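(* Let $\Sigma\in\mathcal F_\alpha$ for some $\alpha>0$, where $\Sigma$ is the covariance matrix of the data distribution described in the context. Consider the blockwise tridiagonal estimator $\hat\Sigma^{\mathsf{DP}}=\mathsf{DPCovTri}(X;k,\rho,R)$ described in the context, with block size $k\le cn$ for some small constant $c>0$. Then $$ \mathbb E\|\hat\Sigma^{\mathsf{DP}}-\Sigma\|^2\;\lesssim\;\frac{k+\log d}{n}+\frac{dk(k+\log d)}{\rho n^2}+k^{-2\alpha}. $$
   Context: Norms: $\|\cdot\|$ is the spectral norm. $\|X\|_{\psi_2}=\sup_{\|v\|_2=1}\inf\{t>0:\mathbb E e^{\langle X,v\rangle^2/t^2}\le2\}$. Model and class. $X_1,\dots,X_n$ are i.i.d. in $\mathbb R^d$ with mean $0$, covariance $\Sigma$ and $\|X_1\|_{\psi_2}\le K$; $K,M_0,M$ are fixed. For $R\subseteq[d]^2$, $\Sigma_R$ is $\Sigma$ with entries outside $R$ set to zero. A block $R=I\times J$ is $k$-off-diagonal if it is contained in $\{(i,j):j\ge i+k\}$ or in $\{(i,j):i\ge j+k\}$. $\mathcal F_\alpha=\mathcal F_\alpha(M_0,M)$ is the set of covariance matrices with $0\preceq\Sigma\preceq M_0I_d$ and $\|\Sigma_R\|\le Mk^{-\alpha}$ for every $k\ge1$ and every $k$-off-diagonal block $R$. Estimator. For a square block $B=I\times J$, budget $\rho_B$ and clipping radius $R$, $\mathsf{DPCovBlock}(X,B;\rho_B,R)$ returns (supported on $B$) $$\frac1n\sum_{i=1}^n\chi_R(X_{i,I})\chi_R(X_{i,J})^\top+\sigma_BM_B,\qquad\sigma_B^2=\frac{18R^4}{\rho_Bn^2},$$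 where $\chi_R(z)=z\min\{1,R/\|z\|_2\}$, $\chi_R(0)=0$, and $M_B$ is the $B$-block of a fresh random symmetric $d\times d$ matrix whose upper triangular entries (including the diagonal) are i.i.d. $N(0,1)$. Given a block size $k\ge1$, the data are padded with deterministic zero coordinates so that $d=2^Jk$ for an integer $J\ge0$ (the estimate of the original $\Sigma$ being the corresponding principal submatrix). Put $N_k=d/k$, $I_{k,\ell}=\{1+(\ell-1)k,\dots,\ell k\}$, $B_{k;\ell,r}=I_{k,\ell}\times I_{k,\ell+r}$. $\mathsf{DPCovTri}(X;k,\rho,R)$ sets $\rho_0=\rho/(2N_k)$, fills each block $B_{k;\ell,r}$ with $r\in\{0,1\}$, $\ell\ge1$, $\ell+r\le N_k$ by $\mathsf{DPCovBlock}(X,B_{k;\ell,r};\rho_0,R)$, fills the lower triangular part by symmetry and sets all other entries to zero. Here $R=CK\sqrt k$ with $C$ a sufficiently large numerical constant. Regime and constants. Statements are along sequences $(n,d,\rho)$, $n\to\infty$, with $d\gtrsim\log n$, $0<\rho\lesssim1$ (fixed upper bound), $d/(\rho n^2)\to0$. $a\lesssim b$ means $a\le C'b$ for all sufficiently large $n$ with $C'$ not depending on $n,d,\rho,k$ or on the particular distribution (it may depend on $\alpha,K,M_0,M$ and the regime constants). *)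

theory Defs
  imports "HOL-Probability.Probability"
begin

text \<open>
  The dimension varies along the asymptotic regime, so vectors in \<open>\<real>\<^sup>d\<close> are functions
  \<open>nat \<Rightarrow> real\<close> and \<open>d \<times> d\<close> matrices are functions \<open>nat \<Rightarrow> nat \<Rightarrow> real\<close>, of which only the
  entries with indices below \<open>d\<close> are used. Indices start at 0. The Euclidean norm of the subvector
  of \<open>v\<close> with index set \<open>I\<close> is \<open>L2_set v I\<close>.
\<close>

section \<open>Norms\<close>

definition spec_norm :: "nat \<Rightarrow> (nat \<Rightarrow> nat \<Rightarrow> real) \<Rightarrow> real" where
  "spec_norm d A =
     (SUP v\<in>{v. L2_set v {..<d} \<le> 1}. L2_set (\<lambda>i. \<Sum>j<d. A i j * v j) {..<d})"

text \<open>
  The value is an extended real and the expectation is a \<open>\<integral>\<^sup>+\<close>: an infinite expectation is not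
  mistaken for 0, and the infimum over an empty set of \<open>t\<close> is \<open>\<infinity>\<close>.
\<close>
definition psi2_norm :: "nat \<Rightarrow> (nat \<Rightarrow> real) measure \<Rightarrow> ennreal" where
  "psi2_norm d P =
     (SUP v\<in>{v. L2_set v {..<d} = 1}.
        INF t\<in>{t::real. 0 < t \<and> (\<integral>\<^sup>+x. ennreal (exp ((\<Sum>i<d. x i * v i)\<^sup>2 / t\<^sup>2)) \<partial>P) \<le> 2}. ennreal t)"


section \<open>Data distributions and the covariance class\<close>

definition mean_vec :: "(nat \<Rightarrow> real) measure \<Rightarrow> nat \<Rightarrow> real" where
  "mean_vec P i = (\<integral>x. x i \<partial>P)"

definition cov_mat :: "(nat \<Rightarrow> real) measure \<Rightarrow> nat \<Rightarrow> nat \<Rightarrow> real" where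
  "cov_mat P i j = (\<integral>x. (x i - mean_vec P i) * (x j - mean_vec P j) \<partial>P)"

text \<open>All moments of a law in the following class are finite because its \<open>\<psi>\<^sub>2\<close> norm is.\<close>
definition data_laws :: "nat \<Rightarrow> real \<Rightarrow> (nat \<Rightarrow> real) measure set" where
  "data_laws d K = {P. prob_space P \<and> sets P = sets (Pi\<^sub>M {..<d} (\<lambda>_. borel)) \<and>
     (\<forall>i<d. mean_vec P i = 0) \<and> psi2_norm d P \<le> ennreal K}"

definition loewner_le :: "nat \<Rightarrow> (nat \<Rightarrow> nat \<Rightarrow> real) \<Rightarrow> (nat \<Rightarrow> nat \<Rightarrow> real) \<Rightarrow> bool" where
  "loewner_le d A B \<longleftrightarrow>
     (\<forall>v. (\<Sum>i<d. \<Sum>j<d. v i * A i j * v j) \<le> (\<Sum>i<d. \<Sum>j<d. v i * B i j * v j))"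

definition mat_restrict :: "(nat \<Rightarrow> nat \<Rightarrow> real) \<Rightarrow> (nat \<times> nat) set \<Rightarrow> nat \<Rightarrow> nat \<Rightarrow> real" where
  "mat_restrict A R i j = (if (i, j) \<in> R then A i j else 0)"

text \<open>
  \<open>I\<close> and \<open>J\<close> need not be intervals. Allowing only intervals gives the same class: the smallest
  intervals containing \<open>I\<close> and \<open>J\<close> again form a \<open>k\<close>-off-diagonal block.
\<close>
definition off_diag_block :: "nat \<Rightarrow> nat \<Rightarrow> (nat \<times> nat) set \<Rightarrow> bool" where
  "off_diag_block d k R \<longleftrightarrow>
     (\<exists>I J. I \<subseteq> {..<d} \<and> J \<subseteq> {..<d} \<and> R = I \<times> J) \<and>
     (R \<subseteq> {(i, j). j \<ge> i + k} \<or> R \<subseteq> {(i, j). i \<ge> j + k})"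

definition cov_class :: "nat \<Rightarrow> real \<Rightarrow> real \<Rightarrow> real \<Rightarrow> (nat \<Rightarrow> nat \<Rightarrow> real) set" where
  "cov_class d \<alpha> M0 M = {S. (\<forall>i<d. \<forall>j<d. S i j = S j i) \<and>
     loewner_le d (\<lambda>_ _. 0) S \<and> loewner_le d S (\<lambda>i j. if i = j then M0 else 0) \<and>
     (\<forall>k\<ge>1. \<forall>R. off_diag_block d k R \<longrightarrow>
        spec_norm d (mat_restrict S R) \<le> M * real k powr (- \<alpha>))}"


section \<open>The estimator\<close>

text \<open>
  \<open>clip R I z\<close> is \<open>\<chi>\<^sub>R\<close> applied to the subvector of \<open>z\<close> with index set \<open>I\<close>; it is 0 if that
  subvector is 0, since then all its factors \<open>z i\<close> vanish.
\<close>
definition clip :: "real \<Rightarrow> nat set \<Rightarrow> (nat \<Rightarrow> real) \<Rightarrow> nat \<Rightarrow> real" where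
  "clip R I z i = z i * min 1 (R / L2_set z I)"

text \<open>
  The data set is \<open>X 0, \<dots>, X (n - 1)\<close>, and \<open>W (i, j)\<close>, \<open>i \<le> j\<close>, are the upper triangular entries
  of the symmetric noise matrix.
\<close>
definition dp_cov_block ::
  "nat \<Rightarrow> (nat \<Rightarrow> nat \<Rightarrow> real) \<Rightarrow> nat set \<Rightarrow> nat set \<Rightarrow> real \<Rightarrow> real \<Rightarrow>
   (nat \<times> nat \<Rightarrow> real) \<Rightarrow> nat \<Rightarrow> nat \<Rightarrow> real" where
  "dp_cov_block n X I J \<rho>B R W i j =
     (if i \<in> I \<and> j \<in> J then
        (1 / real n) * (\<Sum>m<n. clip R I (X m) i * clip R J (X m) j)
        + sqrt (18 * R ^ 4 / (\<rho>B * (real n)\<^sup>2)) * W (min i j, max i j)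
      else 0)"

text \<open>
  The data are padded to the smallest dimension \<open>2 ^ J * k\<close> that is at least \<open>d\<close>;
  \<open>num_blocks d k\<close> is the resulting number \<open>2 ^ J\<close> of index blocks.
\<close>
definition num_blocks :: "nat \<Rightarrow> nat \<Rightarrow> nat" where
  "num_blocks d k = 2 ^ (LEAST J. d \<le> 2 ^ J * k)"

definition pad :: "nat \<Rightarrow> (nat \<Rightarrow> real) \<Rightarrow> nat \<Rightarrow> real" where
  "pad d x i = (if i < d then x i else 0)"

definition idx_block :: "nat \<Rightarrow> nat \<Rightarrow> nat set" where
  "idx_block k l = {l * k..<(l + 1) * k}"

definition tri_blocks :: "nat \<Rightarrow> nat \<Rightarrow> (nat \<times> nat) set" where
  "tri_blocks d k = {(l, r). r \<le> 1 \<and> l + r < num_blocks d k}"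

text \<open>
  \<open>X\<close> are the unpadded data and \<open>W (l, r)\<close> is the fresh noise for the block \<open>(l, r)\<close>. The blocks
  are disjoint and every filled entry on or above the diagonal lies in one of them; an entry below
  the diagonal is copied from the transposed position. The entries with indices below \<open>d\<close> are the
  estimate of the original covariance matrix.
\<close>
definition dp_cov_tri ::
  "nat \<Rightarrow> nat \<Rightarrow> (nat \<Rightarrow> nat \<Rightarrow> real) \<Rightarrow> nat \<Rightarrow> real \<Rightarrow> real \<Rightarrow>
   (nat \<times> nat \<Rightarrow> nat \<times> nat \<Rightarrow> real) \<Rightarrow> nat \<Rightarrow> nat \<Rightarrow> real" where
  "dp_cov_tri n d X k \<rho> R W i j =
     (\<Sum>(l, r)\<in>tri_blocks d k.
        dp_cov_block n (\<lambda>m. pad d (X m)) (idx_block k l) (idx_block k (l + r))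
          (\<rho> / (2 * real (num_blocks d k))) R (W (l, r)) (min i j) (max i j))"

text \<open>
  Joint law of the \<open>n\<close> i.i.d. data vectors and, independently of them, of the independent standard
  Gaussian upper triangular entries of all noise matrices, which have the padded dimension.
\<close>
definition joint_law ::
  "nat \<Rightarrow> nat \<Rightarrow> nat \<Rightarrow> (nat \<Rightarrow> real) measure \<Rightarrow>
   ((nat \<Rightarrow> nat \<Rightarrow> real) \<times> ((nat \<times> nat) \<times> (nat \<times> nat) \<Rightarrow> real)) measure" where
  "joint_law n d k P =
     Pi\<^sub>M {..<n} (\<lambda>_. P) \<Otimes>\<^sub>M
     Pi\<^sub>M (tri_blocks d k \<times> {(i, j). i \<le> j \<and> j < num_blocks d k * k}) (\<lambda>_. std_normal_distribution)"

definition dp_tri_risk ::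
  "nat \<Rightarrow> nat \<Rightarrow> nat \<Rightarrow> real \<Rightarrow> real \<Rightarrow> (nat \<Rightarrow> real) measure \<Rightarrow> ennreal" where
  "dp_tri_risk n d k \<rho> R P =
     (\<integral>\<^sup>+(X, W). ennreal ((spec_norm d (\<lambda>i j.
          dp_cov_tri n d X k \<rho> R (\<lambda>b e. W (b, e)) i j - cov_mat P i j))\<^sup>2) \<partial>joint_law n d k P)"

end

theory Submission
  imports Defs
begin

text \<open>
  The estimation error is a sum of four matrices: the sampling error of the averaged products of
  clipped subvectors, the Gaussian noise, the bias caused by clipping, and the part of \<open>\<Sigma>\<close> outside
  the block tridiagonal band, which the estimator replaces by zero. The first three live on the
  band, where every block row and block column meets at most three blocks, so each of their spectral
  norms is at most three times the largest norm of a block (\<open>op_norm_le_block_band\<close>).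

  Outside the band, passing from block size \<open>b\<close> to \<open>2 b\<close> adds entries that again form a matrix
  with boundedly many \<open>b\<close>-off-diagonal blocks in each block row and column, hence of norm
  \<open>O(b\<^sup>-\<^sup>\<alpha>)\<close>. Summing this over \<open>b = k, 2 k, 4 k, \<dots>\<close> gives a geometric series and the bound
  \<open>O(k\<^sup>-\<^sup>\<alpha>)\<close> (\<open>off_band_op_norm_le\<close>). The bias of a block is caused by the event that one of two
  subvectors of length at most \<open>k\<close> exceeds the radius \<open>C K \<surd>k\<close>; for large \<open>C\<close> it has probability
  \<open>O(e\<^sup>-\<^sup>2\<^sup>k)\<close>, so the bias is \<open>O(e\<^sup>-\<^sup>k)\<close> and therefore \<open>O(k\<^sup>-\<^sup>\<alpha>)\<close> (\<open>clip_bias_op_norm_le\<close>,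
  \<open>exp_minus_le_powr\<close>).

  The norms of the random blocks are reduced to scalars by finite nets (\<open>ex_quarter_net\<close>,
  \<open>op_norm_le_netI\<close>): there are at most three blocks for each of the \<open>N\<close> index blocks and
  \<open>exp (O(k))\<close> pairs of net points for each of them, so one has to control the maximum of
  \<open>e\<^sup>L\<close> scalars with \<open>L = O(k + ln d)\<close>. A scalar of the sampling error is a centred mean of \<open>n\<close>
  independent products of two subgaussian variables, so its moment generating function is at most that of a
  Gaussian of variance \<open>O(1/n)\<close> for arguments up to a multiple of \<open>n\<close>; a scalar of the noise is
  Gaussian of bounded variance. In both cases a second moment of the maximum of order variance
  times \<open>L\<close> follows from one pointwise inequality without integrating tails
  (\<open>square_le_threshold_plus_exp\<close>, \<open>maximal_second_moment\<close>). For the sampling error this needs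
  \<open>L = O(n)\<close>, which is what \<open>k \<le> n\<close> and the polynomial growth of \<open>d\<close> in \<open>n\<close> provide.
  For the noise, the factor \<open>N k L\<close> that comes from splitting the privacy budget over the blocks is
  \<open>O(d (k + ln d))\<close>: either \<open>N k \<le> 2 d\<close>, or there is a single block with only \<open>d\<close> relevant
  indices (\<open>num_blocks_log_net_size_le\<close>).
\<close>

section \<open>Bilinear forms and operator norms of blocks\<close>

definition bilin :: "nat set \<Rightarrow> nat set \<Rightarrow> (nat \<Rightarrow> nat \<Rightarrow> real) \<Rightarrow> (nat \<Rightarrow> real) \<Rightarrow> (nat \<Rightarrow> real) \<Rightarrow> real" where
  "bilin I J A u v = (\<Sum>i\<in>I. \<Sum>j\<in>J. u i * A i j * v j)"

text \<open>
  A homogeneous bound on the bilinear form rather than an operator norm: it needs no supremum, it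
  makes sense on every pair of index sets, and it is inherited by submatrices.
\<close>
definition op_norm_le :: "nat set \<Rightarrow> nat set \<Rightarrow> (nat \<Rightarrow> nat \<Rightarrow> real) \<Rightarrow> real \<Rightarrow> bool" where
  "op_norm_le I J A \<beta> \<longleftrightarrow> (\<forall>u v. \<bar>bilin I J A u v\<bar> \<le> \<beta> * L2_set u I * L2_set v J)"

lemma bilin_add: "bilin I J (\<lambda>i j. A i j + B i j) u v = bilin I J A u v + bilin I J B u v"
  by (simp add: bilin_def algebra_simps sum.distrib)

lemma bilin_scale: "bilin I J (\<lambda>i j. c * A i j) u v = c * bilin I J A u v"
  by (simp add: bilin_def algebra_simps sum_distrib_left)

lemma bilin_scale_left: "bilin I J A (\<lambda>i. c * u i) v = c * bilin I J A u v"
  by (simp add: bilin_def algebra_simps sum_distrib_left)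

lemma bilin_scale_right: "bilin I J A u (\<lambda>i. c * v i) = c * bilin I J A u v"
  by (simp add: bilin_def algebra_simps sum_distrib_left)

lemma bilin_diff_left: "bilin I J A (\<lambda>i. u i - u' i) v = bilin I J A u v - bilin I J A u' v"
  by (simp add: bilin_def algebra_simps sum_subtractf)

lemma bilin_diff_right: "bilin I J A u (\<lambda>i. v i - v' i) = bilin I J A u v - bilin I J A u v'"
  by (simp add: bilin_def algebra_simps sum_subtractf)

lemma bilin_cong:
  assumes "\<And>i j. i \<in> I \<Longrightarrow> j \<in> J \<Longrightarrow> A i j = B i j"
    and "\<And>i. i \<in> I \<Longrightarrow> u i = u' i" and "\<And>j. j \<in> J \<Longrightarrow> v j = v' j"
  shows "bilin I J A u v = bilin I J B u' v'"
  using assms by (simp add: bilin_def)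

lemma op_norm_leD: "op_norm_le I J A \<beta> \<Longrightarrow> \<bar>bilin I J A u v\<bar> \<le> \<beta> * L2_set u I * L2_set v J"
  by (simp add: op_norm_le_def)

lemma op_norm_le_cong:
  assumes "\<And>i j. i \<in> I \<Longrightarrow> j \<in> J \<Longrightarrow> A i j = B i j"
  shows "op_norm_le I J A \<beta> \<longleftrightarrow> op_norm_le I J B \<beta>"
  using bilin_cong[of I J A B] assms by (simp add: op_norm_le_def)

lemma op_norm_le_add:
  assumes "op_norm_le I J A \<alpha>" "op_norm_le I J B \<beta>"
  shows "op_norm_le I J (\<lambda>i j. A i j + B i j) (\<alpha> + \<beta>)"
  unfolding op_norm_le_def
proof (intro allI)
  fix u v
  show "\<bar>bilin I J (\<lambda>i j. A i j + B i j) u v\<bar> \<le> (\<alpha> + \<beta>) * L2_set u I * L2_set v J"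
    using op_norm_leD[OF assms(1), of u v] op_norm_leD[OF assms(2), of u v]
    by (simp add: bilin_add algebra_simps)
qed

lemma op_norm_le_scale:
  assumes "op_norm_le I J A \<beta>"
  shows "op_norm_le I J (\<lambda>i j. c * A i j) (\<bar>c\<bar> * \<beta>)"
  using assms by (auto simp: op_norm_le_def bilin_scale abs_mult mult.assoc intro!: mult_left_mono)

lemma op_norm_le_zero: "op_norm_le I J (\<lambda>i j. 0) 0"
  by (simp add: op_norm_le_def bilin_def)

lemma op_norm_le_mono:
  assumes "op_norm_le I J A \<alpha>" "\<alpha> \<le> \<beta>" shows "op_norm_le I J A \<beta>"
  unfolding op_norm_le_def
proof (intro allI)
  fix u v
  have "\<alpha> * L2_set u I * L2_set v J \<le> \<beta> * L2_set u I * L2_set v J"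
    using assms(2) by (intro mult_right_mono) auto
  then show "\<bar>bilin I J A u v\<bar> \<le> \<beta> * L2_set u I * L2_set v J"
    using op_norm_leD[OF assms(1), of u v] by linarith
qed

text \<open>
  Both signs come for free, since \<open>-u\<close> has the same norm as \<open>u\<close>.
\<close>
lemma op_norm_le_unitI:
  assumes fin: "finite I" "finite J"
    and unit: "\<And>u v. L2_set u I \<le> 1 \<Longrightarrow> L2_set v J \<le> 1 \<Longrightarrow> bilin I J A u v \<le> \<beta>"
  shows "op_norm_le I J A \<beta>"
  unfolding op_norm_le_def
proof (intro allI)
  fix u v
  define a where "a = L2_set u I"
  define b where "b = L2_set v J"
  show "\<bar>bilin I J A u v\<bar> \<le> \<beta> * L2_set u I * L2_set v J"
  proof (cases "a = 0 \<or> b = 0")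
    case True
    then have "(\<forall>i\<in>I. u i = 0) \<or> (\<forall>j\<in>J. v j = 0)"
      using fin by (auto simp: a_def b_def L2_set_eq_0_iff)
    then have "bilin I J A u v = 0" by (auto simp: bilin_def)
    with True show ?thesis by (auto simp: a_def b_def)
  next
    case False
    then have pos: "a > 0" "b > 0" by (simp_all add: a_def b_def less_le)
    have *: "s * bilin I J A u v \<le> \<beta> * a * b" if "\<bar>s\<bar> = 1" for s
    proof -
      have "L2_set (\<lambda>i. s / a * u i) I \<le> 1"
        using pos that L2_set_right_distrib[of "1/a" "\<lambda>i. s * u i" I]
        by (simp add: L2_set_def power_mult_distrib power_divide a_def sum_divide_distrib[symmetric]
            real_sqrt_divide) (metis abs_1 divide_self_if mult_1 order_refl power2_abs power_one sum_distrib_left)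
      moreover have "L2_set (\<lambda>i. 1 / b * v i) J \<le> 1"
        using pos L2_set_right_distrib[of "1/b" v J] by (simp add: b_def)
      ultimately have "bilin I J A (\<lambda>i. s / a * u i) (\<lambda>i. 1 / b * v i) \<le> \<beta>" by (rule unit)
      then show ?thesis using pos
        unfolding bilin_scale_left bilin_scale_right by (simp add: field_simps)
    qed
    show ?thesis using *[of 1] *[of "-1"] by (simp add: a_def b_def abs_le_iff)
  qed
qed

lemma op_norm_le_restrict:
  assumes "op_norm_le I J A \<beta>" "I' \<subseteq> I" "J' \<subseteq> J" "finite I" "finite J"
  shows "op_norm_le I' J' A \<beta>"
  unfolding op_norm_le_def
proof (intro allI)
  fix u v :: "nat \<Rightarrow> real"
  let ?u = "\<lambda>i. if i \<in> I' then u i else 0" and ?v = "\<lambda>j. if j \<in> J' then v j else 0"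
  have "bilin I J A ?u ?v = (\<Sum>i\<in>I'. \<Sum>j\<in>J. ?u i * A i j * ?v j)"
    unfolding bilin_def using assms by (intro sum.mono_neutral_right) auto
  also have "\<dots> = (\<Sum>i\<in>I'. \<Sum>j\<in>J'. ?u i * A i j * ?v j)"
    using assms by (intro sum.cong refl sum.mono_neutral_right) auto
  also have "\<dots> = bilin I' J' A u v" by (simp add: bilin_def)
  finally have b: "bilin I J A ?u ?v = bilin I' J' A u v" .
  have "(\<Sum>i\<in>I. (?u i)\<^sup>2) = (\<Sum>i\<in>I'. (?u i)\<^sup>2)"
    using assms by (intro sum.mono_neutral_right) auto
  then have l: "L2_set ?u I = L2_set u I'" by (simp add: L2_set_def)
  have "(\<Sum>i\<in>J. (?v i)\<^sup>2) = (\<Sum>i\<in>J'. (?v i)\<^sup>2)"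
    using assms by (intro sum.mono_neutral_right) auto
  then have r: "L2_set ?v J = L2_set v J'" by (simp add: L2_set_def)
  show "\<bar>bilin I' J' A u v\<bar> \<le> \<beta> * L2_set u I' * L2_set v J'"
    using op_norm_leD[OF assms(1), of ?u ?v] by (simp only: b l r)
qed

lemma L2_set_square: "(L2_set f I)\<^sup>2 = (\<Sum>i\<in>I. (f i)\<^sup>2)"
  by (simp add: L2_set_def sum_nonneg)

lemma sum_mult_le_L2: "(\<Sum>i\<in>I. f i * g i) \<le> L2_set f I * L2_set g I"
proof -
  have "(\<Sum>i\<in>I. f i * g i) \<le> (\<Sum>i\<in>I. \<bar>f i\<bar> * \<bar>g i\<bar>)"
    by (intro sum_mono) (metis abs_ge_self abs_mult)
  then show ?thesis using L2_set_mult_ineq order_trans by blast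
qed

lemma bilin_eq_sum: "bilin I J A u v = (\<Sum>i\<in>I. u i * (\<Sum>j\<in>J. A i j * v j))"
  by (simp add: bilin_def sum_distrib_left mult.assoc)

text \<open>
  Testing the form against the image vector \<open>w = A v\<close> itself turns it into \<open>\<parallel>w\<parallel>\<^sup>2\<close>.
\<close>
lemma op_norm_le_image:
  assumes "op_norm_le I J A \<beta>" "0 \<le> \<beta>" "L2_set v J \<le> 1"
  shows "L2_set (\<lambda>i. \<Sum>j\<in>J. A i j * v j) I \<le> \<beta>"
proof -
  define w where "w = (\<lambda>i. \<Sum>j\<in>J. A i j * v j)"
  have "(L2_set w I)\<^sup>2 = bilin I J A w v"
    unfolding L2_set_square bilin_eq_sum w_def by (simp add: power2_eq_square)
  also have "\<dots> \<le> \<beta> * L2_set w I * L2_set v J"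
    using op_norm_leD[OF assms(1), of w v] by linarith
  also have "\<dots> \<le> \<beta> * L2_set w I" using assms by (simp add: mult_left_le)
  finally have "L2_set w I * L2_set w I \<le> \<beta> * L2_set w I" by (simp add: power2_eq_square)
  then show ?thesis unfolding w_def[symmetric]
    using assms(2) L2_set_nonneg[of w I] mult_right_le_imp_le[of "L2_set w I" "L2_set w I" \<beta>]
    by (cases "L2_set w I = 0") (simp_all add: less_le)
qed

lemma spec_norm_le:
  assumes "op_norm_le {..<d} {..<d} A \<beta>" "0 \<le> \<beta>"
  shows "0 \<le> spec_norm d A" "spec_norm d A \<le> \<beta>"
proof -
  have 0: "(\<lambda>_. 0) \<in> {v. L2_set v {..<d} \<le> 1}" by (simp add: L2_set_def)
  have le: "L2_set (\<lambda>i. \<Sum>j<d. A i j * v j) {..<d} \<le> \<beta>" if "v \<in> {v. L2_set v {..<d} \<le> 1}" for v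
    using op_norm_le_image[OF assms] that by auto
  show "spec_norm d A \<le> \<beta>" unfolding spec_norm_def
    using 0 le by (intro cSUP_least) auto
  have "L2_set (\<lambda>i. \<Sum>j<d. A i j * 0) {..<d} \<le> spec_norm d A" unfolding spec_norm_def
    using le by (intro cSUP_upper[OF 0, of "\<lambda>v. L2_set (\<lambda>i. \<Sum>j<d. A i j * v j) {..<d}"]) (auto intro!: bdd_aboveI[of _ \<beta>])
  then show "0 \<le> spec_norm d A" by (simp add: L2_set_def)
qed

lemma op_norm_le_of_spec_norm:
  assumes "spec_norm d A \<le> \<beta>"
  shows "op_norm_le {..<d} {..<d} A \<beta>"
proof (rule op_norm_le_unitI)
  fix u v assume u: "L2_set u {..<d} \<le> 1" and v: "L2_set v {..<d} \<le> 1"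
  let ?F = "\<lambda>v. L2_set (\<lambda>i. \<Sum>j<d. A i j * v j) {..<d}"
  have bd: "?F v \<le> (\<Sum>i<d. \<Sum>j<d. \<bar>A i j\<bar>)" if "L2_set v {..<d} \<le> 1" for v
  proof -
    have "?F v \<le> (\<Sum>i<d. \<bar>\<Sum>j<d. A i j * v j\<bar>)" by (rule L2_set_le_sum_abs)
    also have "\<dots> \<le> (\<Sum>i<d. \<Sum>j<d. \<bar>A i j\<bar>)"
    proof (rule sum_mono, rule order_trans[OF sum_abs], rule sum_mono)
      fix i j assume "j \<in> {..<d}"
      then have "\<bar>v j\<bar> \<le> L2_set (\<lambda>j. \<bar>v j\<bar>) {..<d}" by (intro member_le_L2_set) auto
      also have "\<dots> \<le> 1" using that by (simp add: L2_set_def)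
      finally have "\<bar>v j\<bar> \<le> 1" .
      then show "\<bar>A i j * v j\<bar> \<le> \<bar>A i j\<bar>" by (metis abs_ge_zero abs_mult mult_left_le)
    qed
    finally show ?thesis .
  qed
  have "bdd_above (?F ` {v. L2_set v {..<d} \<le> 1})"
    using bd by (intro bdd_aboveI2[of _ _ "\<Sum>i<d. \<Sum>j<d. \<bar>A i j\<bar>"]) blast
  then have "?F v \<le> spec_norm d A" unfolding spec_norm_def
    using v by (intro cSUP_upper[where f = ?F]) simp_all
  then have F: "?F v \<le> \<beta>" using assms by linarith
  have "bilin {..<d} {..<d} A u v \<le> L2_set u {..<d} * ?F v"
    unfolding bilin_eq_sum using sum_mult_le_L2[of u "\<lambda>i. \<Sum>j<d. A i j * v j" "{..<d}"] .
  also have "\<dots> \<le> 1 * \<beta>" using u F by (intro mult_mono) auto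
  finally show "bilin {..<d} {..<d} A u v \<le> \<beta>" by simp
qed auto

definition nat_gap :: "nat \<Rightarrow> nat \<Rightarrow> nat" where
  "nat_gap p q = max p q - min p q"

text \<open>
  The block length is a parameter because the dyadic argument doubles it. Cutting the blocks off at
  \<open>d\<close> removes the padding from the argument and keeps their size at most \<open>min b d\<close>.
\<close>
definition index_block :: "nat \<Rightarrow> nat \<Rightarrow> nat \<Rightarrow> nat set" where
  "index_block d b p = {i. i < d \<and> i div b = p}"

lemma finite_index_block [simp]: "finite (index_block d b p)"
  by (simp add: index_block_def)

lemma sum_by_index_blocks: "(\<Sum>i<d. f i) = (\<Sum>p<d. \<Sum>i\<in>index_block d b p. f i)"
  for f :: "nat \<Rightarrow> real"
proof -
  have "(\<lambda>i. i div b) ` {..<d} \<subseteq> {..<d}"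
    by (auto intro: le_less_trans[OF div_le_dividend])
  then have "(\<Sum>p<d. \<Sum>i\<in>{i\<in>{..<d}. i div b = p}. f i) = (\<Sum>i<d. f i)"
    by (intro sum.group) auto
  then show ?thesis by (simp add: index_block_def)
qed

text \<open>
  Cauchy--Schwarz for block matrices: each of the products \<open>\<parallel>u\<^sub>p\<parallel> \<parallel>v\<^sub>q\<parallel>\<close> of block norms is split by
  the inequality between the geometric and the arithmetic mean, and a given \<open>p\<close> has at most
  \<open>2 h + 1\<close> partners \<open>q\<close> at distance at most \<open>h\<close>.
\<close>
lemma op_norm_le_block_band:
  assumes zero: "\<And>i j. i < d \<Longrightarrow> j < d \<Longrightarrow> nat_gap (i div b) (j div b) > h \<Longrightarrow> A i j = 0"
    and bl: "\<And>p q. nat_gap p q \<le> h \<Longrightarrow> op_norm_le (index_block d b p) (index_block d b q) A \<beta>"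
    and \<beta>: "0 \<le> \<beta>"
  shows "op_norm_le {..<d} {..<d} A ((2 * real h + 1) * \<beta>)"
proof (rule op_norm_le_unitI)
  fix u v assume u: "L2_set u {..<d} \<le> 1" and v: "L2_set v {..<d} \<le> 1"
  let ?I = "index_block d b"
  let ?a = "\<lambda>p. L2_set u (?I p)" and ?c = "\<lambda>q. L2_set v (?I q)"
  let ?N = "\<lambda>p. {q. q < d \<and> nat_gap p q \<le> h}"
  have cardN: "real (card (?N p)) \<le> 2 * real h + 1" for p
  proof -
    have "?N p \<subseteq> {p - h..p + h}" by (auto simp: nat_gap_def)
    then have "card (?N p) \<le> card {p - h..p + h}" by (intro card_mono) auto
    also have "\<dots> \<le> 2 * h + 1" by simp
    finally have "real (card (?N p)) \<le> real (2 * h + 1)" by (rule of_nat_mono)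
    then show ?thesis by simp
  qed
  have mass: "(\<Sum>p<d. (?a p)\<^sup>2) \<le> 1" "(\<Sum>q<d. (?c q)\<^sup>2) \<le> 1"
  proof -
    have "(\<Sum>p<d. (L2_set x (?I p))\<^sup>2) \<le> 1" if "L2_set x {..<d} \<le> 1" for x
    proof -
      have "(\<Sum>p<d. (L2_set x (?I p))\<^sup>2) = (\<Sum>i<d. (x i)\<^sup>2)"
        unfolding L2_set_square by (rule sum_by_index_blocks[symmetric])
      also have "\<dots> \<le> 1" using that by (simp add: L2_set_def)
      finally show ?thesis .
    qed
    then show "(\<Sum>p<d. (?a p)\<^sup>2) \<le> 1" "(\<Sum>q<d. (?c q)\<^sup>2) \<le> 1" using u v by blast+
  qed
  have row: "(\<Sum>p<d. \<Sum>q<d. if nat_gap p q \<le> h then (x p)\<^sup>2 else 0) \<le> 2 * real h + 1"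
    if "(\<Sum>p<d. (x p)\<^sup>2) \<le> 1" for x :: "nat \<Rightarrow> real"
  proof -
    have "(\<Sum>p<d. \<Sum>q<d. if nat_gap p q \<le> h then (x p)\<^sup>2 else 0) = (\<Sum>p<d. real (card (?N p)) * (x p)\<^sup>2)"
    proof (rule sum.cong[OF refl])
      fix p
      have "(\<Sum>q<d. if nat_gap p q \<le> h then (x p)\<^sup>2 else 0) = (\<Sum>q\<in>{q\<in>{..<d}. nat_gap p q \<le> h}. (x p)\<^sup>2)"
        by (rule sum.inter_filter[symmetric]) simp
      also have "{q\<in>{..<d}. nat_gap p q \<le> h} = ?N p" by auto
      finally show "(\<Sum>q<d. if nat_gap p q \<le> h then (x p)\<^sup>2 else 0) = real (card (?N p)) * (x p)\<^sup>2" by simp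
    qed
    also have "\<dots> \<le> (\<Sum>p<d. (2 * real h + 1) * (x p)\<^sup>2)"
      by (rule sum_mono, rule mult_right_mono[OF cardN]) simp
    also have "\<dots> = (2 * real h + 1) * (\<Sum>p<d. (x p)\<^sup>2)" by (rule sum_distrib_left[symmetric])
    also have "\<dots> \<le> (2 * real h + 1) * 1" using that by (intro mult_left_mono) auto
    finally show ?thesis by simp
  qed
  let ?S1 = "\<Sum>p<d. \<Sum>q<d. if nat_gap p q \<le> h then (?a p)\<^sup>2 else 0"
  let ?S2 = "\<Sum>p<d. \<Sum>q<d. if nat_gap p q \<le> h then (?c q)\<^sup>2 else 0"
  have S1: "?S1 \<le> 2 * real h + 1" using row[OF mass(1)] .
  have "?S2 = (\<Sum>q<d. \<Sum>p<d. if nat_gap p q \<le> h then (?c q)\<^sup>2 else 0)" by (rule sum.swap)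
  also have "\<dots> = (\<Sum>q<d. \<Sum>p<d. if nat_gap q p \<le> h then (?c q)\<^sup>2 else 0)"
    by (simp add: nat_gap_def max.commute min.commute)
  also have "\<dots> \<le> 2 * real h + 1" using row[OF mass(2)] .
  finally have S2: "?S2 \<le> 2 * real h + 1" .
  have "bilin {..<d} {..<d} A u v = (\<Sum>p<d. \<Sum>i\<in>?I p. \<Sum>q<d. \<Sum>j\<in>?I q. u i * A i j * v j)"
  proof -
    have "bilin {..<d} {..<d} A u v = (\<Sum>i<d. \<Sum>q<d. \<Sum>j\<in>?I q. u i * A i j * v j)"
      unfolding bilin_def by (rule sum.cong[OF refl], rule sum_by_index_blocks)
    then show ?thesis
      using sum_by_index_blocks[where b = b, of "\<lambda>i. \<Sum>q<d. \<Sum>j\<in>?I q. u i * A i j * v j" d] by simp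
  qed
  also have "\<dots> = (\<Sum>p<d. \<Sum>q<d. bilin (?I p) (?I q) A u v)"
    unfolding bilin_def by (rule sum.cong[OF refl], rule sum.swap)
  also have "\<dots> \<le> (\<Sum>p<d. \<Sum>q<d. if nat_gap p q \<le> h then \<beta> * ((?a p)\<^sup>2 / 2 + (?c q)\<^sup>2 / 2) else 0)"
  proof (intro sum_mono)
    fix p q
    show "bilin (?I p) (?I q) A u v \<le> (if nat_gap p q \<le> h then \<beta> * ((?a p)\<^sup>2 / 2 + (?c q)\<^sup>2 / 2) else 0)"
    proof (cases "nat_gap p q \<le> h")
      case True
      have "bilin (?I p) (?I q) A u v \<le> \<beta> * (?a p * ?c q)"
        using op_norm_leD[OF bl[OF True], of u v] by (simp add: mult.assoc)
      moreover have "\<beta> * (?a p * ?c q) \<le> \<beta> * ((?a p)\<^sup>2 / 2 + (?c q)\<^sup>2 / 2)"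
        using sum_squares_bound[of "?a p" "?c q"] \<beta> by (intro mult_left_mono) auto
      ultimately show ?thesis using True by simp
    next
      case False
      then have "bilin (?I p) (?I q) A u v = 0"
        unfolding bilin_def using zero by (intro sum.neutral ballI) (auto simp: index_block_def)
      then show ?thesis using False by simp
    qed
  qed
  also have "\<dots> = \<beta> / 2 * (?S1 + ?S2)"
    unfolding sum.distrib[symmetric] sum_distrib_left
    by (rule sum.cong[OF refl], rule sum.cong[OF refl]) (simp add: field_simps)
  also have "\<dots> \<le> \<beta> / 2 * ((2 * real h + 1) + (2 * real h + 1))"
    using \<beta> S1 S2 by (intro mult_left_mono add_mono) auto
  also have "\<dots> = (2 * real h + 1) * \<beta>" by simp
  finally show "bilin {..<d} {..<d} A u v \<le> (2 * real h + 1) * \<beta>" .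
qed auto

section \<open>Nets of lattice points in Euclidean balls\<close>

definition quarter_net :: "nat set \<Rightarrow> (nat \<Rightarrow> real) set \<Rightarrow> bool" where
  "quarter_net I S \<longleftrightarrow> finite S \<and> (\<forall>u\<in>S. L2_set u I \<le> 1) \<and>
     (\<forall>v. L2_set v I \<le> 1 \<longrightarrow> (\<exists>u\<in>S. L2_set (\<lambda>i. v i - u i) I \<le> 1 / 4))"

text \<open>
  In dimension \<open>m\<close> the net consists of points \<open>h z\<close> with \<open>h = 1 / (4 \<surd>m)\<close> and integral \<open>z\<close> of
  \<open>\<ell>\<^sub>1\<close> norm at most \<open>16 m\<close>. The factor \<open>2 ^ 16\<close> per dimension pays for the norm, and the factor 3 is
  the total weight of the integers when \<open>t\<close> has weight \<open>2\<^sup>-\<^sup>|\<^sup>t\<^sup>|\<close>.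
\<close>
abbreviation net_base :: real where "net_base \<equiv> 3 * 2 ^ 16"

lemma sum_geometric_weights:
  "(\<Sum>t\<in>{- int T..int T}. (1/2 :: real) ^ nat \<bar>t\<bar>) = 3 - 2 * (1/2) ^ T"
proof (induction T)
  case (Suc T)
  have "{- int (Suc T)..int (Suc T)} = insert (- int (Suc T)) (insert (int (Suc T)) {- int T..int T})"
    by auto
  then show ?case using Suc by (simp add: nat_add_distrib)
qed simp

text \<open>
  An exponential Chebyshev bound for the counting measure: every point that is counted has weight
  \<open>\<Prod> 2\<^sup>-\<^sup>|\<^sup>z\<^sup>i\<^sup>|\<close> at least \<open>2\<^sup>-\<^sup>N\<close>, and the total weight factorises over the coordinates.
\<close>
lemma card_small_integer_points:
  assumes "finite I"
  shows "real (card {z \<in> PiE I (\<lambda>_. {- int T..int T}). (\<Sum>i\<in>I. \<bar>z i\<bar>) \<le> int N}) \<le> 2 ^ N * 3 ^ card I"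
proof -
  let ?P = "PiE I (\<lambda>_. {- int T..int T})"
  let ?Z = "{z \<in> ?P. (\<Sum>i\<in>I. \<bar>z i\<bar>) \<le> int N}"
  let ?w = "\<lambda>z. \<Prod>i\<in>I. (1/2 :: real) ^ nat \<bar>z i\<bar>"
  have finP: "finite ?P" using assms by (intro finite_PiE) auto
  have "1 \<le> 2 ^ N * ?w z" if "z \<in> ?Z" for z
  proof -
    have "?w z = (1/2) ^ (\<Sum>i\<in>I. nat \<bar>z i\<bar>)" by (simp add: power_sum)
    moreover have "int (\<Sum>i\<in>I. nat \<bar>z i\<bar>) \<le> int N" using that by simp
    then have "(\<Sum>i\<in>I. nat \<bar>z i\<bar>) \<le> N" by (simp only: of_nat_le_iff)
    then have "(1/2 :: real) ^ N \<le> (1/2) ^ (\<Sum>i\<in>I. nat \<bar>z i\<bar>)" by (intro power_decreasing) auto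
    ultimately have "2 ^ N * (1/2 :: real) ^ N \<le> 2 ^ N * ?w z" by (intro mult_left_mono) auto
    then show ?thesis by (simp add: power_mult_distrib[symmetric])
  qed
  then have "(\<Sum>z\<in>?Z. 1) \<le> (\<Sum>z\<in>?Z. 2 ^ N * ?w z)" by (intro sum_mono)
  also have "\<dots> \<le> (\<Sum>z\<in>?P. 2 ^ N * ?w z)"
    using finP by (intro sum_mono2) (auto intro!: mult_nonneg_nonneg prod_nonneg)
  also have "\<dots> = 2 ^ N * (\<Sum>z\<in>?P. ?w z)" by (simp only: sum_distrib_left)
  also have "(\<Sum>z\<in>?P. ?w z) = (\<Prod>i\<in>I. \<Sum>t\<in>{- int T..int T}. (1/2 :: real) ^ nat \<bar>t\<bar>)"
    using assms by (subst prod_sum_PiE[symmetric]) auto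
  also have "\<dots> = (3 - 2 * (1/2) ^ T) ^ card I" by (simp only: sum_geometric_weights prod_constant)
  also have "2 ^ N * (3 - 2 * (1/2 :: real) ^ T) ^ card I \<le> 2 ^ N * 3 ^ card I"
  proof -
    have "(1/2 :: real) ^ T \<le> 1" by (rule power_le_one) auto
    then show ?thesis by (intro mult_left_mono power_mono) auto
  qed
  finally show ?thesis by simp
qed

lemma ex_round_toward_zero:
  fixes x h :: real assumes "0 < h"
  shows "\<exists>z::int. \<bar>z * h\<bar> \<le> \<bar>x\<bar> \<and> \<bar>x - z * h\<bar> \<le> h"
proof -
  have nonneg: "\<lfloor>y / h\<rfloor> * h \<le> y" "y - \<lfloor>y / h\<rfloor> * h \<le> h" "0 \<le> \<lfloor>y / h\<rfloor> * h" if "0 \<le> y" for y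
    using assms that floor_correct[of "y / h"]
    by (auto simp: pos_le_divide_eq[OF assms] pos_divide_less_eq[OF assms] algebra_simps)
  show ?thesis
  proof (cases "0 \<le> x")
    case True
    then show ?thesis using nonneg[of x] by (intro exI[of _ "\<lfloor>x / h\<rfloor>"]) auto
  next
    case False
    define z where "z = \<lfloor>(- x) / h\<rfloor>"
    have "z * h \<le> - x" "- x - z * h \<le> h" "0 \<le> z * h" using nonneg[of "- x"] False by (simp_all add: z_def)
    then show ?thesis using False by (intro exI[of _ "- z"]) auto
  qed
qed

text \<open>
  Rounding every coordinate toward zero to the lattice of width \<open>h\<close> never leaves the unit ball and
  moves the vector by at most \<open>h \<surd>m = 1/4\<close>. Since \<open>|z| \<le> z\<^sup>2\<close> for integers, a lattice point of the unit
  ball has \<open>\<ell>\<^sub>1\<close> norm at most \<open>1 / h\<^sup>2 = 16 m\<close> in lattice units, so few points are used.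
\<close>
lemma ex_quarter_net:
  assumes fin: "finite I"
  shows "\<exists>S. quarter_net I S \<and> real (card S) \<le> net_base ^ card I"
proof (cases "I = {}")
  case True
  then show ?thesis by (intro exI[of _ "{\<lambda>_. 0}"]) (simp add: quarter_net_def)
next
  case False
  define m where "m = card I"
  have m: "m > 0" using fin False by (simp add: m_def card_gt_0_iff)
  define h where "h = 1 / (4 * sqrt m)"
  have h: "h > 0" "h\<^sup>2 = 1 / (16 * m)" using m by (auto simp: h_def power_divide power_mult_distrib)
  define Z where "Z = {z \<in> PiE I (\<lambda>_. {- int (16 * m)..int (16 * m)}). (\<Sum>i\<in>I. \<bar>z i\<bar>) \<le> int (16 * m)}"
  define S where "S = {u \<in> (\<lambda>z i. real_of_int (z i) * h) ` Z. L2_set u I \<le> 1}"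
  have finZ: "finite Z" unfolding Z_def using fin by (intro finite_subset[OF Collect_subset] finite_PiE) auto
  have finS: "finite S" using finZ by (auto simp: S_def)
  have "card S \<le> card Z" unfolding S_def
    using finZ by (intro order_trans[OF card_mono card_image_le[of Z]]) auto
  then have "real (card S) \<le> real (card Z)" by simp
  also have "\<dots> \<le> 2 ^ (16 * m) * 3 ^ card I"
    unfolding Z_def by (rule card_small_integer_points[OF fin])
  also have "\<dots> = net_base ^ card I"
    unfolding m_def power_mult power_mult_distrib by (simp only: mult.commute)
  finally have cardS: "real (card S) \<le> net_base ^ card I" .
  have "\<exists>u\<in>S. L2_set (\<lambda>i. v i - u i) I \<le> 1 / 4" if v: "L2_set v I \<le> 1" for v
  proof -
    have "\<forall>i. \<exists>z::int. \<bar>z * h\<bar> \<le> \<bar>v i\<bar> \<and> \<bar>v i - z * h\<bar> \<le> h"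
      using ex_round_toward_zero[OF h(1)] by blast
    from choice[OF this] obtain z :: "nat \<Rightarrow> int"
      where z: "\<And>i. \<bar>z i * h\<bar> \<le> \<bar>v i\<bar>" "\<And>i. \<bar>v i - z i * h\<bar> \<le> h"
      by blast
    define u where "u = (\<lambda>i. real_of_int (restrict z I i) * h)"
    have u_le: "L2_set u I \<le> 1"
    proof -
      have "L2_set u I = L2_set (\<lambda>i. \<bar>z i * h\<bar>) I" by (simp add: u_def L2_set_def)
      also have "\<dots> \<le> L2_set (\<lambda>i. \<bar>v i\<bar>) I" using z by (intro L2_set_mono) auto
      also have "\<dots> = L2_set v I" by (simp add: L2_set_def)
      finally show ?thesis using v by simp
    qed
    have "real_of_int (\<Sum>i\<in>I. \<bar>restrict z I i\<bar>) \<le> (\<Sum>i\<in>I. (real_of_int (z i))\<^sup>2)"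
    proof -
      have "\<bar>t\<bar> \<le> t\<^sup>2" for t :: int
        by (metis abs_le_square_iff abs_of_nonneg abs_ge_zero abs_idempotent int_one_le_iff_zero_less
            linorder_not_less mult_le_cancel_left1 power2_abs power2_eq_square order.order_iff_strict zero_less_abs_iff abs_0 power_zero_numeral)
      then have "real_of_int \<bar>t\<bar> \<le> (real_of_int t)\<^sup>2" for t :: int
        by (metis of_int_le_iff of_int_power)
      then show ?thesis by (simp add: sum_mono)
    qed
    also have "\<dots> = (L2_set u I)\<^sup>2 / h\<^sup>2"
      using h(1) by (simp add: L2_set_square u_def power_mult_distrib sum_distrib_right[symmetric])
    also have "\<dots> \<le> 1 / h\<^sup>2" using u_le by (intro divide_right_mono) (auto simp: power_le_one)
    also have "\<dots> = real_of_int (int (16 * m))" using h(2) by simp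
    finally have sumz: "(\<Sum>i\<in>I. \<bar>restrict z I i\<bar>) \<le> int (16 * m)" by (simp only: of_int_le_iff)
    have "\<bar>z i\<bar> \<le> int (16 * m)" if "i \<in> I" for i
      using sumz member_le_sum[of i I "\<lambda>i. \<bar>restrict z I i\<bar>"] that fin by simp
    then have "restrict z I \<in> PiE I (\<lambda>_. {- int (16 * m)..int (16 * m)})" by force
    then have "restrict z I \<in> Z" using sumz unfolding Z_def by blast
    then have "u \<in> (\<lambda>z i. real_of_int (z i) * h) ` Z" unfolding u_def by (rule imageI)
    then have "u \<in> S" using u_le by (simp add: S_def)
    moreover have "L2_set (\<lambda>i. v i - u i) I \<le> 1 / 4"
    proof -
      have "L2_set (\<lambda>i. v i - u i) I = L2_set (\<lambda>i. \<bar>v i - z i * h\<bar>) I"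
        by (simp add: L2_set_def u_def)
      also have "\<dots> \<le> L2_set (\<lambda>i. h) I" using z by (intro L2_set_mono) auto
      also have "\<dots> = 1 / 4" using m by (simp add: L2_set_constant m_def[symmetric] h_def)
      finally show ?thesis .
    qed
    ultimately show ?thesis by blast
  qed
  then have "quarter_net I S" using finS by (auto simp: quarter_net_def S_def)
  then show ?thesis using cardS by blast
qed

lemma bilin_bounded_on_balls:
  assumes "finite I" "finite J" "L2_set u I \<le> 1" "L2_set v J \<le> 1"
  shows "bilin I J A u v \<le> (\<Sum>i\<in>I. \<Sum>j\<in>J. \<bar>A i j\<bar>)"
  unfolding bilin_def
proof (intro sum_mono)
  fix i j assume i: "i \<in> I" and j: "j \<in> J"
  have "\<bar>u i\<bar> \<le> L2_set (\<lambda>i. \<bar>u i\<bar>) I" using assms i by (intro member_le_L2_set)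
  also have "\<dots> \<le> 1" using assms by (simp add: L2_set_def)
  finally have "\<bar>u i\<bar> \<le> 1" .
  moreover have "\<bar>v j\<bar> \<le> L2_set (\<lambda>i. \<bar>v i\<bar>) J" using assms j by (intro member_le_L2_set)
  then have "\<bar>v j\<bar> \<le> 1" using assms(4) order_trans[of "\<bar>v j\<bar>" "L2_set (\<lambda>i. \<bar>v i\<bar>) J" 1]
    by (simp add: L2_set_def)
  ultimately have "\<bar>u i\<bar> * \<bar>A i j\<bar> * \<bar>v j\<bar> \<le> 1 * \<bar>A i j\<bar> * 1" by (intro mult_mono) auto
  then show "u i * A i j * v j \<le> \<bar>A i j\<bar>" by (simp add: abs_mult[symmetric])
qed

text \<open>
  Replacing both arguments by net points costs at most a quarter of the supremum \<open>\<sigma>\<close> of the form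
  over the unit balls each time, so \<open>\<sigma> \<le> \<beta> + \<sigma>/2\<close>.
\<close>
lemma op_norm_le_netI:
  assumes fin: "finite I" "finite J" and S: "quarter_net I S" and T: "quarter_net J T"
    and bd: "\<And>u v. u \<in> S \<Longrightarrow> v \<in> T \<Longrightarrow> bilin I J A u v \<le> \<beta>"
  shows "op_norm_le I J A (2 * \<beta>)"
proof (rule op_norm_le_unitI[OF fin])
  define Q where "Q = {bilin I J A u v | u v. L2_set u I \<le> 1 \<and> L2_set v J \<le> 1}"
  have bdd: "bdd_above Q" unfolding Q_def
    using bilin_bounded_on_balls[OF fin] by (intro bdd_aboveI[of _ "\<Sum>i\<in>I. \<Sum>j\<in>J. \<bar>A i j\<bar>"]) blast
  have up: "bilin I J A u v \<le> Sup Q" if "L2_set u I \<le> 1" "L2_set v J \<le> 1" for u v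
    using that bdd by (intro cSup_upper) (auto simp: Q_def)
  have up4: "bilin I J A u v \<le> Sup Q / 4" if "L2_set u I \<le> 1 / 4" "L2_set v J \<le> 1" for u v
  proof -
    have "L2_set (\<lambda>i. 4 * u i) I \<le> 1" using that L2_set_right_distrib[of 4 u I] by simp
    from up[OF this that(2)] show ?thesis by (simp add: bilin_scale_left)
  qed
  have up4': "bilin I J A u v \<le> Sup Q / 4" if "L2_set u I \<le> 1" "L2_set v J \<le> 1 / 4" for u v
  proof -
    have "L2_set (\<lambda>i. 4 * v i) J \<le> 1" using that L2_set_right_distrib[of 4 v J] by simp
    from up[OF that(1) this] show ?thesis by (simp add: bilin_scale_right)
  qed
  have step: "bilin I J A u v \<le> \<beta> + Sup Q / 2" if u: "L2_set u I \<le> 1" and v: "L2_set v J \<le> 1" for u v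
  proof -
    obtain u' where u': "u' \<in> S" "L2_set (\<lambda>i. u i - u' i) I \<le> 1 / 4" using S u by (auto simp: quarter_net_def)
    obtain v' where v': "v' \<in> T" "L2_set (\<lambda>i. v i - v' i) J \<le> 1 / 4" using T v by (auto simp: quarter_net_def)
    have "L2_set u' I \<le> 1" using S u' by (auto simp: quarter_net_def)
    then show ?thesis
      using bd[OF u'(1) v'(1)] up4[OF u'(2) v] up4'[of u', OF _ v'(2)]
      by (simp add: bilin_diff_left bilin_diff_right)
  qed
  have "(\<lambda>_. 0) \<in> {u. L2_set u I \<le> 1}" "(\<lambda>_. 0) \<in> {v. L2_set v J \<le> 1}" by (auto simp: L2_set_def)
  then have "Q \<noteq> {}" by (auto simp: Q_def)
  then have "Sup Q \<le> \<beta> + Sup Q / 2" using step by (intro cSup_least) (auto simp: Q_def)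
  then have "Sup Q \<le> 2 * \<beta>" by simp
  then show "bilin I J A u v \<le> 2 * \<beta>" if "L2_set u I \<le> 1" "L2_set v J \<le> 1" for u v
    using up[OF that] by linarith
qed

lemma L2_le_net_inner:
  assumes fin: "finite I" and S: "quarter_net I S"
  shows "\<exists>u\<in>S. L2_set x I \<le> 2 * (\<Sum>i\<in>I. x i * u i)"
proof (cases "L2_set x I = 0")
  case True
  have "L2_set (\<lambda>_. 0) I \<le> 1" by (simp add: L2_set_def)
  then obtain u where "u \<in> S" using S unfolding quarter_net_def by blast
  moreover have "\<forall>i\<in>I. x i = 0" using True fin by (simp add: L2_set_eq_0_iff)
  ultimately show ?thesis using True by (intro bexI[of _ u]) simp_all
next
  case False
  define r where "r = L2_set x I"
  have r: "r > 0" using False by (simp add: r_def less_le)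
  define v where "v = (\<lambda>i. 1 / r * x i)"
  have "L2_set v I = 1" using r L2_set_right_distrib[of "1 / r" x I] by (simp add: v_def r_def)
  then have "L2_set v I \<le> 1" by simp
  then obtain u where u: "u \<in> S" "L2_set (\<lambda>i. v i - u i) I \<le> 1 / 4"
    using S unfolding quarter_net_def by blast
  have "(\<Sum>i\<in>I. x i * v i) = (\<Sum>i\<in>I. (x i)\<^sup>2) / r"
    by (simp add: v_def power2_eq_square sum_divide_distrib)
  also have "\<dots> = r" using r unfolding L2_set_square[symmetric] r_def[symmetric] by (simp add: power2_eq_square)
  finally have "(\<Sum>i\<in>I. x i * u i) = r - (\<Sum>i\<in>I. x i * (v i - u i))"
    by (simp add: algebra_simps sum_subtractf)
  moreover have "(\<Sum>i\<in>I. x i * (v i - u i)) \<le> r * (1 / 4)"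
    using order_trans[OF sum_mult_le_L2 mult_left_mono[OF u(2)], of x] by (simp add: r_def)
  ultimately have "r \<le> 2 * (\<Sum>i\<in>I. x i * u i)" using r by linarith
  then show ?thesis using u(1) unfolding r_def by blast
qed

section \<open>Exponential moments and maxima\<close>

lemma square_le_exp:
  fixes x :: real assumes "0 \<le> x" shows "x\<^sup>2 \<le> 2 * exp x"
  using exp_lower_Taylor_quadratic[OF assms] assms by simp

text \<open>
  Up to the threshold \<open>s\<close> the first term suffices. Beyond it, \<open>l\<^sup>2 z\<^sup>2 / 2 \<le> exp (l |z|)\<close>, and one more
  factor \<open>exp (l |z|)\<close> pays for \<open>exp (- l s)\<close>.
\<close>
lemma square_le_threshold_plus_exp:
  fixes z s l :: real
  assumes l: "0 < l"
  shows "z\<^sup>2 \<le> s\<^sup>2 + 2 / l\<^sup>2 * exp (- l * s) * (exp (2 * l * z) + exp (- 2 * l * z))"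
proof (cases "\<bar>z\<bar> \<le> s")
  case True
  then have "\<bar>z\<bar>\<^sup>2 \<le> s\<^sup>2" by (intro power_mono) auto
  moreover have "0 \<le> 2 / l\<^sup>2 * exp (- l * s) * (exp (2 * l * z) + exp (- 2 * l * z))"
    by (intro mult_nonneg_nonneg add_nonneg_nonneg) auto
  ultimately show ?thesis unfolding power2_abs by linarith
next
  case False
  have "(l * \<bar>z\<bar>)\<^sup>2 \<le> 2 * exp (l * \<bar>z\<bar>)" using l by (intro square_le_exp) simp
  also have "\<dots> \<le> 2 * exp (- l * s + 2 * l * \<bar>z\<bar>)"
    using False l mult_strict_left_mono[of s "\<bar>z\<bar>" l] by simp
  also have "\<dots> = 2 * exp (- l * s) * exp (2 * l * \<bar>z\<bar>)" by (simp only: exp_add mult.assoc)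
  also have "\<dots> \<le> 2 * exp (- l * s) * (exp (2 * l * z) + exp (- 2 * l * z))"
    by (intro mult_left_mono) (auto simp: abs_if add_increasing add_increasing2)
  finally have "z\<^sup>2 \<le> 2 / l\<^sup>2 * exp (- l * s) * (exp (2 * l * z) + exp (- 2 * l * z))"
    using l by (simp add: power_mult_distrib field_simps)
  then show ?thesis using zero_le_power2[of s] by linarith
qed

text \<open>
  The function \<open>F\<close> is the sum of the pointwise bounds for all variables, with a single \<open>s\<^sup>2\<close>; it is
  measurable, so it can be integrated in place of the norms that it dominates. The threshold \<open>s\<close> is free: with
  \<open>l s \<ge> L + w\<close> the union over \<open>e\<^sup>L\<close> variables costs nothing beyond \<open>s\<^sup>2\<close>.
\<close>
lemma maximal_second_moment:
  fixes Z :: "'i \<Rightarrow> 'a \<Rightarrow> real"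
  assumes "prob_space M" and fin: "finite T" and card: "real (card T) \<le> exp L" and l: "0 < l"
    and meas [measurable]: "\<And>j. j \<in> T \<Longrightarrow> Z j \<in> borel_measurable M"
    and mgf: "\<And>j t. j \<in> T \<Longrightarrow> \<bar>t\<bar> = 2 * l \<Longrightarrow> (\<integral>\<^sup>+x. ennreal (exp (t * Z j x)) \<partial>M) \<le> ennreal (exp w)"
  obtains F :: "'a \<Rightarrow> real" where "F \<in> borel_measurable M" "\<And>x. 0 \<le> F x"
    "\<And>x j. j \<in> T \<Longrightarrow> (Z j x)\<^sup>2 \<le> F x"
    "(\<integral>\<^sup>+x. ennreal (F x) \<partial>M) \<le> ennreal (s\<^sup>2 + 4 / l\<^sup>2 * exp (L + w - l * s))"
proof
  interpret prob_space M by fact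
  define c where "c = 2 / l\<^sup>2 * exp (- l * s)"
  have c: "0 \<le> c" by (simp add: c_def)
  define E where "E = (\<lambda>j x. exp (2 * l * Z j x) + exp (- 2 * l * Z j x))"
  have E: "0 \<le> E j x" for j x by (simp add: E_def add_nonneg_nonneg)
  define F where "F = (\<lambda>x. s\<^sup>2 + c * (\<Sum>j\<in>T. E j x))"
  have Em [measurable]: "E j \<in> borel_measurable M" if "j \<in> T" for j
    using that unfolding E_def by measurable
  show "F \<in> borel_measurable M" unfolding F_def by measurable
  show F0: "0 \<le> F x" for x unfolding F_def using c E by (intro add_nonneg_nonneg mult_nonneg_nonneg sum_nonneg) auto
  show "(Z j x)\<^sup>2 \<le> F x" if j: "j \<in> T" for x j
  proof -
    have "(Z j x)\<^sup>2 \<le> s\<^sup>2 + c * E j x"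
      unfolding c_def E_def by (rule square_le_threshold_plus_exp[OF l])
    also have "\<dots> \<le> F x" unfolding F_def
      using c fin j E by (intro add_left_mono mult_left_mono member_le_sum) auto
    finally show ?thesis .
  qed
  have EE: "(\<integral>\<^sup>+x. ennreal (E j x) \<partial>M) \<le> ennreal (2 * exp w)" if j: "j \<in> T" for j
  proof -
    note [measurable] = meas[OF j]
    have "(\<integral>\<^sup>+x. ennreal (E j x) \<partial>M)
        = (\<integral>\<^sup>+x. ennreal (exp (2 * l * Z j x)) + ennreal (exp (- 2 * l * Z j x)) \<partial>M)"
      by (simp add: E_def ennreal_plus)
    also have "\<dots> = (\<integral>\<^sup>+x. ennreal (exp (2 * l * Z j x)) \<partial>M) + (\<integral>\<^sup>+x. ennreal (exp (- 2 * l * Z j x)) \<partial>M)"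
      by (intro nn_integral_add) auto
    also have "\<dots> \<le> ennreal (exp w) + ennreal (exp w)"
      using l by (intro add_mono mgf[OF j]) auto
    finally show ?thesis by (simp add: ennreal_plus[symmetric] del: ennreal_plus)
  qed
  have "(\<integral>\<^sup>+x. ennreal (F x) \<partial>M) = (\<integral>\<^sup>+x. ennreal (s\<^sup>2) + ennreal c * (\<Sum>j\<in>T. ennreal (E j x)) \<partial>M)"
    unfolding F_def using c E
    by (intro nn_integral_cong) (simp add: ennreal_plus ennreal_mult sum_nonneg)
  also have "\<dots> = ennreal (s\<^sup>2) + ennreal c * (\<Sum>j\<in>T. (\<integral>\<^sup>+x. ennreal (E j x) \<partial>M))"
    by (simp add: nn_integral_add nn_integral_cmult nn_integral_sum emeasure_space_1)
  also have "\<dots> \<le> ennreal (s\<^sup>2) + ennreal c * (\<Sum>j\<in>T. ennreal (2 * exp w))"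
    using EE by (intro add_left_mono mult_left_mono sum_mono) auto
  also have "\<dots> = ennreal (s\<^sup>2 + c * (real (card T) * (2 * exp w)))"
    using c by (simp add: ennreal_of_nat_eq_real_of_nat ennreal_mult[symmetric] ennreal_plus[symmetric] del: ennreal_plus)
  also have "\<dots> \<le> ennreal (s\<^sup>2 + c * (exp L * (2 * exp w)))"
    using c card by (intro ennreal_leI add_left_mono mult_left_mono mult_right_mono) auto
  also have "c * (exp L * (2 * exp w)) = 4 / l\<^sup>2 * exp (L + w - l * s)"
    by (simp add: c_def exp_add exp_diff exp_minus field_simps)
  finally show "(\<integral>\<^sup>+x. ennreal (F x) \<partial>M) \<le> ennreal (s\<^sup>2 + 4 / l\<^sup>2 * exp (L + w - l * s))" .
qed

lemma exp_le_quadratic: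
  fixes x :: real shows "exp x \<le> 1 + x + x\<^sup>2 / 2 * exp \<bar>x\<bar>"
proof -
  obtain t where t: "\<bar>t\<bar> \<le> \<bar>x\<bar>" "exp x = (\<Sum>m<2. x ^ m / fact m) + exp t / fact 2 * x ^ 2"
    using Maclaurin_exp_le[of x 2] by blast
  have "exp t \<le> exp \<bar>x\<bar>" using t(1) by simp
  then have "exp t * x\<^sup>2 \<le> exp \<bar>x\<bar> * x\<^sup>2" by (rule mult_right_mono) simp
  then show ?thesis using t(2) by (simp add: numeral_2_eq_2 algebra_simps)
qed

text \<open>
  Bernstein's condition. In the second-order bound \<open>exp (t Y) \<le> 1 + t Y + (t Y)\<^sup>2 exp |t Y| / 2\<close>, half of
  the exponential moment of \<open>|Y| / b\<close> absorbs \<open>Y\<^sup>2\<close> and the other half absorbs \<open>exp |t Y|\<close>.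
\<close>
lemma (in prob_space) centered_mgf_le:
  fixes Y :: "'a \<Rightarrow> real"
  assumes Y [measurable]: "Y \<in> borel_measurable M" and b: "0 < b"
    and psi: "(\<integral>\<^sup>+x. ennreal (exp (\<bar>Y x\<bar> / b)) \<partial>M) \<le> 2" and t: "\<bar>t\<bar> \<le> 1 / (2 * b)"
  shows "(\<integral>\<^sup>+x. ennreal (exp (t * (Y x - expectation Y))) \<partial>M) \<le> ennreal (exp (8 * t\<^sup>2 * b\<^sup>2))"
proof -
  define G where "G = (\<lambda>x. exp (\<bar>Y x\<bar> / b))"
  have Gm [measurable]: "G \<in> borel_measurable M" unfolding G_def by measurable
  have Gi: "integrable M G"
  proof (rule integrableI_nonneg)
    show "(\<integral>\<^sup>+x. ennreal (G x) \<partial>M) < \<infinity>" unfolding G_def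
      using psi by (rule order.strict_trans1) simp
  qed (auto simp: G_def)
  have "ennreal (expectation G) \<le> 2"
    using psi nn_integral_eq_integral[OF Gi] by (simp add: G_def)
  then have EG: "expectation G \<le> 2" by (simp add: ennreal_le_iff2 flip: ennreal_numeral)
  have Yi: "integrable M Y"
  proof (rule Bochner_Integration.integrable_bound[OF integrable_mult_right[OF Gi, of b] Y], rule AE_I2)
    fix x
    have "\<bar>Y x\<bar> / b \<le> G x" unfolding G_def using exp_ge_add_one_self[of "\<bar>Y x\<bar> / b"] by linarith
    then show "norm (Y x) \<le> norm (b * G x)" using b by (simp add: field_simps G_def)
  qed
  define H where "H = (\<lambda>x. exp (- t * expectation Y) * (1 + t * Y x + 4 * t\<^sup>2 * b\<^sup>2 * G x))"
  have pt: "exp (t * (Y x - expectation Y)) \<le> H x" for x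
  proof -
    have "\<bar>t * Y x\<bar> \<le> 1 / (2 * b) * \<bar>Y x\<bar>" unfolding abs_mult using t by (intro mult_right_mono) auto
    then have "exp \<bar>t * Y x\<bar> \<le> exp (\<bar>Y x\<bar> / (2 * b))" by simp
    moreover have "(\<bar>Y x\<bar> / (2 * b))\<^sup>2 \<le> 2 * exp (\<bar>Y x\<bar> / (2 * b))" using b by (intro square_le_exp) simp
    ultimately have "(\<bar>Y x\<bar> / (2 * b))\<^sup>2 * exp \<bar>t * Y x\<bar> \<le> 2 * exp (\<bar>Y x\<bar> / (2 * b)) * exp (\<bar>Y x\<bar> / (2 * b))"
      by (intro mult_mono) auto
    also have "\<dots> = 2 * G x" by (simp add: G_def mult_exp_exp mult.assoc)
    finally have "2 * t\<^sup>2 * b\<^sup>2 * ((\<bar>Y x\<bar> / (2 * b))\<^sup>2 * exp \<bar>t * Y x\<bar>) \<le> 2 * t\<^sup>2 * b\<^sup>2 * (2 * G x)"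
      by (rule mult_left_mono) simp
    moreover have "2 * t\<^sup>2 * b\<^sup>2 * ((\<bar>Y x\<bar> / (2 * b))\<^sup>2 * exp \<bar>t * Y x\<bar>) = (t * Y x)\<^sup>2 / 2 * exp \<bar>t * Y x\<bar>"
      using b by (simp add: power_divide power_mult_distrib)
    ultimately have "exp (t * Y x) \<le> 1 + t * Y x + 4 * t\<^sup>2 * b\<^sup>2 * G x"
      using exp_le_quadratic[of "t * Y x"] by simp
    then have "exp (- t * expectation Y) * exp (t * Y x) \<le> H x"
      unfolding H_def by (intro mult_left_mono) auto
    then show ?thesis by (simp add: exp_add[symmetric] algebra_simps)
  qed
  have H0: "0 \<le> H x" for x using pt[of x] exp_ge_zero order_trans by blast
  have Hi: "integrable M H" unfolding H_def using Gi Yi by (intro integrable_mult_right Bochner_Integration.integrable_add) auto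
  have "(\<integral>\<^sup>+x. ennreal (exp (t * (Y x - expectation Y))) \<partial>M) \<le> (\<integral>\<^sup>+x. ennreal (H x) \<partial>M)"
    using pt by (intro nn_integral_mono ennreal_leI) auto
  also have "\<dots> = ennreal (expectation H)" using H0 by (intro nn_integral_eq_integral[OF Hi]) auto
  also have "expectation H = exp (- t * expectation Y) * (1 + t * expectation Y + 4 * t\<^sup>2 * b\<^sup>2 * expectation G)"
    unfolding H_def using Gi Yi by (simp add: prob_space)
  also have "ennreal \<dots> \<le> ennreal (exp (- t * expectation Y) * exp (t * expectation Y + 8 * t\<^sup>2 * b\<^sup>2))"
  proof (intro ennreal_leI mult_left_mono)
    have "4 * t\<^sup>2 * b\<^sup>2 * expectation G \<le> 4 * t\<^sup>2 * b\<^sup>2 * 2" using EG by (intro mult_left_mono) auto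
    then show "1 + t * expectation Y + 4 * t\<^sup>2 * b\<^sup>2 * expectation G \<le> exp (t * expectation Y + 8 * t\<^sup>2 * b\<^sup>2)"
      using exp_ge_add_one_self[of "t * expectation Y + 8 * t\<^sup>2 * b\<^sup>2"] by linarith
  qed simp
  also have "exp (- t * expectation Y) * exp (t * expectation Y + 8 * t\<^sup>2 * b\<^sup>2) = exp (8 * t\<^sup>2 * b\<^sup>2)"
    by (simp add: exp_add[symmetric])
  finally show ?thesis .
qed

lemma sample_mean_mgf_le:
  fixes Y :: "'a \<Rightarrow> real"
  assumes P: "prob_space P" and Y [measurable]: "Y \<in> borel_measurable P" and b: "0 < b"
    and psi: "(\<integral>\<^sup>+x. ennreal (exp (\<bar>Y x\<bar> / b)) \<partial>P) \<le> 2"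
    and n: "0 < n" and t: "\<bar>t\<bar> \<le> real n / (2 * b)"
  shows "(\<integral>\<^sup>+X. ennreal (exp (t * (1 / real n * (\<Sum>m<n. Y (X m)) - integral\<^sup>L P Y))) \<partial>Pi\<^sub>M {..<n} (\<lambda>_. P))
     \<le> ennreal (exp (8 * t\<^sup>2 * b\<^sup>2 / real n))"
proof -
  interpret P: prob_space P by fact
  interpret PP: product_sigma_finite "\<lambda>_::nat. P" by standard
  let ?f = "\<lambda>x. exp (t / real n * (Y x - integral\<^sup>L P Y))"
  have "exp (t * (1 / real n * (\<Sum>m<n. Y (X m)) - integral\<^sup>L P Y)) = (\<Prod>m<n. ?f (X m))" for X
  proof -
    have "t * (1 / real n * (\<Sum>m<n. Y (X m)) - integral\<^sup>L P Y) = (\<Sum>m<n. t / real n * (Y (X m) - integral\<^sup>L P Y))"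
      using n unfolding sum_distrib_left[symmetric] sum_subtractf by (simp add: field_simps)
    then show ?thesis by (simp add: exp_sum)
  qed
  then have "(\<integral>\<^sup>+X. ennreal (exp (t * (1 / real n * (\<Sum>m<n. Y (X m)) - integral\<^sup>L P Y))) \<partial>Pi\<^sub>M {..<n} (\<lambda>_. P))
      = (\<integral>\<^sup>+X. (\<Prod>m<n. ennreal (?f (X m))) \<partial>Pi\<^sub>M {..<n} (\<lambda>_. P))"
    by (simp add: prod_ennreal)
  also have "\<dots> = (\<Prod>m<n. (\<integral>\<^sup>+x. ennreal (?f x) \<partial>P))"
    by (rule PP.product_nn_integral_prod) auto
  also have "\<dots> \<le> (\<Prod>m<n. ennreal (exp (8 * (t / real n)\<^sup>2 * b\<^sup>2)))"
  proof (rule prod_mono_ennreal)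
    have "\<bar>t / real n\<bar> \<le> 1 / (2 * b)" using t n b by (simp add: field_simps)
    then show "(\<integral>\<^sup>+x. ennreal (?f x) \<partial>P) \<le> ennreal (exp (8 * (t / real n)\<^sup>2 * b\<^sup>2))" for m
      by (rule P.centered_mgf_le[OF Y b psi])
  qed
  also have "\<dots> = ennreal (exp (8 * (t / real n)\<^sup>2 * b\<^sup>2) ^ n)" by (simp add: ennreal_power)
  also have "exp (8 * (t / real n)\<^sup>2 * b\<^sup>2) ^ n = exp (8 * t\<^sup>2 * b\<^sup>2 / real n)"
    using n by (simp add: exp_of_nat_mult[symmetric] power2_eq_square)
  finally show ?thesis .
qed

lemma nn_integral_normal_density: "(\<integral>\<^sup>+x. ennreal (normal_density \<mu> 1 x) \<partial>lborel) = 1"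
proof -
  interpret prob_space "density lborel (normal_density \<mu> 1)" by (rule prob_space_normal_density) simp
  show ?thesis using emeasure_space_1 by (simp add: emeasure_density)
qed

text \<open>
  Completing the square turns the integrand into a multiple of the normal density with mean \<open>t\<close>.
\<close>
lemma std_normal_mgf:
  "(\<integral>\<^sup>+x. ennreal (exp (t * x)) \<partial>std_normal_distribution) = ennreal (exp (t\<^sup>2 / 2))"
proof -
  have "(\<integral>\<^sup>+x. ennreal (exp (t * x)) \<partial>std_normal_distribution)
      = (\<integral>\<^sup>+x. ennreal (std_normal_density x) * ennreal (exp (t * x)) \<partial>lborel)"
    by (subst nn_integral_density) auto
  also have "\<dots> = (\<integral>\<^sup>+x. ennreal (exp (t\<^sup>2 / 2)) * ennreal (normal_density t 1 x) \<partial>lborel)"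
  proof (intro nn_integral_cong)
    fix x
    have "- x\<^sup>2 / 2 + t * x = t\<^sup>2 / 2 + - (x - t)\<^sup>2 / 2" by (simp add: power2_diff field_simps)
    then have "exp (- x\<^sup>2 / 2) * exp (t * x) = exp (t\<^sup>2 / 2) * exp (- (x - t)\<^sup>2 / 2)"
      unfolding exp_add[symmetric] by (rule arg_cong)
    then have "std_normal_density x * exp (t * x) = exp (t\<^sup>2 / 2) * normal_density t 1 x"
      unfolding normal_density_def by simp
    then show "ennreal (std_normal_density x) * ennreal (exp (t * x))
        = ennreal (exp (t\<^sup>2 / 2)) * ennreal (normal_density t 1 x)"
      by (simp add: ennreal_mult[symmetric])
  qed
  also have "\<dots> = ennreal (exp (t\<^sup>2 / 2))" by (simp add: nn_integral_cmult nn_integral_normal_density)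
  finally show ?thesis .
qed

lemma gaussian_linear_form_mgf:
  assumes "finite E"
  shows "(\<integral>\<^sup>+W. ennreal (exp (\<Sum>e\<in>E. c e * W e)) \<partial>Pi\<^sub>M E (\<lambda>_. std_normal_distribution))
     = ennreal (exp ((\<Sum>e\<in>E. (c e)\<^sup>2) / 2))"
proof -
  interpret N: prob_space std_normal_distribution by (rule prob_space_normal_density) simp
  interpret PP: product_sigma_finite "\<lambda>_. std_normal_distribution" by standard
  have "(\<integral>\<^sup>+W. ennreal (exp (\<Sum>e\<in>E. c e * W e)) \<partial>Pi\<^sub>M E (\<lambda>_. std_normal_distribution))
     = (\<integral>\<^sup>+W. (\<Prod>e\<in>E. ennreal (exp (c e * W e))) \<partial>Pi\<^sub>M E (\<lambda>_. std_normal_distribution))"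
    using assms by (simp add: exp_sum prod_ennreal)
  also have "\<dots> = (\<Prod>e\<in>E. (\<integral>\<^sup>+x. ennreal (exp (c e * x)) \<partial>std_normal_distribution))"
    by (rule PP.product_nn_integral_prod[OF assms]) auto
  also have "\<dots> = ennreal (exp ((\<Sum>e\<in>E. (c e)\<^sup>2) / 2))"
    using assms by (simp add: std_normal_mgf prod_ennreal exp_sum sum_divide_distrib)
  finally show ?thesis .
qed

section \<open>The covariance outside the block band\<close>

text \<open>
  Two index blocks of length \<open>b\<close> with a further block between them are separated by at least \<open>b\<close>.
\<close>
lemma far_block_op_norm_le:
  assumes S: "S \<in> cov_class d \<alpha> M0 M" and b: "1 \<le> b" and pq: "2 \<le> nat_gap p q"
  shows "op_norm_le (index_block d b p) (index_block d b q) S (M * real b powr (- \<alpha>))"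
proof -
  let ?R = "index_block d b p \<times> index_block d b q"
  have sep: "p * b + 2 * b \<le> q * b \<or> q * b + 2 * b \<le> p * b"
  proof (cases "p + 2 \<le> q")
    case True
    then have "(p + 2) * b \<le> q * b" by (rule mult_le_mono1)
    then show ?thesis by (simp add: algebra_simps)
  next
    case False
    with pq have "(q + 2) * b \<le> p * b" by (intro mult_le_mono1) (auto simp: nat_gap_def max_def min_def split: if_splits)
    then show ?thesis by (simp add: algebra_simps)
  qed
  have bounds: "r * b \<le> i" "i < r * b + b" if "i \<in> index_block d b r" for i r
  proof -
    have "i mod b < b" "i = r * b + i mod b" using that b by (auto simp: index_block_def)
    then show "r * b \<le> i" "i < r * b + b" by linarith+
  qed
  have "?R \<subseteq> {(i, j). j \<ge> i + b} \<or> ?R \<subseteq> {(i, j). i \<ge> j + b}"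
    using sep
  proof
    assume "p * b + 2 * b \<le> q * b"
    then have "i + b \<le> j" if "i \<in> index_block d b p" "j \<in> index_block d b q" for i j
      using bounds[OF that(1)] bounds[OF that(2)] by linarith
    then show ?thesis by auto
  next
    assume "q * b + 2 * b \<le> p * b"
    then have "j + b \<le> i" if "i \<in> index_block d b p" "j \<in> index_block d b q" for i j
      using bounds[OF that(1)] bounds[OF that(2)] by linarith
    then show ?thesis by auto
  qed
  then have "off_diag_block d b ?R"
    unfolding off_diag_block_def
    by (intro conjI exI[of _ "index_block d b p"] exI[of _ "index_block d b q"]) (auto simp: index_block_def)
  then have "spec_norm d (mat_restrict S ?R) \<le> M * real b powr (- \<alpha>)"
    using S b by (auto simp: cov_class_def)
  then have "op_norm_le {..<d} {..<d} (mat_restrict S ?R) (M * real b powr (- \<alpha>))"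
    by (rule op_norm_le_of_spec_norm)
  then have "op_norm_le (index_block d b p) (index_block d b q) (mat_restrict S ?R) (M * real b powr (- \<alpha>))"
    by (rule op_norm_le_restrict) (auto simp: index_block_def)
  then show ?thesis
    by (subst (asm) op_norm_le_cong[where B = S]) (auto simp: mat_restrict_def)
qed

definition off_band :: "nat \<Rightarrow> (nat \<Rightarrow> nat \<Rightarrow> real) \<Rightarrow> nat \<Rightarrow> nat \<Rightarrow> real" where
  "off_band b A i j = (if 2 \<le> nat_gap (i div b) (j div b) then A i j else 0)"

lemma nat_gap_div_le: "nat_gap (p div 2) (q div 2) \<le> 1 \<Longrightarrow> nat_gap p q \<le> 3"
  by (auto simp: nat_gap_def max_def min_def split: if_splits)

lemma nat_gap_le_div: "nat_gap p q \<le> 1 \<Longrightarrow> nat_gap (p div 2) (q div 2) \<le> 1"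
  by (auto simp: nat_gap_def max_def min_def split: if_splits)

text \<open>
  The entries outside the band of block size \<open>b\<close> are those outside the band of block size \<open>2 b\<close> and an
  increment. The latter consists of whole blocks of size \<open>b\<close> whose block indices differ by 2 or 3, so
  each block row and column meets at most \<open>7 = 2 * 3 + 1\<close> of them. Once \<open>b \<ge> d\<close> nothing is left.
\<close>
lemma off_band_telescope:
  assumes S: "S \<in> cov_class d \<alpha> M0 M" and M: "0 \<le> M" and b: "1 \<le> b" and J: "d \<le> 2 ^ J * b"
  shows "op_norm_le {..<d} {..<d} (off_band b S) (\<Sum>t<J. 7 * (M * (2 ^ t * real b) powr (- \<alpha>)))"
  using b J
proof (induction J arbitrary: b)
  case 0
  have "off_band b S i j = 0" if "i < d" "j < d" for i j
    using that 0 by (simp add: off_band_def nat_gap_def)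
  then show ?case using op_norm_le_zero[of "{..<d}" "{..<d}"]
    by (subst op_norm_le_cong[where B = "\<lambda>_ _. 0"]) auto
next
  case (Suc J)
  let ?inc = "\<lambda>i j. off_band b S i j - off_band (b * 2) S i j"
  have IH: "op_norm_le {..<d} {..<d} (off_band (b * 2) S) (\<Sum>t<J. 7 * (M * (2 ^ t * real (b * 2)) powr (- \<alpha>)))"
    using Suc.prems by (intro Suc.IH) (auto simp: algebra_simps)
  have inc: "?inc i j = (if 2 \<le> nat_gap (i div b) (j div b) \<and> nat_gap (i div b div 2) (j div b div 2) \<le> 1
       then S i j else 0)" for i j
    using nat_gap_le_div[of "i div b" "j div b"] by (auto simp: off_band_def div_mult2_eq)
  have "op_norm_le {..<d} {..<d} ?inc ((2 * real 3 + 1) * (M * real b powr (- \<alpha>)))"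
  proof (rule op_norm_le_block_band[where b = b])
    show "?inc i j = 0" if "nat_gap (i div b) (j div b) > 3" for i j
      using nat_gap_div_le[of "i div b" "j div b"] that unfolding inc by auto
    fix p q
    show "op_norm_le (index_block d b p) (index_block d b q) ?inc (M * real b powr (- \<alpha>))"
    proof (cases "2 \<le> nat_gap p q \<and> nat_gap (p div 2) (q div 2) \<le> 1")
      case True
      then have "op_norm_le (index_block d b p) (index_block d b q) S (M * real b powr (- \<alpha>))"
        using far_block_op_norm_le[OF S Suc.prems(1)] by blast
      then show ?thesis unfolding inc using True
        by (subst op_norm_le_cong[where B = S]) (auto simp: index_block_def)
    next
      case False
      have "op_norm_le (index_block d b p) (index_block d b q) (\<lambda>_ _. 0) (M * real b powr (- \<alpha>))"
        using M by (intro op_norm_le_mono[OF op_norm_le_zero]) simp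
      then show ?thesis unfolding inc using False
        by (subst op_norm_le_cong[where B = "\<lambda>_ _. 0"]) (auto simp: index_block_def)
    qed
  qed (use M in auto)
  from op_norm_le_add[OF IH this]
  show ?case
    by (simp add: sum.lessThan_Suc_shift algebra_simps del: sum.lessThan_Suc)
qed

lemma geometric_powr_sum_le:
  assumes "0 < \<alpha>"
  shows "(\<Sum>t<J. (2 ^ t * real b) powr (- \<alpha>)) \<le> real b powr (- \<alpha>) / (1 - 2 powr (- \<alpha>))"
proof -
  define r :: real where "r = 2 powr (- \<alpha>)"
  have r: "0 < r" "r < 1" using assms by (auto simp: r_def powr_less_one)
  have "(\<Sum>t<J. (2 ^ t * real b) powr (- \<alpha>)) = real b powr (- \<alpha>) * (\<Sum>t<J. r ^ t)"
    unfolding sum_distrib_left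
  proof (rule sum.cong[OF refl])
    fix t
    have "((2::real) ^ t) powr (- \<alpha>) = r ^ t"
      by (simp add: r_def powr_powr powr_realpow[symmetric] mult.commute)
    then show "(2 ^ t * real b) powr (- \<alpha>) = real b powr (- \<alpha>) * r ^ t" by (simp add: powr_mult)
  qed
  also have "(\<Sum>t<J. r ^ t) \<le> 1 / (1 - r)"
  proof -
    have "(\<Sum>t<J. r ^ t) = (1 - r ^ J) / (1 - r)" using r by (simp add: sum_gp_strict)
    also have "\<dots> \<le> 1 / (1 - r)" using r by (intro divide_right_mono) auto
    finally show ?thesis .
  qed
  then have "real b powr (- \<alpha>) * (\<Sum>t<J. r ^ t) \<le> real b powr (- \<alpha>) * (1 / (1 - r))"
    by (intro mult_left_mono) auto
  finally show ?thesis by (simp add: r_def)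
qed

lemma off_band_op_norm_le:
  assumes S: "S \<in> cov_class d \<alpha> M0 M" and "0 \<le> M" "0 < \<alpha>" "1 \<le> b"
  shows "op_norm_le {..<d} {..<d} (off_band b S) (7 * M / (1 - 2 powr (- \<alpha>)) * real b powr (- \<alpha>))"
proof -
  have "d \<le> 2 ^ d * b" using less_exp[of d] assms(4) mult_le_mono[of d "2 ^ d" 1 b] by simp
  then have "op_norm_le {..<d} {..<d} (off_band b S) (\<Sum>t<d. 7 * (M * (2 ^ t * real b) powr (- \<alpha>)))"
    by (rule off_band_telescope[OF S assms(2) assms(4)])
  moreover have "(\<Sum>t<d. 7 * (M * (2 ^ t * real b) powr (- \<alpha>))) = 7 * M * (\<Sum>t<d. (2 ^ t * real b) powr (- \<alpha>))"
    by (simp add: sum_distrib_left mult.assoc)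
  moreover have "\<dots> \<le> 7 * M * (real b powr (- \<alpha>) / (1 - 2 powr (- \<alpha>)))"
    using assms(2) geometric_powr_sum_le[OF assms(3)] by (intro mult_left_mono) auto
  ultimately have "op_norm_le {..<d} {..<d} (off_band b S) (7 * M * (real b powr (- \<alpha>) / (1 - 2 powr (- \<alpha>))))"
    using op_norm_le_mono by simp
  then show ?thesis by simp
qed

section \<open>Subgaussian laws\<close>

text \<open>
  The constant \<open>2 K\<close> below replaces \<open>K\<close> because the \<open>\<psi>\<^sub>2\<close> norm is an infimum, so the
  exponential moment may be bounded by 2 only for values \<open>t\<close> slightly above \<open>K\<close>.
\<close>
locale subgaussian_law =
  fixes d :: nat and K :: real and P :: "(nat \<Rightarrow> real) measure"
  assumes law: "P \<in> data_laws d K" and K_pos: "0 < K"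
begin

sublocale prob_space P
  using law by (simp add: data_laws_def)

lemma coordinate_measurable [measurable]: "i < d \<Longrightarrow> (\<lambda>x. x i) \<in> borel_measurable P"
proof -
  assume "i < d"
  then have "(\<lambda>x. x i) \<in> borel_measurable (Pi\<^sub>M {..<d} (\<lambda>_. borel))"
    by (intro measurable_component_singleton) auto
  moreover have "sets P = sets (Pi\<^sub>M {..<d} (\<lambda>_. borel))" using law by (simp add: data_laws_def)
  ultimately show ?thesis by (simp cong: measurable_cong_sets)
qed

lemma cov_mat_eq:
  assumes "i < d" "j < d" shows "cov_mat P i j = (\<integral>x. x i * x j \<partial>P)"
  using law assms by (simp add: cov_mat_def data_laws_def)

lemma inner_psi2_full:
  assumes v: "L2_set v {..<d} \<le> 1"
  shows "(\<integral>\<^sup>+x. ennreal (exp ((\<Sum>i<d. x i * v i)\<^sup>2 / (2 * K)\<^sup>2)) \<partial>P) \<le> 2"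
proof (cases "L2_set v {..<d} = 0")
  case True
  then have "\<forall>i<d. v i = 0" by (simp add: L2_set_eq_0_iff)
  then have "(\<Sum>i<d. x i * v i) = 0" for x by simp
  then show ?thesis by (simp add: emeasure_space_1)
next
  case False
  define r where "r = L2_set v {..<d}"
  have r: "0 < r" "r \<le> 1" using False v by (auto simp: r_def less_le)
  define w where "w = (\<lambda>i. 1 / r * v i)"
  have w: "L2_set w {..<d} = 1" using r L2_set_right_distrib[of "1 / r" v "{..<d}"] by (simp add: w_def r_def)
  let ?S = "{t::real. 0 < t \<and> (\<integral>\<^sup>+x. ennreal (exp ((\<Sum>i<d. x i * w i)\<^sup>2 / t\<^sup>2)) \<partial>P) \<le> 2}"
  have "(INF t\<in>?S. ennreal t) \<le> psi2_norm d P"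
    unfolding psi2_norm_def using w by (intro SUP_upper2[of w]) auto
  also have "\<dots> \<le> ennreal K" using law by (simp add: data_laws_def)
  also have "\<dots> < ennreal (2 * K)" using K_pos by (intro ennreal_lessI) auto
  finally have "\<exists>t\<in>?S. ennreal t < ennreal (2 * K)" by (simp only: INF_less_iff)
  then obtain t where t: "0 < t" "(\<integral>\<^sup>+x. ennreal (exp ((\<Sum>i<d. x i * w i)\<^sup>2 / t\<^sup>2)) \<partial>P) \<le> 2" "t < 2 * K"
    using K_pos by (auto simp: ennreal_less_iff)
  have "(\<Sum>i<d. x i * v i)\<^sup>2 / (2 * K)\<^sup>2 \<le> (\<Sum>i<d. x i * w i)\<^sup>2 / t\<^sup>2" for x :: "nat \<Rightarrow> real"
  proof -
    have "(\<Sum>i<d. x i * v i) = r * (\<Sum>i<d. x i * w i)"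
      using r by (simp add: w_def sum_distrib_left)
    then have "(\<Sum>i<d. x i * v i)\<^sup>2 = r\<^sup>2 * (\<Sum>i<d. x i * w i)\<^sup>2" by (simp add: power_mult_distrib)
    also have "\<dots> \<le> 1 * (\<Sum>i<d. x i * w i)\<^sup>2" using r by (intro mult_right_mono) (auto simp: power_le_one)
    finally have "(\<Sum>i<d. x i * v i)\<^sup>2 \<le> (\<Sum>i<d. x i * w i)\<^sup>2" by simp
    moreover have "t\<^sup>2 \<le> (2 * K)\<^sup>2" using t by (intro power_mono) auto
    ultimately show ?thesis using t(1) by (intro frac_le) auto
  qed
  then have "(\<integral>\<^sup>+x. ennreal (exp ((\<Sum>i<d. x i * v i)\<^sup>2 / (2 * K)\<^sup>2)) \<partial>P)
     \<le> (\<integral>\<^sup>+x. ennreal (exp ((\<Sum>i<d. x i * w i)\<^sup>2 / t\<^sup>2)) \<partial>P)"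
    by (intro nn_integral_mono ennreal_leI) auto
  then show ?thesis using t(2) by (rule order_trans)
qed

lemma inner_psi2:
  assumes I: "I \<subseteq> {..<d}" and u: "L2_set u I \<le> 1"
  shows "(\<integral>\<^sup>+x. ennreal (exp ((\<Sum>i\<in>I. x i * u i)\<^sup>2 / (2 * K)\<^sup>2)) \<partial>P) \<le> 2"
proof -
  define v where "v = (\<lambda>i. if i \<in> I then u i else 0)"
  have "(\<Sum>i<d. (v i)\<^sup>2) = (\<Sum>i\<in>I. (u i)\<^sup>2)"
    using I by (intro sum.mono_neutral_cong_right) (auto simp: v_def)
  then have "L2_set v {..<d} \<le> 1" using u by (simp add: L2_set_def)
  moreover have "(\<Sum>i<d. x i * v i) = (\<Sum>i\<in>I. x i * u i)" for x :: "nat \<Rightarrow> real"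
    using I by (intro sum.mono_neutral_cong_right) (auto simp: v_def)
  ultimately show ?thesis using inner_psi2_full[of v] by simp
qed

lemma inner_measurable [measurable]:
  assumes "I \<subseteq> {..<d}" shows "(\<lambda>x. \<Sum>i\<in>I. x i * u i) \<in> borel_measurable P"
  using assms by (intro borel_measurable_sum borel_measurable_times) auto

lemma L2_measurable [measurable]:
  assumes "I \<subseteq> {..<d}" shows "(\<lambda>x. L2_set x I) \<in> borel_measurable P"
  unfolding L2_set_def using assms
  by (intro measurable_compose[OF _ borel_measurable_sqrt] borel_measurable_sum borel_measurable_power) auto

lemma clip_measurable [measurable]:
  assumes "I \<subseteq> {..<d}" "i \<in> I" shows "(\<lambda>x. clip R I x i) \<in> borel_measurable P"
proof -
  note [measurable] = L2_measurable[OF assms(1)] coordinate_measurable[of i]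
  have "i < d" using assms by auto
  then show ?thesis unfolding clip_def by measurable
qed

text \<open>
  A product of two subgaussian variables is subexponential: \<open>|a b| \<le> (a\<^sup>2 + b\<^sup>2) / 2\<close>, and the
  exponential of a mean is at most the mean of the exponentials.
\<close>
lemma inner_product_psi1:
  assumes I: "I \<subseteq> {..<d}" "L2_set u I \<le> 1" and J: "J \<subseteq> {..<d}" "L2_set v J \<le> 1"
  shows "(\<integral>\<^sup>+x. ennreal (exp (\<bar>(\<Sum>i\<in>I. x i * u i) * (\<Sum>j\<in>J. x j * v j)\<bar> / (2 * K)\<^sup>2)) \<partial>P) \<le> 2"
proof -
  let ?a = "\<lambda>x. \<Sum>i\<in>I. x i * u i" and ?b = "\<lambda>x. \<Sum>j\<in>J. x j * v j"
  note [measurable] = inner_measurable[OF I(1)] inner_measurable[OF J(1)]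
  have pt: "exp (\<bar>?a x * ?b x\<bar> / (2 * K)\<^sup>2)
      \<le> 1 / 2 * exp ((?a x)\<^sup>2 / (2 * K)\<^sup>2) + 1 / 2 * exp ((?b x)\<^sup>2 / (2 * K)\<^sup>2)" for x
  proof -
    define A where "A = (?a x)\<^sup>2 / (2 * K)\<^sup>2 / 2"
    define B where "B = (?b x)\<^sup>2 / (2 * K)\<^sup>2 / 2"
    have "2 * \<bar>?a x\<bar> * \<bar>?b x\<bar> \<le> (?a x)\<^sup>2 + (?b x)\<^sup>2"
      using sum_squares_bound[of "\<bar>?a x\<bar>" "\<bar>?b x\<bar>"] by simp
    then have "\<bar>?a x * ?b x\<bar> / (2 * K)\<^sup>2 \<le> ((?a x)\<^sup>2 + (?b x)\<^sup>2) / 2 / (2 * K)\<^sup>2"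
      by (intro divide_right_mono) (auto simp: abs_mult)
    also have "\<dots> = A + B" by (simp add: A_def B_def add_divide_distrib)
    finally have "exp (\<bar>?a x * ?b x\<bar> / (2 * K)\<^sup>2) \<le> exp A * exp B" by (simp add: exp_add[symmetric])
    also have "\<dots> \<le> 1 / 2 * (exp A)\<^sup>2 + 1 / 2 * (exp B)\<^sup>2"
      using sum_squares_bound[of "exp A" "exp B"] by simp
    also have "\<dots> = 1 / 2 * exp ((?a x)\<^sup>2 / (2 * K)\<^sup>2) + 1 / 2 * exp ((?b x)\<^sup>2 / (2 * K)\<^sup>2)"
      by (simp add: A_def B_def exp_double[symmetric])
    finally show ?thesis .
  qed
  have "(\<integral>\<^sup>+x. ennreal (exp (\<bar>?a x * ?b x\<bar> / (2 * K)\<^sup>2)) \<partial>P)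
     \<le> (\<integral>\<^sup>+x. ennreal (1 / 2) * ennreal (exp ((?a x)\<^sup>2 / (2 * K)\<^sup>2)) + ennreal (1 / 2) * ennreal (exp ((?b x)\<^sup>2 / (2 * K)\<^sup>2)) \<partial>P)"
  proof (intro nn_integral_mono)
    fix x
    show "ennreal (exp (\<bar>?a x * ?b x\<bar> / (2 * K)\<^sup>2)) \<le> ennreal (1 / 2) * ennreal (exp ((?a x)\<^sup>2 / (2 * K)\<^sup>2)) + ennreal (1 / 2) * ennreal (exp ((?b x)\<^sup>2 / (2 * K)\<^sup>2))"
      using ennreal_leI[OF pt[of x]]
      by (subst (asm) ennreal_plus) (simp_all only: ennreal_mult' divide_nonneg_nonneg zero_le_one zero_le_numeral exp_ge_zero mult_nonneg_nonneg)
  qed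
  also have "\<dots> = ennreal (1 / 2) * (\<integral>\<^sup>+x. ennreal (exp ((?a x)\<^sup>2 / (2 * K)\<^sup>2)) \<partial>P)
      + ennreal (1 / 2) * (\<integral>\<^sup>+x. ennreal (exp ((?b x)\<^sup>2 / (2 * K)\<^sup>2)) \<partial>P)"
    by (simp add: nn_integral_add nn_integral_cmult)
  also have "\<dots> \<le> ennreal (1 / 2) * 2 + ennreal (1 / 2) * 2"
    by (intro add_mono mult_left_mono inner_psi2 I J) auto
  also have "\<dots> = ennreal 2"
    unfolding ennreal_numeral[symmetric] ennreal_mult''[symmetric, OF zero_le_numeral]
    by (subst ennreal_plus[symmetric]) simp_all
  finally show ?thesis by simp
qed

lemma inner_product_second_moment:
  assumes I: "I \<subseteq> {..<d}" "L2_set u I \<le> 1" and J: "J \<subseteq> {..<d}" "L2_set v J \<le> 1"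
  shows "(\<integral>\<^sup>+x. ennreal (((\<Sum>i\<in>I. x i * u i) * (\<Sum>j\<in>J. x j * v j))\<^sup>2) \<partial>P) \<le> ennreal (64 * K ^ 4)"
proof -
  let ?y = "\<lambda>x. (\<Sum>i\<in>I. x i * u i) * (\<Sum>j\<in>J. x j * v j)"
  note [measurable] = inner_measurable[OF I(1)] inner_measurable[OF J(1)]
  have "(?y x)\<^sup>2 \<le> 32 * K ^ 4 * exp (\<bar>?y x\<bar> / (2 * K)\<^sup>2)" for x
  proof -
    have "(\<bar>?y x\<bar> / (2 * K)\<^sup>2)\<^sup>2 \<le> 2 * exp (\<bar>?y x\<bar> / (2 * K)\<^sup>2)" by (rule square_le_exp) simp
    moreover have "(\<bar>?y x\<bar> / (2 * K)\<^sup>2)\<^sup>2 = (?y x)\<^sup>2 / (16 * K ^ 4)"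
      by (simp only: power_divide power2_abs) (simp add: power_mult_distrib)
    ultimately show ?thesis using K_pos by (simp add: field_simps)
  qed
  then have "(\<integral>\<^sup>+x. ennreal ((?y x)\<^sup>2) \<partial>P) \<le> (\<integral>\<^sup>+x. ennreal (32 * K ^ 4) * ennreal (exp (\<bar>?y x\<bar> / (2 * K)\<^sup>2)) \<partial>P)"
    by (intro nn_integral_mono) (simp add: ennreal_mult'[symmetric] ennreal_leI)
  also have "\<dots> = ennreal (32 * K ^ 4) * (\<integral>\<^sup>+x. ennreal (exp (\<bar>?y x\<bar> / (2 * K)\<^sup>2)) \<partial>P)"
    by (intro nn_integral_cmult) measurable
  also have "\<dots> \<le> ennreal (32 * K ^ 4) * 2"
    by (intro mult_left_mono inner_product_psi1 I J) auto
  also have "\<dots> = ennreal (64 * K ^ 4)"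
    unfolding ennreal_numeral[symmetric] ennreal_mult''[symmetric, OF zero_le_numeral] by simp
  finally show ?thesis .
qed

text \<open>
  The norm is at most twice an inner product with some net point, so \<open>exp (\<parallel>x\<parallel>\<^sup>2 / (16 K\<^sup>2))\<close> is at most
  the sum of the exponentials for all net points.
\<close>
lemma norm_exp_moment:
  assumes I: "I \<subseteq> {..<d}"
  shows "(\<integral>\<^sup>+x. ennreal (exp ((L2_set x I)\<^sup>2 / (16 * K\<^sup>2))) \<partial>P) \<le> ennreal (2 * net_base ^ card I)"
proof -
  have fin: "finite I" using I finite_subset by blast
  obtain S where S: "quarter_net I S" "real (card S) \<le> net_base ^ card I"
    using ex_quarter_net[OF fin] by blast
  have finS: "finite S" using S by (simp add: quarter_net_def)
  note [measurable] = inner_measurable[OF I]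
  have "ennreal (exp ((L2_set x I)\<^sup>2 / (16 * K\<^sup>2))) \<le> (\<Sum>u\<in>S. ennreal (exp ((\<Sum>i\<in>I. x i * u i)\<^sup>2 / (2 * K)\<^sup>2)))" for x
  proof -
    obtain u where u: "u \<in> S" "L2_set x I \<le> 2 * (\<Sum>i\<in>I. x i * u i)"
      using L2_le_net_inner[OF fin S(1)] by blast
    have "(L2_set x I)\<^sup>2 \<le> (2 * (\<Sum>i\<in>I. x i * u i))\<^sup>2" using u(2) by (intro power_mono) auto
    then have "(L2_set x I)\<^sup>2 / (16 * K\<^sup>2) \<le> (2 * (\<Sum>i\<in>I. x i * u i))\<^sup>2 / (16 * K\<^sup>2)"
      by (intro divide_right_mono) auto
    also have "\<dots> = (\<Sum>i\<in>I. x i * u i)\<^sup>2 / (2 * K)\<^sup>2" by (simp add: power_mult_distrib)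
    finally have "ennreal (exp ((L2_set x I)\<^sup>2 / (16 * K\<^sup>2))) \<le> ennreal (exp ((\<Sum>i\<in>I. x i * u i)\<^sup>2 / (2 * K)\<^sup>2))"
      by (simp add: ennreal_leI)
    also have "\<dots> \<le> (\<Sum>u\<in>S. ennreal (exp ((\<Sum>i\<in>I. x i * u i)\<^sup>2 / (2 * K)\<^sup>2)))"
      using u(1) finS by (intro member_le_sum) auto
    finally show ?thesis .
  qed
  then have "(\<integral>\<^sup>+x. ennreal (exp ((L2_set x I)\<^sup>2 / (16 * K\<^sup>2))) \<partial>P)
     \<le> (\<integral>\<^sup>+x. (\<Sum>u\<in>S. ennreal (exp ((\<Sum>i\<in>I. x i * u i)\<^sup>2 / (2 * K)\<^sup>2))) \<partial>P)"
    by (intro nn_integral_mono)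
  also have "\<dots> = (\<Sum>u\<in>S. (\<integral>\<^sup>+x. ennreal (exp ((\<Sum>i\<in>I. x i * u i)\<^sup>2 / (2 * K)\<^sup>2)) \<partial>P))"
    by (intro nn_integral_sum) measurable
  also have "\<dots> \<le> (\<Sum>u\<in>S. 2)"
    using S(1) by (intro sum_mono inner_psi2[OF I]) (auto simp: quarter_net_def)
  also have "\<dots> = ennreal (2 * real (card S))"
    by (simp add: ennreal_mult ennreal_of_nat_eq_real_of_nat mult.commute)
  also have "\<dots> \<le> ennreal (2 * net_base ^ card I)" using S(2) by (intro ennreal_leI) auto
  finally show ?thesis .
qed

text \<open>
  The numerical threshold for \<open>C\<close> is set here: the exponent \<open>C\<^sup>2 k / 16 \<ge> 25 k\<close> has to beat the
  logarithm of the size of the net, which is at most \<open>19 k\<close>, by at least \<open>2 k\<close>.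
\<close>
lemma norm_tail:
  assumes I: "I \<subseteq> {..<d}" "card I \<le> k" and k: "1 \<le> k" and C: "20 \<le> C"
  shows "emeasure P {x\<in>space P. C * K * sqrt (real k) < L2_set x I} \<le> ennreal (exp (- 2 * real k))"
proof -
  let ?R = "C * K * sqrt (real k)"
  note [measurable] = L2_measurable[OF I(1)]
  have C2: "25 * real k \<le> ?R\<^sup>2 / (16 * K\<^sup>2)"
  proof -
    have "20\<^sup>2 \<le> C\<^sup>2" using C by (intro power_mono) auto
    then have "25 * 16 * real k \<le> C\<^sup>2 * real k" by (intro mult_right_mono) auto
    moreover have "?R\<^sup>2 / (16 * K\<^sup>2) = C\<^sup>2 * real k / 16" using K_pos by (simp add: power_mult_distrib)
    ultimately show ?thesis by simp
  qed
  have "emeasure P {x\<in>space P. ?R < L2_set x I} = (\<integral>\<^sup>+x. indicator {x\<in>space P. ?R < L2_set x I} x \<partial>P)"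
    by (rule nn_integral_indicator[symmetric]) measurable
  also have "\<dots> \<le> (\<integral>\<^sup>+x. ennreal (exp (- 25 * real k)) * ennreal (exp ((L2_set x I)\<^sup>2 / (16 * K\<^sup>2))) \<partial>P)"
  proof (intro nn_integral_mono)
    fix x
    show "indicator {x\<in>space P. ?R < L2_set x I} x \<le> ennreal (exp (- 25 * real k)) * ennreal (exp ((L2_set x I)\<^sup>2 / (16 * K\<^sup>2)))"
    proof (cases "?R < L2_set x I")
      case True
      have "?R\<^sup>2 \<le> (L2_set x I)\<^sup>2" using True C K_pos by (intro power_mono) auto
      then have "?R\<^sup>2 / (16 * K\<^sup>2) \<le> (L2_set x I)\<^sup>2 / (16 * K\<^sup>2)" by (intro divide_right_mono) auto
      then have "1 \<le> exp (- 25 * real k + (L2_set x I)\<^sup>2 / (16 * K\<^sup>2))" using C2 by simp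
      then have "1 \<le> ennreal (exp (- 25 * real k) * exp ((L2_set x I)\<^sup>2 / (16 * K\<^sup>2)))"
        by (simp add: exp_add[symmetric])
      then show ?thesis using True by (simp add: ennreal_mult indicator_def)
    qed simp
  qed
  also have "\<dots> = ennreal (exp (- 25 * real k)) * (\<integral>\<^sup>+x. ennreal (exp ((L2_set x I)\<^sup>2 / (16 * K\<^sup>2))) \<partial>P)"
    by (intro nn_integral_cmult) measurable
  also have "\<dots> \<le> ennreal (exp (- 25 * real k)) * ennreal (2 * net_base ^ card I)"
    by (intro mult_left_mono norm_exp_moment I) auto
  also have "\<dots> \<le> ennreal (exp (- 25 * real k)) * ennreal (exp (19 * real k))"
  proof (intro mult_left_mono ennreal_leI)
    have e: "(2::real) \<le> exp 1" using exp_ge_add_one_self[of 1] by simp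
    have "net_base \<le> 2 ^ 18" by simp
    also have "(2::real) ^ 18 \<le> exp 1 ^ 18" using e by (intro power_mono) auto
    finally have "net_base ^ card I \<le> (exp 1 ^ 18) ^ card I" by (intro power_mono) auto
    also have "\<dots> \<le> (exp 1 ^ 18) ^ k" using I(2) e by (intro power_increasing one_le_power) auto
    finally have "2 * net_base ^ card I \<le> exp 1 ^ k * (exp 1 ^ 18) ^ k"
      using e k power_increasing[of 1 k "exp (1::real)"] by (intro mult_mono) auto
    also have "\<dots> = exp 1 ^ (19 * k)" by (simp only: power_mult[symmetric] power_add[symmetric]) simp
    also have "\<dots> = exp (19 * real k)" by (simp add: exp_of_nat_mult[symmetric])
    finally show "2 * net_base ^ card I \<le> exp (19 * real k)" .
  qed auto
  also have "\<dots> \<le> ennreal (exp (- 2 * real k))"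
    by (simp add: ennreal_mult[symmetric] exp_add[symmetric] ennreal_leI)
  finally show ?thesis .
qed

end

section \<open>Maxima over the blocks of the band, and clipping bias\<close>

lemma card_index_block_le: "1 \<le> k \<Longrightarrow> card (index_block d k p) \<le> min k d"
proof -
  assume k: "1 \<le> k"
  have "index_block d k p \<subseteq> {p * k..<p * k + k}"
  proof
    fix i assume "i \<in> index_block d k p"
    then have "i = p * k + i mod k" by (auto simp: index_block_def)
    moreover have "i mod k < k" using k by simp
    ultimately show "i \<in> {p * k..<p * k + k}" by (metis atLeastLessThan_iff le_add1 nat_add_left_cancel_less)
  qed
  then have "card (index_block d k p) \<le> card {p * k..<p * k + k}" by (intro card_mono) auto
  moreover have "card (index_block d k p) \<le> card {..<d}" by (intro card_mono) (auto simp: index_block_def)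
  ultimately show ?thesis by simp
qed

lemma card_band_pairs_le: "card {(p, q). p < N \<and> q < N \<and> nat_gap p q \<le> 1} \<le> 3 * N"
proof -
  have "{(p, q). p < N \<and> q < N \<and> nat_gap p q \<le> 1}
      \<subseteq> (\<lambda>p. (p, p)) ` {..<N} \<union> (\<lambda>p. (p, Suc p)) ` {..<N} \<union> (\<lambda>p. (Suc p, p)) ` {..<N}" (is "_ \<subseteq> ?U")
  proof clarify
    fix p q assume "p < N" "q < N" "nat_gap p q \<le> 1" "(p, q) \<notin> (\<lambda>p. (Suc p, p)) ` {..<N}"
      "(p, q) \<notin> (\<lambda>p. (p, Suc p)) ` {..<N}"
    moreover from this have "q = p \<or> q = Suc p \<or> p = Suc q"
      by (auto simp: nat_gap_def max_def min_def split: if_splits)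
    ultimately show "(p, q) \<in> (\<lambda>p. (p, p)) ` {..<N}" by auto
  qed
  then have "card {(p, q). p < N \<and> q < N \<and> nat_gap p q \<le> 1} \<le> card ?U" by (intro card_mono) auto
  also have "\<dots> \<le> card ((\<lambda>p. (p, p)) ` {..<N}) + card ((\<lambda>p. (p, Suc p)) ` {..<N}) + card ((\<lambda>p. (Suc p, p)) ` {..<N})"
    by (meson add_mono_thms_linordered_semiring(3) card_Un_le order_trans)
  also have "\<dots> \<le> N + N + N" by (intro add_mono order_trans[OF card_image_le]) auto
  finally show ?thesis by simp
qed

text \<open>
  Logarithm of a bound on the number of scalars to be controlled: \<open>3 N\<close> blocks in the band, and two
  net points of dimension at most \<open>min k d\<close> for each. For \<open>k > d\<close> the dimension is \<open>d\<close>, not \<open>k\<close>.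
\<close>
definition log_net_size :: "nat \<Rightarrow> nat \<Rightarrow> nat \<Rightarrow> real" where
  "log_net_size N k d = ln (3 * real N) + 2 * real (min k d) * ln net_base"

text \<open>
  The scalars are the values of the block forms at pairs of net points. The factor 2 is the price of
  extending the bound from the nets to all vectors.
\<close>
lemma band_maximal_second_moment:
  fixes A :: "'a \<Rightarrow> nat \<Rightarrow> nat \<Rightarrow> real"
  assumes M: "prob_space M" and k: "1 \<le> k" and N: "0 < N" and l: "0 < l"
    and meas: "\<And>i j. i < d \<Longrightarrow> j < d \<Longrightarrow> nat_gap (i div k) (j div k) \<le> 1 \<Longrightarrow> i div k < N \<Longrightarrow> j div k < N
       \<Longrightarrow> (\<lambda>x. A x i j) \<in> borel_measurable M"
    and mgf: "\<And>p q u v t. p < N \<Longrightarrow> q < N \<Longrightarrow> nat_gap p q \<le> 1 \<Longrightarrow> L2_set u (index_block d k p) \<le> 1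
       \<Longrightarrow> L2_set v (index_block d k q) \<le> 1 \<Longrightarrow> \<bar>t\<bar> = 2 * l
       \<Longrightarrow> (\<integral>\<^sup>+x. ennreal (exp (t * bilin (index_block d k p) (index_block d k q) (A x) u v)) \<partial>M) \<le> ennreal (exp w)"
  obtains F :: "'a \<Rightarrow> real" where "F \<in> borel_measurable M" "\<And>x. 0 \<le> F x"
    "\<And>x p q. p < N \<Longrightarrow> q < N \<Longrightarrow> nat_gap p q \<le> 1
       \<Longrightarrow> op_norm_le (index_block d k p) (index_block d k q) (A x) (2 * sqrt (F x))"
    "(\<integral>\<^sup>+x. ennreal (F x) \<partial>M) \<le> ennreal (s\<^sup>2 + 4 / l\<^sup>2 * exp (log_net_size N k d + w - l * s))"
proof -
  let ?I = "index_block d k"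
  have "\<forall>p. \<exists>S. quarter_net (?I p) S \<and> real (card S) \<le> net_base ^ card (?I p)"
    using ex_quarter_net by simp
  from choice[OF this] obtain net where net: "\<And>p. quarter_net (?I p) (net p)"
    and card_net: "\<And>p. real (card (net p)) \<le> net_base ^ card (?I p)" by blast
  have fin_net: "finite (net p)" for p using net by (simp add: quarter_net_def)
  have card_net': "real (card (net p)) \<le> net_base ^ min k d" for p
    by (rule order_trans[OF card_net]) (intro power_increasing card_index_block_le[OF k], simp)
  define B where "B = {(p, q). p < N \<and> q < N \<and> nat_gap p q \<le> 1}"
  have finB: "finite B" by (rule finite_subset[of _ "{..<N} \<times> {..<N}"]) (auto simp: B_def)
  define T where "T = (SIGMA pq:B. net (fst pq) \<times> net (snd pq))"
  have finT: "finite T" unfolding T_def using finB fin_net by (intro finite_SigmaI) auto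
  have cardT: "real (card T) \<le> exp (log_net_size N k d)"
  proof -
    have "real (card T) = (\<Sum>pq\<in>B. real (card (net (fst pq))) * real (card (net (snd pq))))"
      unfolding T_def using finB fin_net by (subst card_SigmaI) auto
    also have "\<dots> \<le> (\<Sum>pq\<in>B. net_base ^ min k d * net_base ^ min k d)"
      by (intro sum_mono mult_mono card_net') auto
    also have "\<dots> = real (card B) * (net_base ^ min k d * net_base ^ min k d)" by simp
    also have "\<dots> \<le> (3 * real N) * (net_base ^ min k d * net_base ^ min k d)"
      using of_nat_mono[OF card_band_pairs_le[of N], where 'a = real]
      by (intro mult_right_mono) (auto simp: B_def)
    also have "\<dots> = exp (ln (3 * real N)) * (exp (ln net_base) ^ min k d * exp (ln net_base) ^ min k d)"
      using N by simp
    also have "\<dots> = exp (log_net_size N k d)"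
      unfolding log_net_size_def exp_of_nat_mult[symmetric] exp_add[symmetric] by (simp add: algebra_simps)
    finally show ?thesis .
  qed
  define Z where "Z = (\<lambda>(pq, u, v) x. bilin (?I (fst pq)) (?I (snd pq)) (A x) u v)"
  have Zm: "Z j \<in> borel_measurable M" if "j \<in> T" for j
  proof -
    obtain p q u v where j: "j = ((p, q), u, v)" by (metis prod.collapse)
    have "(\<lambda>x. A x i i') \<in> borel_measurable M" if "i \<in> ?I p" "i' \<in> ?I q" for i i'
      using that \<open>j \<in> T\<close> by (intro meas) (auto simp: j T_def B_def index_block_def)
    then show ?thesis unfolding Z_def j bilin_def
      by (simp only: prod.case fst_conv snd_conv)
         (intro borel_measurable_sum borel_measurable_times borel_measurable_const)
  qed
  have Zmgf: "(\<integral>\<^sup>+x. ennreal (exp (t * Z j x)) \<partial>M) \<le> ennreal (exp w)" if j: "j \<in> T" and t: "\<bar>t\<bar> = 2 * l" for j t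
  proof -
    obtain p q u v where j': "j = ((p, q), u, v)" by (metis prod.collapse)
    show ?thesis unfolding Z_def j' prod.case fst_conv snd_conv
      using j net[of p] net[of q] by (intro mgf t) (auto simp: j' T_def B_def quarter_net_def)
  qed
  show thesis
  proof (rule maximal_second_moment[OF M finT cardT l, of Z w s])
    show "Z j \<in> borel_measurable M" if "j \<in> T" for j using Zm[OF that] .
    show "(\<integral>\<^sup>+x. ennreal (exp (t * Z j x)) \<partial>M) \<le> ennreal (exp w)" if "j \<in> T" "\<bar>t\<bar> = 2 * l" for j t
      using Zmgf[OF that] .
    fix F assume F: "F \<in> borel_measurable M" "\<And>x. 0 \<le> F x" "\<And>x j. j \<in> T \<Longrightarrow> (Z j x)\<^sup>2 \<le> F x"
      "(\<integral>\<^sup>+x. ennreal (F x) \<partial>M) \<le> ennreal (s\<^sup>2 + 4 / l\<^sup>2 * exp (log_net_size N k d + w - l * s))"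
    show thesis
    proof (rule that[OF F(1,2) _ F(4)])
      fix x p q assume pq: "p < N" "q < N" "nat_gap p q \<le> 1"
      show "op_norm_le (?I p) (?I q) (A x) (2 * sqrt (F x))"
      proof (rule op_norm_le_netI[OF _ _ net net])
        fix u v assume "u \<in> net p" "v \<in> net q"
        then have "((p, q), u, v) \<in> T" using pq by (simp add: T_def B_def)
        from F(3)[OF this] have "(bilin (?I p) (?I q) (A x) u v)\<^sup>2 \<le> F x" by (simp add: Z_def)
        then show "bilin (?I p) (?I q) (A x) u v \<le> sqrt (F x)" by (rule real_le_rsqrt)
      qed auto
    qed
  qed
qed

lemma bilin_clip:
  "bilin I J (\<lambda>i j. clip R I x i * clip R J x j) u v
     = (min 1 (R / L2_set x I) * min 1 (R / L2_set x J)) * ((\<Sum>i\<in>I. x i * u i) * (\<Sum>j\<in>J. x j * v j))"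
proof -
  have "bilin I J (\<lambda>i j. clip R I x i * clip R J x j) u v
     = (\<Sum>i\<in>I. u i * clip R I x i) * (\<Sum>j\<in>J. clip R J x j * v j)"
    by (simp add: bilin_def sum_product mult.assoc)
  also have "(\<Sum>i\<in>I. u i * clip R I x i) = min 1 (R / L2_set x I) * (\<Sum>i\<in>I. x i * u i)"
    unfolding clip_def sum_distrib_left by (intro sum.cong refl) (simp only: mult_ac)
  also have "(\<Sum>j\<in>J. clip R J x j * v j) = min 1 (R / L2_set x J) * (\<Sum>j\<in>J. x j * v j)"
    unfolding clip_def sum_distrib_left by (intro sum.cong refl) (simp only: mult_ac)
  finally show ?thesis by (simp only: mult_ac)
qed

lemma clip_factor_bounds: "0 \<le> R \<Longrightarrow> 0 \<le> min 1 (R / L2_set x I) \<and> min 1 (R / L2_set x I) \<le> 1"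
  by simp

context subgaussian_law
begin

lemma bilin_clip_psi1:
  assumes I: "I \<subseteq> {..<d}" "L2_set u I \<le> 1" and J: "J \<subseteq> {..<d}" "L2_set v J \<le> 1" and R: "0 \<le> R"
  shows "(\<integral>\<^sup>+x. ennreal (exp (\<bar>bilin I J (\<lambda>i j. clip R I x i * clip R J x j) u v\<bar> / (2 * K)\<^sup>2)) \<partial>P) \<le> 2"
proof (rule order_trans[OF nn_integral_mono inner_product_psi1[OF I J]])
  fix x
  let ?y = "(\<Sum>i\<in>I. x i * u i) * (\<Sum>j\<in>J. x j * v j)"
  have "\<bar>bilin I J (\<lambda>i j. clip R I x i * clip R J x j) u v\<bar> \<le> 1 * 1 * \<bar>?y\<bar>"
    unfolding bilin_clip abs_mult[of "_ * _" ?y]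
    using clip_factor_bounds[OF R, of x I] clip_factor_bounds[OF R, of x J]
    by (intro mult_right_mono) (auto simp: abs_mult intro!: mult_le_one)
  then have "\<bar>bilin I J (\<lambda>i j. clip R I x i * clip R J x j) u v\<bar> / (2 * K)\<^sup>2 \<le> \<bar>?y\<bar> / (2 * K)\<^sup>2"
    by (intro divide_right_mono) auto
  then show "ennreal (exp (\<bar>bilin I J (\<lambda>i j. clip R I x i * clip R J x j) u v\<bar> / (2 * K)\<^sup>2))
      \<le> ennreal (exp (\<bar>?y\<bar> / (2 * K)\<^sup>2))" by (intro ennreal_leI) simp
qed

lemma integrable_coordinate_product:
  assumes "i < d" "j < d" shows "integrable P (\<lambda>x. x i * x j)"
proof (rule integrableI_bounded)
  note [measurable] = coordinate_measurable[OF assms(1)] coordinate_measurable[OF assms(2)]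
  show "(\<lambda>x. x i * x j) \<in> borel_measurable P" by measurable
  have "(\<integral>\<^sup>+x. ennreal (norm (x i * x j)) \<partial>P) \<le> (\<integral>\<^sup>+x. ennreal ((2 * K)\<^sup>2) * ennreal (exp (\<bar>x i * x j\<bar> / (2 * K)\<^sup>2)) \<partial>P)"
  proof (intro nn_integral_mono)
    fix x
    have "\<bar>x i * x j\<bar> / (2 * K)\<^sup>2 \<le> exp (\<bar>x i * x j\<bar> / (2 * K)\<^sup>2)"
      using exp_ge_add_one_self[of "\<bar>x i * x j\<bar> / (2 * K)\<^sup>2"] by linarith
    then have "\<bar>x i * x j\<bar> \<le> (2 * K)\<^sup>2 * exp (\<bar>x i * x j\<bar> / (2 * K)\<^sup>2)" using K_pos by (simp add: field_simps)
    then show "ennreal (norm (x i * x j)) \<le> ennreal ((2 * K)\<^sup>2) * ennreal (exp (\<bar>x i * x j\<bar> / (2 * K)\<^sup>2))"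
      by (simp only: ennreal_mult'[symmetric] zero_le_power2 real_norm_def ennreal_leI)
  qed
  also have "\<dots> = ennreal ((2 * K)\<^sup>2) * (\<integral>\<^sup>+x. ennreal (exp (\<bar>x i * x j\<bar> / (2 * K)\<^sup>2)) \<partial>P)"
    by (intro nn_integral_cmult) measurable
  also have "\<dots> \<le> ennreal ((2 * K)\<^sup>2) * 2"
    using inner_product_psi1[of "{i}" "\<lambda>_. 1" "{j}" "\<lambda>_. 1"] assms
    by (intro mult_left_mono) (simp_all add: L2_set_def)
  also have "\<dots> < \<infinity>" by (simp add: ennreal_mult_less_top)
  finally show "(\<integral>\<^sup>+x. ennreal (norm (x i * x j)) \<partial>P) < \<infinity>" .
qed

lemma integrable_clip_product:
  assumes "I \<subseteq> {..<d}" "J \<subseteq> {..<d}" "i \<in> I" "j \<in> J" "0 \<le> R"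
  shows "integrable P (\<lambda>x. clip R I x i * clip R J x j)"
proof (rule Bochner_Integration.integrable_bound[OF integrable_coordinate_product])
  show "i < d" "j < d" using assms by auto
  note [measurable] = clip_measurable[OF assms(1,3), of R] clip_measurable[OF assms(2,4), of R]
  show "(\<lambda>x. clip R I x i * clip R J x j) \<in> borel_measurable P" by measurable
  show "AE x in P. norm (clip R I x i * clip R J x j) \<le> norm (x i * x j)"
  proof (rule AE_I2)
    fix x
    have "\<bar>clip R I x i\<bar> \<le> \<bar>x i\<bar>" "\<bar>clip R J x j\<bar> \<le> \<bar>x j\<bar>"
      using clip_factor_bounds[OF assms(5), of x I] clip_factor_bounds[OF assms(5), of x J]
      unfolding clip_def abs_mult by (intro mult_left_le; simp)+
    then show "norm (clip R I x i * clip R J x j) \<le> norm (x i * x j)"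
      by (simp add: abs_mult mult_mono)
  qed
qed

text \<open>
  With \<open>y\<close> the product of the two unclipped inner products, clipping changes \<open>y\<close> by at most \<open>|y|\<close>,
  and only on the event that one of the two subvectors is long. There
  \<open>|y| \<le> (e\<^sup>-\<^sup>k y\<^sup>2 + e\<^sup>k) / 2\<close>, where \<open>y\<^sup>2\<close> has bounded mean and the event has probability at most \<open>2 e\<^sup>-\<^sup>2\<^sup>k\<close>.
\<close>
lemma clip_bias_op_norm_le:
  assumes I: "I \<subseteq> {..<d}" "card I \<le> k" and J: "J \<subseteq> {..<d}" "card J \<le> k" and k: "1 \<le> k" and C: "20 \<le> C"
  defines "R \<equiv> C * K * sqrt (real k)"
  shows "op_norm_le I J (\<lambda>i j. (\<integral>x. clip R I x i * clip R J x j \<partial>P) - cov_mat P i j)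
     ((32 * K ^ 4 + 1) * exp (- real k))"
proof (rule op_norm_le_unitI)
  show "finite I" "finite J" using I J finite_subset by blast+
  fix u v assume u: "L2_set u I \<le> 1" and v: "L2_set v J \<le> 1"
  have R: "0 \<le> R" using C K_pos by (simp add: R_def)
  let ?y = "\<lambda>x. (\<Sum>i\<in>I. x i * u i) * (\<Sum>j\<in>J. x j * v j)"
  let ?g = "\<lambda>x. bilin I J (\<lambda>i j. clip R I x i * clip R J x j - x i * x j) u v"
  let ?EI = "{x\<in>space P. R < L2_set x I}" and ?EJ = "{x\<in>space P. R < L2_set x J}"
  note [measurable] = inner_measurable[OF I(1)] inner_measurable[OF J(1)] L2_measurable[OF I(1)] L2_measurable[OF J(1)]
  have int: "integrable P (\<lambda>x. clip R I x i * clip R J x j - x i * x j)" if "i \<in> I" "j \<in> J" for i j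
    using that I J R by (intro Bochner_Integration.integrable_diff integrable_clip_product integrable_coordinate_product) auto
  have gi: "integrable P ?g" unfolding bilin_def
    using int by (intro Bochner_Integration.integrable_sum integrable_mult_right integrable_mult_left)
  have eq: "bilin I J (\<lambda>i j. (\<integral>x. clip R I x i * clip R J x j \<partial>P) - cov_mat P i j) u v = (\<integral>x. ?g x \<partial>P)"
  proof -
    have "(\<integral>x. ?g x \<partial>P) = (\<Sum>i\<in>I. \<Sum>j\<in>J. \<integral>x. u i * (clip R I x i * clip R J x j - x i * x j) * v j \<partial>P)"
    proof -
      have int': "integrable P (\<lambda>x. u i * (clip R I x i * clip R J x j - x i * x j) * v j)" if "i \<in> I" "j \<in> J" for i j
        using int[OF that] by (intro integrable_mult_right integrable_mult_left)
      have "(\<integral>x. ?g x \<partial>P) = (\<Sum>i\<in>I. \<integral>x. (\<Sum>j\<in>J. u i * (clip R I x i * clip R J x j - x i * x j) * v j) \<partial>P)"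
        unfolding bilin_def using int' by (intro Bochner_Integration.integral_sum Bochner_Integration.integrable_sum)
      also have "\<dots> = (\<Sum>i\<in>I. \<Sum>j\<in>J. \<integral>x. u i * (clip R I x i * clip R J x j - x i * x j) * v j \<partial>P)"
        using int' by (intro sum.cong[OF refl] Bochner_Integration.integral_sum)
      finally show ?thesis .
    qed
    also have "\<dots> = bilin I J (\<lambda>i j. \<integral>x. clip R I x i * clip R J x j - x i * x j \<partial>P) u v"
      by (simp add: bilin_def)
    also have "\<dots> = bilin I J (\<lambda>i j. (\<integral>x. clip R I x i * clip R J x j \<partial>P) - cov_mat P i j) u v"
    proof (intro bilin_cong refl)
      fix i j assume ij: "i \<in> I" "j \<in> J"
      then have "i < d" "j < d" using I J by auto
      then show "(\<integral>x. clip R I x i * clip R J x j - x i * x j \<partial>P) = (\<integral>x. clip R I x i * clip R J x j \<partial>P) - cov_mat P i j"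
        using ij I J R by (subst Bochner_Integration.integral_diff)
          (auto intro: integrable_clip_product integrable_coordinate_product simp: cov_mat_eq)
    qed
    finally show ?thesis by simp
  qed
  have g: "?g x = (min 1 (R / L2_set x I) * min 1 (R / L2_set x J)) * ?y x - ?y x" for x
  proof -
    have "bilin I J (\<lambda>i j. x i * x j) u v = ?y x"
      by (simp add: bilin_def sum_product mult_ac)
    moreover have "?g x = bilin I J (\<lambda>i j. clip R I x i * clip R J x j) u v - bilin I J (\<lambda>i j. x i * x j) u v"
      by (simp add: bilin_def algebra_simps sum_subtractf)
    ultimately show ?thesis by (simp only: bilin_clip)
  qed
  have pt: "\<bar>?g x\<bar> \<le> exp (- real k) / 2 * (?y x)\<^sup>2 + exp (real k) / 2 * (indicat_real ?EI x + indicat_real ?EJ x)"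
    if x: "x \<in> space P" for x
  proof (cases "L2_set x I \<le> R \<and> L2_set x J \<le> R")
    case True
    \<comment> \<open>A zero subvector has clipping factor 0, because \<open>R / 0 = 0\<close>, but its inner products vanish as well.\<close>
    have *: "min 1 (R / L2_set x A) = 1 \<or> (\<Sum>i\<in>A. x i * w i) = 0" if "L2_set x A \<le> R" "finite A" for A w
    proof (cases "L2_set x A = 0")
      case True
      then show ?thesis using that by (simp add: L2_set_eq_0_iff)
    next
      case False
      then have "1 \<le> R / L2_set x A" using that by (simp add: less_le)
      then show ?thesis by simp
    qed
    have "?g x = 0" unfolding g
      using *[of I u] *[of J v] True \<open>finite I\<close> \<open>finite J\<close> by auto
    then show ?thesis by (auto intro!: add_nonneg_nonneg mult_nonneg_nonneg)
  next
    case False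
    define c where "c = min 1 (R / L2_set x I) * min 1 (R / L2_set x J)"
    have c: "0 \<le> c" "c \<le> 1" unfolding c_def
      using clip_factor_bounds[OF R, of x I] clip_factor_bounds[OF R, of x J]
      by (auto intro!: mult_le_one simp del: min_less_iff_conj)
    have "\<bar>?g x\<bar> = (1 - c) * \<bar>?y x\<bar>"
    proof -
      have "?g x = - ((1 - c) * ?y x)" unfolding g c_def[symmetric] by (simp only: left_diff_distrib minus_diff_eq mult_1)
      then show ?thesis using c by (simp only: abs_minus_cancel abs_mult[of "1 - c"] abs_of_nonneg diff_ge_0_iff_ge)
    qed
    also have "\<dots> \<le> \<bar>?y x\<bar>" using c by (simp add: mult_left_le_one_le)
    also have "\<dots> \<le> exp (- real k) / 2 * (?y x)\<^sup>2 + exp (real k) / 2"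
    proof -
      have "exp (- real k) * exp (real k) = 1" by (simp add: exp_add[symmetric])
      moreover have "exp (- real k) * (\<bar>?y x\<bar> - exp (real k))\<^sup>2 = exp (- real k) * (?y x)\<^sup>2
          - 2 * \<bar>?y x\<bar> * (exp (- real k) * exp (real k)) + (exp (- real k) * exp (real k)) * exp (real k)"
        unfolding power2_diff power2_abs by (simp only: algebra_simps power2_eq_square)
      moreover have "0 \<le> exp (- real k) * (\<bar>?y x\<bar> - exp (real k))\<^sup>2" by simp
      ultimately show ?thesis by simp
    qed
    finally have "\<bar>?g x\<bar> \<le> exp (- real k) / 2 * (?y x)\<^sup>2 + exp (real k) / 2" .
    moreover have "exp (real k) / 2 * 1 \<le> exp (real k) / 2 * (indicat_real ?EI x + indicat_real ?EJ x)"
      using False x by (intro mult_left_mono) (auto simp: indicator_def)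
    ultimately show ?thesis by linarith
  qed
  have "ennreal \<bar>\<integral>x. ?g x \<partial>P\<bar> \<le> (\<integral>\<^sup>+x. ennreal \<bar>?g x\<bar> \<partial>P)"
    using integral_norm_bound_ennreal[OF gi] by simp
  also have "\<dots> \<le> (\<integral>\<^sup>+x. ennreal (exp (- real k) / 2) * ennreal ((?y x)\<^sup>2)
      + ennreal (exp (real k) / 2) * (indicator ?EI x + indicator ?EJ x) \<partial>P)"
  proof (intro nn_integral_mono)
    fix x assume x: "x \<in> space P"
    have "ennreal \<bar>?g x\<bar> \<le> ennreal (exp (- real k) / 2 * (?y x)\<^sup>2 + exp (real k) / 2 * (indicat_real ?EI x + indicat_real ?EJ x))"
      by (rule ennreal_leI[OF pt[OF x]])
    also have "\<dots> = ennreal (exp (- real k) / 2) * ennreal ((?y x)\<^sup>2) + ennreal (exp (real k) / 2) * (indicator ?EI x + indicator ?EJ x)"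
    proof -
      have "ennreal (a * b + c * (e + f)) = ennreal a * ennreal b + ennreal c * (ennreal e + ennreal f)"
        if "0 \<le> a" "0 \<le> b" "0 \<le> c" "0 \<le> e" "0 \<le> f" for a b c e f :: real
        using that by (simp add: ennreal_mult)
      from this[of "exp (- real k) / 2" "(?y x)\<^sup>2" "exp (real k) / 2" "indicat_real ?EI x" "indicat_real ?EJ x"]
      show ?thesis by (simp only: ennreal_indicator indicator_pos_le divide_nonneg_nonneg exp_ge_zero zero_le_numeral zero_le_power2 simp_thms)
    qed
    finally show "ennreal \<bar>?g x\<bar> \<le> \<dots>" .
  qed
  also have "\<dots> = ennreal (exp (- real k) / 2) * (\<integral>\<^sup>+x. ennreal ((?y x)\<^sup>2) \<partial>P)
      + ennreal (exp (real k) / 2) * (emeasure P ?EI + emeasure P ?EJ)"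
    by (simp add: nn_integral_add nn_integral_cmult)
  also have "\<dots> \<le> ennreal (exp (- real k) / 2) * ennreal (64 * K ^ 4)
      + ennreal (exp (real k) / 2) * (ennreal (exp (- 2 * real k)) + ennreal (exp (- 2 * real k)))"
    unfolding R_def
    by (intro add_mono mult_left_mono inner_product_second_moment norm_tail I J u v k C) auto
  also have "\<dots> = ennreal (exp (- real k) / 2 * (64 * K ^ 4) + exp (real k) / 2 * (exp (- 2 * real k) + exp (- 2 * real k)))"
    by (simp add: ennreal_mult[symmetric] ennreal_plus[symmetric] add_nonneg_nonneg del: ennreal_plus)
  also have "exp (- real k) / 2 * (64 * K ^ 4) + exp (real k) / 2 * (exp (- 2 * real k) + exp (- 2 * real k))
      = (32 * K ^ 4 + 1) * exp (- real k)"
  proof -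
    have "exp (real k) * exp (- 2 * real k) = exp (- real k)" by (simp add: exp_add[symmetric])
    then show ?thesis by (simp add: algebra_simps)
  qed
  finally have "\<bar>\<integral>x. ?g x \<partial>P\<bar> \<le> (32 * K ^ 4 + 1) * exp (- real k)"
    using K_pos by (subst (asm) ennreal_le_iff) auto
  then show "bilin I J (\<lambda>i j. (\<integral>x. clip R I x i * clip R J x j \<partial>P) - cov_mat P i j) u v
      \<le> (32 * K ^ 4 + 1) * exp (- real k)" unfolding eq by linarith
qed

end

section \<open>The estimator blockwise, and its sampling error\<close>

text \<open>
  All blocks at once: the clipping radius is applied to the index blocks that contain \<open>i\<close> and \<open>j\<close>.
\<close>
definition clip_prod :: "nat \<Rightarrow> nat \<Rightarrow> real \<Rightarrow> (nat \<Rightarrow> real) \<Rightarrow> nat \<Rightarrow> nat \<Rightarrow> real" where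
  "clip_prod d k R x i j =
     clip R (index_block d k (i div k)) x i * clip R (index_block d k (j div k)) x j"

text \<open>
  Variable \<open>(b, e)\<close> is the entry \<open>e\<close> of the noise matrix drawn for block \<open>b\<close>; below the diagonal both
  the block and the entry are those of the transposed position.
\<close>
definition noise_mat :: "nat \<Rightarrow> ((nat \<times> nat) \<times> (nat \<times> nat) \<Rightarrow> real) \<Rightarrow> nat \<Rightarrow> nat \<Rightarrow> real" where
  "noise_mat k W i j =
     W ((min (i div k) (j div k), nat_gap (i div k) (j div k)), (min i j, max i j))"

lemma le_num_blocks: "1 \<le> k \<Longrightarrow> d \<le> num_blocks d k * k"
proof -
  assume k: "1 \<le> k"
  have "d \<le> 2 ^ d * k" using less_exp[of d] k mult_le_mono[of d "2 ^ d" 1 k] by simp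
  then show ?thesis unfolding num_blocks_def by (rule LeastI)
qed

lemma num_blocks_pos: "0 < num_blocks d k"
  by (simp add: num_blocks_def)

text \<open>
  Padding at most doubles the dimension, unless a single block already covers it.
\<close>
lemma num_blocks_bound: "num_blocks d k = 1 \<or> num_blocks d k * k \<le> 2 * d"
proof (cases "LEAST J. d \<le> 2 ^ J * k")
  case (Suc J)
  then have "\<not> d \<le> 2 ^ J * k" by (intro not_less_Least) simp
  then show ?thesis unfolding num_blocks_def Suc by simp
qed (simp add: num_blocks_def)

lemma div_less_num_blocks:
  assumes "1 \<le> k" "i < d" shows "i div k < num_blocks d k"
  using le_num_blocks[OF assms(1), of d] assms by (simp add: less_mult_imp_div_less)

lemma mem_idx_block: "1 \<le> k \<Longrightarrow> i \<in> idx_block k l \<longleftrightarrow> i div k = l"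
proof
  assume k: "1 \<le> k"
  show "i div k = l" if "i \<in> idx_block k l"
    using that k by (intro div_nat_eqI) (auto simp: idx_block_def mult.commute)
  assume "i div k = l"
  then have "i = l * k + i mod k" by auto
  moreover have "i mod k < k" using k by simp
  ultimately show "i \<in> idx_block k l" unfolding idx_block_def by (simp add: algebra_simps)
qed

lemma clip_pad:
  assumes k: "1 \<le> k" and i: "i < d"
  shows "clip R (idx_block k l) (pad d x) i = clip R (index_block d k l) x i"
proof -
  have "(\<Sum>i\<in>idx_block k l. (pad d x i)\<^sup>2) = (\<Sum>i\<in>index_block d k l. (x i)\<^sup>2)"
    using k by (intro sum.mono_neutral_cong_right)
      (auto simp: idx_block_def[of k l] index_block_def pad_def mem_idx_block[symmetric])
  then show ?thesis using i by (simp add: clip_def L2_set_def pad_def)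
qed

lemma finite_tri_blocks [simp]: "finite (tri_blocks d k)"
proof (rule finite_subset)
  show "tri_blocks d k \<subseteq> {..<num_blocks d k} \<times> {..1}" by (auto simp: tri_blocks_def)
qed simp

text \<open>
  The band is symmetric, so below the diagonal the estimator has the same form as above it: swapping
  the two blocks leaves the product of the clipped entries unchanged.
\<close>
lemma dp_cov_tri_entry:
  assumes k: "1 \<le> k" and i: "i < d" and j: "j < d"
  shows "dp_cov_tri n d X k \<rho> R (\<lambda>b e. W (b, e)) i j =
    (if nat_gap (i div k) (j div k) \<le> 1
     then 1 / real n * (\<Sum>m<n. clip_prod d k R (X m) i j)
       + sqrt (18 * R ^ 4 / (\<rho> / (2 * real (num_blocks d k)) * (real n)\<^sup>2)) * noise_mat k W i j
     else 0)"
proof -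
  let ?p = "min (i div k) (j div k)" and ?r = "nat_gap (i div k) (j div k)"
  let ?s = "sqrt (18 * R ^ 4 / (\<rho> / (2 * real (num_blocks d k)) * (real n)\<^sup>2))"
  let ?g = "1 / real n * (\<Sum>m<n. clip_prod d k R (X m) i j) + ?s * noise_mat k W i j"
  have mm: "min i j div k = ?p" "max i j div k = max (i div k) (j div k)"
    using div_le_mono[of i j k] div_le_mono[of j i k] by (auto simp: min_def max_def)
  have iff: "min i j \<in> idx_block k l \<and> max i j \<in> idx_block k (l + r) \<longleftrightarrow> (l, r) = (?p, ?r)" for l r
    unfolding mem_idx_block[OF k] mm by (auto simp: nat_gap_def max_def min_def)
  have clips: "clip R (idx_block k ?p) (pad d x) (min i j) * clip R (idx_block k (?p + ?r)) (pad d x) (max i j)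
      = clip_prod d k R x i j" for x
  proof -
    have "?p + ?r = max (i div k) (j div k)" by (simp add: nat_gap_def)
    then show ?thesis
      using i j div_le_mono[of i j k] div_le_mono[of j i k]
      by (cases "i \<le> j") (auto simp: clip_pad[OF k] clip_prod_def min_def max_def mult.commute)
  qed
  have "dp_cov_tri n d X k \<rho> R (\<lambda>b e. W (b, e)) i j = (\<Sum>b\<in>tri_blocks d k. if b = (?p, ?r) then ?g else 0)"
    unfolding dp_cov_tri_def
  proof (intro sum.cong refl)
    fix b :: "nat \<times> nat"
    obtain l r where b: "b = (l, r)" by (cases b)
    show "(case b of (l, r) \<Rightarrow> dp_cov_block n (\<lambda>m. pad d (X m)) (idx_block k l) (idx_block k (l + r))
          (\<rho> / (2 * real (num_blocks d k))) R (\<lambda>e. W ((l, r), e)) (min i j) (max i j)) = (if b = (?p, ?r) then ?g else 0)"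
    proof (cases "b = (?p, ?r)")
      case True
      then have lr: "l = ?p" "r = ?r" using b by auto
      have "min i j \<in> idx_block k ?p \<and> max i j \<in> idx_block k (?p + ?r)" using iff by blast
      moreover have "min (min i j) (max i j) = min i j" "max (min i j) (max i j) = max i j" by auto
      ultimately show ?thesis unfolding b lr by (simp add: dp_cov_block_def clips noise_mat_def)
    next
      case False
      then have "\<not> (min i j \<in> idx_block k l \<and> max i j \<in> idx_block k (l + r))" unfolding iff b .
      then show ?thesis using False unfolding b by (simp only: dp_cov_block_def prod.case if_False)
    qed
  qed
  also have "\<dots> = (if (?p, ?r) \<in> tri_blocks d k then ?g else 0)" by (simp add: sum.delta)
  also have "(?p, ?r) \<in> tri_blocks d k \<longleftrightarrow> ?r \<le> 1"
    using div_less_num_blocks[OF k i] div_less_num_blocks[OF k j] by (auto simp: tri_blocks_def nat_gap_def)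
  finally show ?thesis .
qed

lemma log_net_size_ge_1:
  assumes "0 < N" shows "1 \<le> log_net_size N k d"
proof -
  have "ln (exp 1) \<le> ln (3 * real N)"
    using exp_le assms by (subst ln_le_cancel_iff) (auto intro: order_trans[of _ 3] simp del: ln_exp)
  moreover have "0 \<le> ln net_base" by (intro ln_ge_zero) simp
  then have "0 \<le> 2 * real (min k d) * ln net_base" by (intro mult_nonneg_nonneg) simp_all
  ultimately show ?thesis unfolding log_net_size_def ln_exp by linarith
qed

text \<open>
  The scale \<open>l\<close> is of the order \<open>\<surd>(n L)\<close>, which balances the two exponents \<open>l\<^sup>2 / n\<close> and \<open>L\<close>. It has to
  stay in the range of \<open>sample_mean_mgf_le\<close>, which is linear in \<open>n\<close>; dividing by \<open>\<surd>B\<close> ensures this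
  when \<open>L \<le> B n\<close>. The constant is \<open>3328 = 13 * 16 * 16\<close>, from \<open>s\<^sup>2 + 4 / l\<^sup>2 \<le> 13 L\<^sup>2 / l\<^sup>2\<close>,
  \<open>l\<^sup>2 = n L / (16 b\<^sup>2 B)\<close> and \<open>b\<^sup>2 = 16 K\<^sup>4\<close>.
\<close>
lemma (in subgaussian_law) sampling_error:
  assumes k: "1 \<le> k" and n: "0 < n" and R: "0 \<le> R" and N: "0 < N" and B: "1 \<le> B"
    and LB: "log_net_size N k d \<le> B * real n"
  obtains F :: "(nat \<Rightarrow> nat \<Rightarrow> real) \<Rightarrow> real" where "F \<in> borel_measurable (Pi\<^sub>M {..<n} (\<lambda>_. P))" "\<And>X. 0 \<le> F X"
    "\<And>X p q. p < N \<Longrightarrow> q < N \<Longrightarrow> nat_gap p q \<le> 1 \<Longrightarrow>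
       op_norm_le (index_block d k p) (index_block d k q)
         (\<lambda>i j. 1 / real n * (\<Sum>m<n. clip_prod d k R (X m) i j) - (\<integral>x. clip_prod d k R x i j \<partial>P)) (2 * sqrt (F X))"
    "(\<integral>\<^sup>+X. ennreal (F X) \<partial>Pi\<^sub>M {..<n} (\<lambda>_. P)) \<le> ennreal (3328 * K ^ 4 * B * log_net_size N k d / real n)"
proof -
  let ?I = "index_block d k"
  let ?L = "log_net_size N k d"
  let ?M = "Pi\<^sub>M {..<n} (\<lambda>_. P)"
  let ?A = "\<lambda>X i j. 1 / real n * (\<Sum>m<n. clip_prod d k R (X m) i j) - (\<integral>x. clip_prod d k R x i j \<partial>P)"
  define b where "b = (2 * K)\<^sup>2"
  have b: "0 < b" using K_pos by (simp add: b_def)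
  have L: "1 \<le> ?L" using N by (rule log_net_size_ge_1)
  interpret PM: prob_space ?M by (intro prob_space_PiM prob_space_axioms)
  have Isub: "?I p \<subseteq> {..<d}" for p by (auto simp: index_block_def)
  define l where "l = 1 / (4 * b) * sqrt (real n * ?L / B)"
  have l0: "0 < l" using b n L B by (simp add: l_def)
  have l2: "l\<^sup>2 = real n * ?L / (16 * b\<^sup>2 * B)" using L B n by (simp add: l_def power_mult_distrib power_divide)
  have l_le: "2 * l \<le> real n / (2 * b)"
  proof -
    have "real n * ?L / B \<le> (real n)\<^sup>2" using LB B n by (simp add: field_simps power2_eq_square)
    then have "sqrt (real n * ?L / B) \<le> real n" by (intro real_le_lsqrt) auto
    then show ?thesis using b by (simp add: l_def field_simps)
  qed
  define w where "w = 32 * l\<^sup>2 * b\<^sup>2 / real n"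
  have w: "w \<le> 2 * ?L"
  proof -
    have "w = 2 * ?L / B" using n b B by (simp add: w_def l2)
    also have "\<dots> \<le> 2 * ?L / 1" using L B by (intro divide_left_mono) auto
    finally show ?thesis by simp
  qed
  define s where "s = 3 * ?L / l"
  have meas1: "(\<lambda>x. clip_prod d k R x i j) \<in> borel_measurable P" if "i < d" "j < d" for i j
    unfolding clip_prod_def using that Isub
    by (intro borel_measurable_times clip_measurable) (auto simp: index_block_def)
  have comp: "(\<lambda>X. f (X m)) \<in> borel_measurable ?M" if "f \<in> borel_measurable P" "m < n" for f :: "(nat \<Rightarrow> real) \<Rightarrow> real" and m
    using that by (intro measurable_compose[OF measurable_component_singleton]) auto
  have meas: "(\<lambda>X. ?A X i j) \<in> borel_measurable ?M" if "i < d" "j < d" for i j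
    using meas1[OF that] by (intro borel_measurable_diff borel_measurable_times borel_measurable_sum borel_measurable_const comp) auto
  have mgf: "(\<integral>\<^sup>+X. ennreal (exp (t * bilin (?I p) (?I q) (?A X) u v)) \<partial>?M) \<le> ennreal (exp w)"
    if u: "L2_set u (?I p) \<le> 1" and v: "L2_set v (?I q) \<le> 1" and t: "\<bar>t\<bar> = 2 * l" for p q u v t
  proof -
    define Y where "Y = (\<lambda>x. bilin (?I p) (?I q) (\<lambda>i j. clip R (?I p) x i * clip R (?I q) x j) u v)"
    have Y_eq: "bilin (?I p) (?I q) (\<lambda>i j. clip_prod d k R x i j) u v = Y x" for x
      unfolding Y_def by (intro bilin_cong refl) (auto simp: clip_prod_def index_block_def)
    have cm: "(\<lambda>x. clip R (?I p) x i) \<in> borel_measurable P" if "i \<in> ?I p" for i p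
      using that Isub by (intro clip_measurable)
    have Ym: "Y \<in> borel_measurable P" unfolding Y_def bilin_def
      by (intro borel_measurable_sum borel_measurable_times borel_measurable_const cm)
    have int: "integrable P (\<lambda>x. u i * clip_prod d k R x i j * v j)" if "i \<in> ?I p" "j \<in> ?I q" for i j
      using that Isub R unfolding clip_prod_def
      by (intro integrable_mult_left integrable_mult_right integrable_clip_product) (auto simp: index_block_def)
    have EY: "bilin (?I p) (?I q) (\<lambda>i j. \<integral>x. clip_prod d k R x i j \<partial>P) u v = integral\<^sup>L P Y"
    proof -
      have "integral\<^sup>L P Y = (\<integral>x. (\<Sum>i\<in>?I p. \<Sum>j\<in>?I q. u i * clip_prod d k R x i j * v j) \<partial>P)"
        by (simp only: Y_eq[symmetric] bilin_def cong: Bochner_Integration.integral_cong)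
      also have "\<dots> = (\<Sum>i\<in>?I p. \<integral>x. (\<Sum>j\<in>?I q. u i * clip_prod d k R x i j * v j) \<partial>P)"
        using int by (intro Bochner_Integration.integral_sum Bochner_Integration.integrable_sum)
      also have "\<dots> = (\<Sum>i\<in>?I p. \<Sum>j\<in>?I q. \<integral>x. u i * clip_prod d k R x i j * v j \<partial>P)"
        using int by (intro sum.cong[OF refl] Bochner_Integration.integral_sum)
      finally show ?thesis by (simp add: bilin_def)
    qed
    have "bilin (?I p) (?I q) (?A X) u v = 1 / real n * (\<Sum>m<n. Y (X m)) - integral\<^sup>L P Y" for X
    proof -
      have "bilin (?I p) (?I q) (\<lambda>i j. \<Sum>m<n. clip_prod d k R (X m) i j) u v = (\<Sum>m<n. Y (X m))"
      proof (induction n)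
        case (Suc n)
        then show ?case by (simp add: bilin_add Y_eq)
      qed (simp add: bilin_def)
      moreover have "bilin (?I p) (?I q) (?A X) u v
          = 1 / real n * bilin (?I p) (?I q) (\<lambda>i j. \<Sum>m<n. clip_prod d k R (X m) i j) u v
            - bilin (?I p) (?I q) (\<lambda>i j. \<integral>x. clip_prod d k R x i j \<partial>P) u v"
        unfolding bilin_scale[symmetric] unfolding bilin_def sum_subtractf[symmetric] by (simp only: algebra_simps)
      ultimately show ?thesis by (simp only: EY)
    qed
    then have "(\<integral>\<^sup>+X. ennreal (exp (t * bilin (?I p) (?I q) (?A X) u v)) \<partial>?M)
        = (\<integral>\<^sup>+X. ennreal (exp (t * (1 / real n * (\<Sum>m<n. Y (X m)) - integral\<^sup>L P Y))) \<partial>?M)" by simp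
    also have "\<dots> \<le> ennreal (exp (8 * t\<^sup>2 * b\<^sup>2 / real n))"
    proof (rule sample_mean_mgf_le[OF prob_space_axioms Ym b _ n])
      show "(\<integral>\<^sup>+x. ennreal (exp (\<bar>Y x\<bar> / b)) \<partial>P) \<le> 2"
        unfolding Y_def b_def by (rule bilin_clip_psi1[OF Isub u Isub v R])
      show "\<bar>t\<bar> \<le> real n / (2 * b)" using t l_le by simp
    qed
    also have "8 * t\<^sup>2 * b\<^sup>2 / real n = w"
    proof -
      have "t\<^sup>2 = (2 * l)\<^sup>2" using t by (metis power2_abs)
      then show ?thesis by (simp add: w_def power_mult_distrib)
    qed
    finally show ?thesis .
  qed
  have bound: "s\<^sup>2 + 4 / l\<^sup>2 * exp (?L + w - l * s) \<le> 3328 * K ^ 4 * B * ?L / real n"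
  proof -
    have "?L + w - l * s \<le> 0" using w l0 by (simp add: s_def)
    then have "4 / l\<^sup>2 * exp (?L + w - l * s) \<le> 4 / l\<^sup>2 * 1" by (intro mult_left_mono) auto
    then have "s\<^sup>2 + 4 / l\<^sup>2 * exp (?L + w - l * s) \<le> (9 * ?L\<^sup>2 + 4) / l\<^sup>2"
      by (simp add: s_def power_divide power_mult_distrib add_divide_distrib)
    also have "\<dots> \<le> 13 * ?L\<^sup>2 / l\<^sup>2"
      using one_le_power[OF L, of 2] by (intro divide_right_mono) auto
    also have "\<dots> = 3328 * K ^ 4 * B * ?L / real n"
      using L n B K_pos unfolding l2 b_def by (simp add: field_simps power2_eq_square power4_eq_xxxx)
    finally show ?thesis .
  qed
  show thesis
  proof (rule band_maximal_second_moment[OF PM.prob_space_axioms k N l0, of d ?A w s])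
    fix F assume F: "F \<in> borel_measurable ?M" "\<And>X. 0 \<le> F X"
      "\<And>X p q. p < N \<Longrightarrow> q < N \<Longrightarrow> nat_gap p q \<le> 1 \<Longrightarrow> op_norm_le (?I p) (?I q) (?A X) (2 * sqrt (F X))"
      "(\<integral>\<^sup>+X. ennreal (F X) \<partial>?M) \<le> ennreal (s\<^sup>2 + 4 / l\<^sup>2 * exp (log_net_size N k d + w - l * s))"
    show thesis by (rule that[OF F(1-3) order_trans[OF F(4) ennreal_leI[OF bound]]])
  qed (use meas mgf in blast)+
qed

section \<open>The Gaussian noise\<close>

text \<open>
  As long as the positions in \<open>D\<close> use different Gaussian variables, the form is Gaussian with variance
  at most \<open>\<Sum> u\<^sub>i\<^sup>2 v\<^sub>j\<^sup>2 \<le> 1\<close>.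
\<close>
lemma gaussian_bilinear_mgf_le:
  assumes E: "finite E" and I: "finite I" "L2_set u I \<le> 1" and J: "finite J" "L2_set v J \<le> 1"
    and D: "D \<subseteq> I \<times> J" and f: "inj_on f D" "f ` D \<subseteq> E"
  shows "(\<integral>\<^sup>+W. ennreal (exp (t * (\<Sum>(i, j)\<in>D. u i * W (f (i, j)) * v j))) \<partial>Pi\<^sub>M E (\<lambda>_. std_normal_distribution))
     \<le> ennreal (exp (t\<^sup>2 / 2))"
proof -
  have finD: "finite D" using D I J by (meson finite_SigmaI finite_subset)
  define g where "g = (\<lambda>(i, j). u i * v j)"
  define c where "c = (\<lambda>e. if e \<in> f ` D then t * g (inv_into D f e) else 0)"
  have c_f: "c (f x) = t * g x" if "x \<in> D" for x
    using that f(1) by (simp add: c_def)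
  have lin: "t * (\<Sum>(i, j)\<in>D. u i * W (f (i, j)) * v j) = (\<Sum>e\<in>E. c e * W e)" for W
  proof -
    have "(\<Sum>e\<in>E. c e * W e) = (\<Sum>e\<in>f ` D. c e * W e)"
      using E f(2) by (intro sum.mono_neutral_right) (auto simp: c_def)
    also have "\<dots> = (\<Sum>x\<in>D. c (f x) * W (f x))" by (simp add: sum.reindex[OF f(1)])
    also have "\<dots> = (\<Sum>x\<in>D. t * (g x * W (f x)))" by (intro sum.cong refl) (simp add: c_f)
    also have "\<dots> = t * (\<Sum>(i, j)\<in>D. u i * W (f (i, j)) * v j)"
      unfolding sum_distrib_left by (intro sum.cong refl) (auto simp: g_def)
    finally show ?thesis ..
  qed
  have "(\<Sum>e\<in>E. (c e)\<^sup>2) = (\<Sum>e\<in>f ` D. (c e)\<^sup>2)"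
    using E f(2) by (intro sum.mono_neutral_right) (auto simp: c_def)
  also have "\<dots> = (\<Sum>x\<in>D. (c (f x))\<^sup>2)" by (simp add: sum.reindex[OF f(1)])
  also have "\<dots> = t\<^sup>2 * (\<Sum>x\<in>D. (g x)\<^sup>2)"
    unfolding sum_distrib_left by (intro sum.cong refl) (simp add: c_f power_mult_distrib)
  also have "\<dots> \<le> t\<^sup>2 * (\<Sum>x\<in>I \<times> J. (g x)\<^sup>2)"
    using D I J by (intro mult_left_mono sum_mono2) auto
  also have "(\<Sum>x\<in>I \<times> J. (g x)\<^sup>2) = (L2_set u I)\<^sup>2 * (L2_set v J)\<^sup>2"
    unfolding L2_set_square sum_product sum.cartesian_product
    by (intro sum.cong refl) (auto simp: g_def power_mult_distrib)
  also have "t\<^sup>2 * \<dots> \<le> t\<^sup>2 * (1 * 1)"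
    using I J by (intro mult_left_mono mult_mono) (auto simp: power_le_one)
  finally have "(\<Sum>e\<in>E. (c e)\<^sup>2) / 2 \<le> t\<^sup>2 / 2" by simp
  then show ?thesis unfolding lin gaussian_linear_form_mgf[OF E] by (intro ennreal_leI) simp
qed

text \<open>
  In a diagonal block each off-diagonal variable occurs twice, so the form is split into its upper
  and its strictly lower triangular part. Each part uses every variable at most once, and the
  exponential of the sum is at most the mean of the exponentials of the doubled parts. Here
  \<open>l = \<surd>L\<close> and \<open>s = 9 \<surd>L\<close> cancel the exponent \<open>L + 8 L\<close> exactly, which leaves \<open>81 L + 4 / L \<le> 85 L\<close>.
\<close>
lemma noise_error:
  assumes k: "1 \<le> k" and d: "1 \<le> d"
  defines "N \<equiv> num_blocks d k"
  defines "E \<equiv> tri_blocks d k \<times> {(i, j). i \<le> j \<and> j < N * k}"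
  obtains F where "F \<in> borel_measurable (Pi\<^sub>M E (\<lambda>_. std_normal_distribution))" "\<And>W. 0 \<le> F W"
    "\<And>W p q. p < N \<Longrightarrow> q < N \<Longrightarrow> nat_gap p q \<le> 1 \<Longrightarrow>
       op_norm_le (index_block d k p) (index_block d k q) (noise_mat k W) (2 * sqrt (F W))"
    "(\<integral>\<^sup>+W. ennreal (F W) \<partial>Pi\<^sub>M E (\<lambda>_. std_normal_distribution)) \<le> ennreal (85 * log_net_size N k d)"
proof -
  let ?I = "index_block d k"
  let ?L = "log_net_size N k d"
  let ?M = "Pi\<^sub>M E (\<lambda>_. std_normal_distribution)"
  have N: "0 < N" by (simp add: N_def num_blocks_pos)
  have L: "1 \<le> ?L" using N by (rule log_net_size_ge_1)
  have finE: "finite E" unfolding E_def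
  proof (intro finite_cartesian_product finite_tri_blocks)
    show "finite {(i, j). i \<le> j \<and> j < N * k}"
      by (rule finite_subset[of _ "{..<N * k} \<times> {..<N * k}"]) auto
  qed
  have prob: "prob_space ?M"
    by (intro prob_space_PiM prob_space_normal_density) simp
  have memE: "((min p q, nat_gap p q), (i, j)) \<in> E" if "p < N" "q < N" "nat_gap p q \<le> 1" "i \<le> j" "j < d" for p q i j
    using that le_num_blocks[OF k, of d] unfolding E_def tri_blocks_def
    by (auto simp: N_def nat_gap_def)
  have comp: "(\<lambda>W. W e) \<in> borel_measurable ?M" if "e \<in> E" for e
  proof -
    have "(\<lambda>W. W e) \<in> ?M \<rightarrow>\<^sub>M std_normal_distribution" using that by (rule measurable_component_singleton)
    then show ?thesis by (simp cong: measurable_cong_sets)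
  qed
  have meas: "(\<lambda>W. noise_mat k W i j) \<in> borel_measurable ?M"
    if "i < d" "j < d" "nat_gap (i div k) (j div k) \<le> 1" "i div k < N" "j div k < N" for i j
    unfolding noise_mat_def using that by (intro comp memE) auto
  define l where "l = sqrt ?L"
  have l0: "0 < l" using L by (simp add: l_def)
  have l2: "l\<^sup>2 = ?L" using L by (simp add: l_def)
  have mgf: "(\<integral>\<^sup>+W. ennreal (exp (t * bilin (?I p) (?I q) (noise_mat k W) u v)) \<partial>?M) \<le> ennreal (exp (8 * ?L))"
    if pq: "p < N" "q < N" "nat_gap p q \<le> 1" and u: "L2_set u (?I p) \<le> 1" and v: "L2_set v (?I q) \<le> 1"
      and t: "\<bar>t\<bar> = 2 * l" for p q u v t
  proof -
    let ?D = "{(i, j). (i, j) \<in> ?I p \<times> ?I q \<and> i \<le> j}" and ?D' = "{(i, j). (i, j) \<in> ?I p \<times> ?I q \<and> j < i}"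
    let ?f = "\<lambda>(i, j). ((min p q, nat_gap p q), (i, j))" and ?f' = "\<lambda>(i, j). ((min p q, nat_gap p q), (j, i))"
    let ?U = "\<lambda>W. \<Sum>(i, j)\<in>?D. u i * W (?f (i, j)) * v j"
    let ?U' = "\<lambda>W. \<Sum>(i, j)\<in>?D'. u i * W (?f' (i, j)) * v j"
    have finD: "finite ?D" "finite ?D'"
      by (rule finite_subset[of _ "?I p \<times> ?I q"]; auto)+
    have split: "bilin (?I p) (?I q) (noise_mat k W) u v = ?U W + ?U' W" for W
    proof -
      have "bilin (?I p) (?I q) (noise_mat k W) u v = (\<Sum>(i, j)\<in>?I p \<times> ?I q. u i * noise_mat k W i j * v j)"
        unfolding bilin_def by (simp add: sum.cartesian_product)
      also have "?I p \<times> ?I q = ?D \<union> ?D'" by auto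
      also have "(\<Sum>(i, j)\<in>?D \<union> ?D'. u i * noise_mat k W i j * v j)
          = (\<Sum>(i, j)\<in>?D. u i * noise_mat k W i j * v j) + (\<Sum>(i, j)\<in>?D'. u i * noise_mat k W i j * v j)"
        using finD by (intro sum.union_disjoint) auto
      also have "(\<Sum>(i, j)\<in>?D. u i * noise_mat k W i j * v j) = ?U W"
        by (intro sum.cong refl) (auto simp: noise_mat_def index_block_def min_absorb1 max_absorb2)
      also have "(\<Sum>(i, j)\<in>?D'. u i * noise_mat k W i j * v j) = ?U' W"
        by (intro sum.cong refl) (auto simp: noise_mat_def index_block_def min_absorb2 max_absorb1)
      finally show ?thesis .
    qed
    have f: "inj_on ?f ?D" "?f ` ?D \<subseteq> E" and f': "inj_on ?f' ?D'" "?f' ` ?D' \<subseteq> E"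
      using memE[OF pq] by (auto simp: inj_on_def index_block_def)
    have half: "(\<integral>\<^sup>+W. ennreal (exp (2 * t * ?U W)) \<partial>?M) \<le> ennreal (exp (8 * ?L))"
      and half': "(\<integral>\<^sup>+W. ennreal (exp (2 * t * ?U' W)) \<partial>?M) \<le> ennreal (exp (8 * ?L))"
    proof -
      have t2: "(2 * t)\<^sup>2 / 2 = 8 * ?L"
      proof -
        have "t\<^sup>2 = (2 * l)\<^sup>2" using t by (metis power2_abs)
        then show ?thesis by (simp add: power_mult_distrib l2)
      qed
      show "(\<integral>\<^sup>+W. ennreal (exp (2 * t * ?U W)) \<partial>?M) \<le> ennreal (exp (8 * ?L))"
        using gaussian_bilinear_mgf_le[OF finE _ u _ v _ f, of "2 * t"] unfolding t2 by auto
      show "(\<integral>\<^sup>+W. ennreal (exp (2 * t * ?U' W)) \<partial>?M) \<le> ennreal (exp (8 * ?L))"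
        using gaussian_bilinear_mgf_le[OF finE _ u _ v _ f', of "2 * t"] unfolding t2 by auto
    qed
    have mU: "?U \<in> borel_measurable ?M"
      using f(2) by (intro borel_measurable_sum) (auto intro!: borel_measurable_times borel_measurable_const comp)
    have mU': "?U' \<in> borel_measurable ?M"
      using f'(2) by (intro borel_measurable_sum) (auto intro!: borel_measurable_times borel_measurable_const comp)
    note [measurable] = mU mU'
    have conv: "ennreal (1 / 2 * (a + b)) = ennreal (1 / 2) * (ennreal a + ennreal b)" if "0 \<le> a" "0 \<le> b" for a b
      using that by (subst ennreal_mult) auto
    have "(\<integral>\<^sup>+W. ennreal (exp (t * bilin (?I p) (?I q) (noise_mat k W) u v)) \<partial>?M)
        \<le> (\<integral>\<^sup>+W. ennreal (1 / 2) * (ennreal (exp (2 * t * ?U W)) + ennreal (exp (2 * t * ?U' W))) \<partial>?M)"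
    proof (intro nn_integral_mono)
      fix W
      have amgm: "exp (t * (x + y)) \<le> 1 / 2 * (exp (2 * t * x) + exp (2 * t * y))" for x y :: real
      proof -
        have "2 * exp (t * x) * exp (t * y) \<le> (exp (t * x))\<^sup>2 + (exp (t * y))\<^sup>2" by (rule sum_squares_bound)
        then show ?thesis by (simp add: exp_double[symmetric] distrib_left exp_add mult.assoc)
      qed
      show "ennreal (exp (t * bilin (?I p) (?I q) (noise_mat k W) u v))
          \<le> ennreal (1 / 2) * (ennreal (exp (2 * t * ?U W)) + ennreal (exp (2 * t * ?U' W)))"
        unfolding split conv[OF exp_ge_zero exp_ge_zero, symmetric] by (rule ennreal_leI[OF amgm])
    qed
    also have "\<dots> = ennreal (1 / 2) * ((\<integral>\<^sup>+W. ennreal (exp (2 * t * ?U W)) \<partial>?M) + (\<integral>\<^sup>+W. ennreal (exp (2 * t * ?U' W)) \<partial>?M))"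
    proof -
      have "(\<lambda>W. ennreal (exp (2 * t * ?U W))) \<in> borel_measurable ?M" "(\<lambda>W. ennreal (exp (2 * t * ?U' W))) \<in> borel_measurable ?M"
        by measurable
      then show ?thesis by (subst nn_integral_cmult; (simp only: nn_integral_add borel_measurable_add)?)
    qed
    also have "\<dots> \<le> ennreal (1 / 2) * (ennreal (exp (8 * ?L)) + ennreal (exp (8 * ?L)))"
      by (intro mult_left_mono add_mono half half') auto
    also have "\<dots> = ennreal (exp (8 * ?L))"
      unfolding conv[OF exp_ge_zero exp_ge_zero, symmetric] by simp
    finally show ?thesis .
  qed
  have bound: "(9 * l)\<^sup>2 + 4 / l\<^sup>2 * exp (?L + 8 * ?L - l * (9 * l)) \<le> 85 * ?L"
  proof -
    have "?L + 8 * ?L - l * (9 * l) = 0" using l2 by (simp add: power2_eq_square)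
    moreover have "4 / ?L \<le> 4 * ?L" using L mult_mono[of 1 ?L 1 ?L] by (simp add: field_simps)
    ultimately show ?thesis by (simp add: power_mult_distrib l2)
  qed
  show thesis
  proof (rule band_maximal_second_moment[OF prob k N l0, of d "\<lambda>W. noise_mat k W" "8 * ?L" "9 * l"])
    fix F assume F: "F \<in> borel_measurable ?M" "\<And>W. 0 \<le> F W"
      "\<And>W p q. p < N \<Longrightarrow> q < N \<Longrightarrow> nat_gap p q \<le> 1 \<Longrightarrow> op_norm_le (?I p) (?I q) (noise_mat k W) (2 * sqrt (F W))"
      "(\<integral>\<^sup>+W. ennreal (F W) \<partial>?M) \<le> ennreal ((9 * l)\<^sup>2 + 4 / l\<^sup>2 * exp (?L + 8 * ?L - l * (9 * l)))"
    show thesis by (rule that[OF F(1-3) order_trans[OF F(4) ennreal_leI[OF bound]]])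
  qed (use meas mgf in blast)+
qed

section \<open>The risk bound\<close>

lemma square_sum4_le: "(x + y + z + w)\<^sup>2 \<le> 4 * (x\<^sup>2 + y\<^sup>2 + z\<^sup>2 + w\<^sup>2)" for x y z w :: real
proof -
  have "0 \<le> (x - y)\<^sup>2 + (x - z)\<^sup>2 + (x - w)\<^sup>2 + (y - z)\<^sup>2 + (y - w)\<^sup>2 + (z - w)\<^sup>2" by simp
  then show ?thesis by (simp add: power2_eq_square algebra_simps)
qed

text \<open>
  The deterministic core: the sampling error, the noise and the bias add up to the error on the band,
  and the error outside the band is the omitted part of the covariance.
\<close>
lemma estimation_error_op_norm_le:
  assumes cov: "cov_mat P \<in> cov_class d \<alpha> M0 M" and M: "0 \<le> M" and \<alpha>: "0 < \<alpha>" and k: "1 \<le> k"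
    and bias: "\<And>p q. op_norm_le (index_block d k p) (index_block d k q)
        (\<lambda>i j. (\<integral>x. clip_prod d k R x i j \<partial>P) - cov_mat P i j) b"
    and samp: "\<And>p q. p < num_blocks d k \<Longrightarrow> q < num_blocks d k \<Longrightarrow> nat_gap p q \<le> 1 \<Longrightarrow>
       op_norm_le (index_block d k p) (index_block d k q)
         (\<lambda>i j. 1 / real n * (\<Sum>m<n. clip_prod d k R (X m) i j) - (\<integral>x. clip_prod d k R x i j \<partial>P)) f"
    and noise: "\<And>p q. p < num_blocks d k \<Longrightarrow> q < num_blocks d k \<Longrightarrow> nat_gap p q \<le> 1 \<Longrightarrow>
       op_norm_le (index_block d k p) (index_block d k q) (noise_mat k W) g"
    and nonneg: "0 \<le> b" "0 \<le> f" "0 \<le> g" "0 \<le> \<sigma>"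
    and \<sigma>: "\<sigma> = sqrt (18 * R ^ 4 / (\<rho> / (2 * real (num_blocks d k)) * (real n)\<^sup>2))"
  shows "op_norm_le {..<d} {..<d} (\<lambda>i j. dp_cov_tri n d X k \<rho> R (\<lambda>b e. W (b, e)) i j - cov_mat P i j)
     (3 * f + 3 * (\<sigma> * g) + 3 * b + 7 * M / (1 - 2 powr (- \<alpha>)) * real k powr (- \<alpha>))"
proof -
  let ?I = "index_block d k"
  let ?samp = "\<lambda>i j. 1 / real n * (\<Sum>m<n. clip_prod d k R (X m) i j) - (\<integral>x. clip_prod d k R x i j \<partial>P)"
  let ?bias = "\<lambda>i j. (\<integral>x. clip_prod d k R x i j \<partial>P) - cov_mat P i j"
  let ?sum = "\<lambda>i j. (?samp i j + \<sigma> * noise_mat k W i j) + ?bias i j"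
  let ?band = "\<lambda>i j. if nat_gap (i div k) (j div k) \<le> 1 then ?sum i j else 0"
  have "op_norm_le {..<d} {..<d} ?band ((2 * real 1 + 1) * (f + \<bar>\<sigma>\<bar> * g + b))"
  proof (rule op_norm_le_block_band[where b = k])
    fix p q :: nat assume pq: "nat_gap p q \<le> 1"
    show "op_norm_le (?I p) (?I q) ?band (f + \<bar>\<sigma>\<bar> * g + b)"
    proof (cases "p < num_blocks d k \<and> q < num_blocks d k")
      case True
      have "op_norm_le (?I p) (?I q) ?sum (f + \<bar>\<sigma>\<bar> * g + b)"
        using True pq by (intro op_norm_le_add op_norm_le_scale samp noise bias) auto
      then show ?thesis using pq
        by (subst op_norm_le_cong[where B = ?sum]) (auto simp: index_block_def)
    next
      case False
      then have "?I p = {} \<or> ?I q = {}" using div_less_num_blocks[OF k] by (auto simp: index_block_def)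
      then have "bilin (?I p) (?I q) ?band u v = 0" for u v by (auto simp: bilin_def)
      then show ?thesis unfolding op_norm_le_def using nonneg
        by (auto intro!: mult_nonneg_nonneg add_nonneg_nonneg)
    qed
  qed (use nonneg in auto)
  then have "op_norm_le {..<d} {..<d} (\<lambda>i j. ?band i j + (-1) * off_band k (cov_mat P) i j)
     ((2 * real 1 + 1) * (f + \<bar>\<sigma>\<bar> * g + b) + \<bar>-1\<bar> * (7 * M / (1 - 2 powr (- \<alpha>)) * real k powr (- \<alpha>)))"
    by (intro op_norm_le_add op_norm_le_scale off_band_op_norm_le[OF cov M \<alpha> k])
  moreover have "(2 * real 1 + 1) * (f + \<bar>\<sigma>\<bar> * g + b) + \<bar>-1\<bar> * (7 * M / (1 - 2 powr (- \<alpha>)) * real k powr (- \<alpha>))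
     = 3 * f + 3 * (\<sigma> * g) + 3 * b + 7 * M / (1 - 2 powr (- \<alpha>)) * real k powr (- \<alpha>)"
    using nonneg(4) by (simp add: algebra_simps)
  moreover have "dp_cov_tri n d X k \<rho> R (\<lambda>b e. W (b, e)) i j - cov_mat P i j
     = ?band i j + (-1) * off_band k (cov_mat P) i j" if "i < d" "j < d" for i j
    unfolding dp_cov_tri_entry[OF k that] \<sigma>[symmetric] off_band_def by simp
  ultimately show ?thesis
    by (subst op_norm_le_cong[where B = "\<lambda>i j. ?band i j + (-1) * off_band k (cov_mat P) i j"]) auto
qed

context subgaussian_law
begin

lemma clip_prod_bias:
  assumes k: "1 \<le> k" and C: "20 \<le> C"
  shows "op_norm_le (index_block d k p) (index_block d k q)
     (\<lambda>i j. (\<integral>x. clip_prod d k (C * K * sqrt (real k)) x i j \<partial>P) - cov_mat P i j)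
     ((32 * K ^ 4 + 1) * exp (- real k))"
proof -
  have I: "index_block d k p \<subseteq> {..<d}" "card (index_block d k p) \<le> k" for p
    using card_index_block_le[OF k, of d p] by (auto simp: index_block_def)
  show ?thesis
    using clip_bias_op_norm_le[OF I I k C, of p q]
    by (subst op_norm_le_cong) (auto simp: clip_prod_def index_block_def)
qed

text \<open>
  The weight \<open>144 = 4 * 6\<^sup>2\<close> comes from squaring a sum of four terms, a factor 3 for the band and a
  factor 2 for the nets.
\<close>
lemma risk_le:
  assumes cov: "cov_mat P \<in> cov_class d \<alpha> M0 M" and M: "0 \<le> M" and \<alpha>: "0 < \<alpha>" and k: "1 \<le> k"
    and d: "1 \<le> d" and n: "0 < n" and \<rho>: "0 < \<rho>" and C: "20 \<le> C" and B: "1 \<le> B"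
    and LB: "log_net_size (num_blocks d k) k d \<le> B * real n"
  defines "L \<equiv> log_net_size (num_blocks d k) k d" and "R \<equiv> C * K * sqrt (real k)"
  shows "dp_tri_risk n d k \<rho> R P \<le> ennreal (144 * (3328 * K ^ 4 * B * L / real n)
     + 144 * (18 * R ^ 4 / (\<rho> / (2 * real (num_blocks d k)) * (real n)\<^sup>2)) * (85 * L)
     + 4 * (9 * ((32 * K ^ 4 + 1) * exp (- real k))\<^sup>2 + (7 * M / (1 - 2 powr (- \<alpha>)) * real k powr (- \<alpha>))\<^sup>2))"
proof -
  define N where "N = num_blocks d k"
  define \<sigma>2 where "\<sigma>2 = 18 * R ^ 4 / (\<rho> / (2 * real N) * (real n)\<^sup>2)"
  define b where "b = (32 * K ^ 4 + 1) * exp (- real k)"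
  define \<tau> where "\<tau> = 7 * M / (1 - 2 powr (- \<alpha>)) * real k powr (- \<alpha>)"
  define E where "E = tri_blocks d k \<times> {(i, j). i \<le> j \<and> j < num_blocks d k * k}"
  define M1 where "M1 = Pi\<^sub>M {..<n} (\<lambda>_. P)"
  define M2 where "M2 = Pi\<^sub>M E (\<lambda>_. std_normal_distribution)"
  have N: "0 < N" by (simp add: N_def num_blocks_pos)
  have R: "0 \<le> R" using C K_pos by (simp add: R_def)
  have b: "0 \<le> b" using K_pos by (simp add: b_def)
  have \<sigma>2: "0 \<le> \<sigma>2" using \<rho> R by (simp add: \<sigma>2_def)
  have \<tau>: "0 \<le> \<tau>"
  proof -
    have "2 powr (- \<alpha>) \<le> (1::real)" using \<alpha> by (simp add: powr_le_one_le powr_less_one less_imp_le)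
    then show ?thesis using M by (simp add: \<tau>_def)
  qed
  interpret M1: prob_space M1 unfolding M1_def by (intro prob_space_PiM prob_space_axioms)
  interpret M2: prob_space M2 unfolding M2_def by (intro prob_space_PiM prob_space_normal_density) simp
  obtain F where F: "F \<in> borel_measurable M1" "\<And>X. 0 \<le> F X"
    "\<And>X p q. p < N \<Longrightarrow> q < N \<Longrightarrow> nat_gap p q \<le> 1 \<Longrightarrow>
       op_norm_le (index_block d k p) (index_block d k q)
         (\<lambda>i j. 1 / real n * (\<Sum>m<n. clip_prod d k R (X m) i j) - (\<integral>x. clip_prod d k R x i j \<partial>P)) (2 * sqrt (F X))"
    "(\<integral>\<^sup>+X. ennreal (F X) \<partial>M1) \<le> ennreal (3328 * K ^ 4 * B * L / real n)"
    using sampling_error[OF k n R N B] LB unfolding M1_def L_def N_def by blast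
  obtain G where G: "G \<in> borel_measurable M2" "\<And>W. 0 \<le> G W"
    "\<And>W p q. p < N \<Longrightarrow> q < N \<Longrightarrow> nat_gap p q \<le> 1 \<Longrightarrow>
       op_norm_le (index_block d k p) (index_block d k q) (noise_mat k W) (2 * sqrt (G W))"
    "(\<integral>\<^sup>+W. ennreal (G W) \<partial>M2) \<le> ennreal (85 * L)"
    using noise_error[OF k d] unfolding M2_def L_def N_def E_def by blast
  note [measurable] = F(1) G(1)
  have pt: "(spec_norm d (\<lambda>i j. dp_cov_tri n d X k \<rho> R (\<lambda>b e. W (b, e)) i j - cov_mat P i j))\<^sup>2
      \<le> 144 * F X + 144 * \<sigma>2 * G W + 4 * (9 * b\<^sup>2 + \<tau>\<^sup>2)" for X W
  proof -
    let ?D = "\<lambda>i j. dp_cov_tri n d X k \<rho> R (\<lambda>b e. W (b, e)) i j - cov_mat P i j"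
    let ?t = "3 * (2 * sqrt (F X)) + 3 * (sqrt \<sigma>2 * (2 * sqrt (G W))) + 3 * b + \<tau>"
    have D: "op_norm_le {..<d} {..<d} ?D ?t"
      unfolding \<tau>_def
      using F(2,3) G(2,3) b \<sigma>2 clip_prod_bias[OF k C]
      by (intro estimation_error_op_norm_le[OF cov M \<alpha> k])
        (simp_all add: N_def \<sigma>2_def R_def b_def)
    have t0: "0 \<le> ?t" using F(2) G(2) b \<sigma>2 \<tau> by (intro add_nonneg_nonneg mult_nonneg_nonneg) auto
    have "(spec_norm d ?D)\<^sup>2 \<le> ?t\<^sup>2" using spec_norm_le[OF D t0] by (intro power_mono)
    also have "\<dots> \<le> 4 * ((3 * (2 * sqrt (F X)))\<^sup>2 + (3 * (sqrt \<sigma>2 * (2 * sqrt (G W))))\<^sup>2 + (3 * b)\<^sup>2 + \<tau>\<^sup>2)"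
      by (rule square_sum4_le)
    also have "\<dots> = 144 * F X + 144 * \<sigma>2 * G W + 4 * (9 * b\<^sup>2 + \<tau>\<^sup>2)"
      using F(2) G(2) \<sigma>2 by (simp add: power_mult_distrib)
    finally show ?thesis .
  qed
  have "dp_tri_risk n d k \<rho> R P = (\<integral>\<^sup>+(X, W). ennreal ((spec_norm d (\<lambda>i j.
          dp_cov_tri n d X k \<rho> R (\<lambda>b e. W (b, e)) i j - cov_mat P i j))\<^sup>2) \<partial>(M1 \<Otimes>\<^sub>M M2))"
    by (simp add: dp_tri_risk_def joint_law_def M1_def M2_def E_def)
  also have "\<dots> \<le> (\<integral>\<^sup>+(X, W). ennreal 144 * ennreal (F X) + ennreal (144 * \<sigma>2) * ennreal (G W)
      + ennreal (4 * (9 * b\<^sup>2 + \<tau>\<^sup>2)) \<partial>(M1 \<Otimes>\<^sub>M M2))"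
  proof (intro nn_integral_mono, clarify)
    fix X W
    have "ennreal 144 * ennreal (F X) + ennreal (144 * \<sigma>2) * ennreal (G W) + ennreal (4 * (9 * b\<^sup>2 + \<tau>\<^sup>2))
       = ennreal (144 * F X + 144 * \<sigma>2 * G W + 4 * (9 * b\<^sup>2 + \<tau>\<^sup>2))"
      using F(2) G(2) \<sigma>2 by (simp only: ennreal_mult[symmetric] ennreal_plus[symmetric] mult_nonneg_nonneg add_nonneg_nonneg zero_le_numeral zero_le_power2)
    then show "ennreal ((spec_norm d (\<lambda>i j. dp_cov_tri n d X k \<rho> R (\<lambda>b e. W (b, e)) i j - cov_mat P i j))\<^sup>2)
      \<le> ennreal 144 * ennreal (F X) + ennreal (144 * \<sigma>2) * ennreal (G W) + ennreal (4 * (9 * b\<^sup>2 + \<tau>\<^sup>2))"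
      using ennreal_leI[OF pt] by simp
  qed
  also have "\<dots> = (\<integral>\<^sup>+X. \<integral>\<^sup>+W. ennreal 144 * ennreal (F X) + ennreal (144 * \<sigma>2) * ennreal (G W)
      + ennreal (4 * (9 * b\<^sup>2 + \<tau>\<^sup>2)) \<partial>M2 \<partial>M1)"
    by (subst M2.nn_integral_fst[symmetric]) simp_all
  also have "\<dots> = ennreal 144 * (\<integral>\<^sup>+X. ennreal (F X) \<partial>M1) + ennreal (144 * \<sigma>2) * (\<integral>\<^sup>+W. ennreal (G W) \<partial>M2)
      + ennreal (4 * (9 * b\<^sup>2 + \<tau>\<^sup>2))"
    by (simp add: nn_integral_add nn_integral_cmult M1.emeasure_space_1 M2.emeasure_space_1)
  also have "\<dots> \<le> ennreal 144 * ennreal (3328 * K ^ 4 * B * L / real n) + ennreal (144 * \<sigma>2) * ennreal (85 * L)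
      + ennreal (4 * (9 * b\<^sup>2 + \<tau>\<^sup>2))"
    using F(4) G(4) by (intro add_mono mult_left_mono) auto
  also have "\<dots> = ennreal (144 * (3328 * K ^ 4 * B * L / real n) + 144 * \<sigma>2 * (85 * L) + 4 * (9 * b\<^sup>2 + \<tau>\<^sup>2))"
  proof -
    have L: "0 \<le> L" using log_net_size_ge_1[OF N, of k d] by (simp add: L_def N_def)
    then have "0 \<le> 3328 * K ^ 4 * B * L / real n" using K_pos B by simp
    with L \<sigma>2 show ?thesis
      by (simp only: ennreal_mult[symmetric] ennreal_plus[symmetric] mult_nonneg_nonneg add_nonneg_nonneg zero_le_numeral zero_le_power2)
  qed
  finally show ?thesis unfolding \<sigma>2_def b_def \<tau>_def N_def .
qed

end

text \<open>
  Maximising \<open>x\<^sup>\<alpha> e\<^sup>-\<^sup>x\<close>: this is where an exponentially small bias becomes a rate \<open>k\<^sup>-\<^sup>\<alpha>\<close>.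
\<close>
lemma exp_minus_le_powr:
  assumes "0 < \<alpha>" "1 \<le> k"
  shows "exp (- real k) \<le> \<alpha> powr \<alpha> * real k powr (- \<alpha>)"
proof -
  have "ln (real k / \<alpha>) \<le> real k / \<alpha> - 1" using assms by (intro ln_le_minus_one) auto
  then have "\<alpha> * ln (real k / \<alpha>) \<le> \<alpha> * (real k / \<alpha> - 1)" using assms by (intro mult_left_mono) auto
  then have "\<alpha> * ln (real k) - \<alpha> * ln \<alpha> \<le> real k - \<alpha>"
    using assms by (simp add: ln_div algebra_simps)
  then have "- real k \<le> \<alpha> * ln \<alpha> + (- \<alpha>) * ln (real k)" using assms by linarith
  then have "exp (- real k) \<le> exp (\<alpha> * ln \<alpha> + (- \<alpha>) * ln (real k))" by simp
  also have "\<dots> = \<alpha> powr \<alpha> * real k powr (- \<alpha>)" using assms by (simp add: powr_def mult_exp_exp)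
  finally show ?thesis .
qed

text \<open>
  The value comes from \<open>ln (3 N) \<le> ln 6 + ln d \<le> 5 k + ln d\<close>.
\<close>
definition net_const :: real where "net_const = 5 + 2 * ln net_base"

lemma net_const_ge: "5 \<le> net_const"
proof -
  have "0 \<le> ln net_base" by (intro ln_ge_zero) simp
  then show ?thesis unfolding net_const_def by linarith
qed

lemma log_net_size_le:
  assumes k: "1 \<le> k" and d: "1 \<le> d"
  shows "log_net_size (num_blocks d k) k d \<le> net_const * (real k + ln (real d))"
proof -
  let ?N = "num_blocks d k" and ?a = "ln net_base"
  have a: "0 \<le> ?a" by (intro ln_ge_zero) simp
  have "?N * 1 \<le> ?N * k" using k by (rule mult_le_mono2)
  then have "?N \<le> 2 * d" using num_blocks_bound[of d k] d by linarith
  then have "3 * real ?N \<le> 6 * real d" using of_nat_mono[of ?N "2 * d", where 'a = real] by simp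
  then have "ln (3 * real ?N) \<le> ln (6 * real d)" using num_blocks_pos[of d k] by (intro ln_mono) auto
  also have "\<dots> = ln 6 + ln (real d)" using d by (simp add: ln_mult)
  also have "ln 6 \<le> (5::real)" using ln_le_minus_one[of 6] by simp
  finally have 1: "ln (3 * real ?N) \<le> 5 * real k + ln (real d)" using k by simp
  have "2 * real (min k d) * ?a \<le> 2 * real k * ?a" using a by (intro mult_right_mono) auto
  then have "log_net_size ?N k d \<le> 5 * real k + ln (real d) + 2 * real k * ?a"
    unfolding log_net_size_def using 1 by linarith
  also have "\<dots> \<le> net_const * real k + net_const * ln (real d)"
  proof -
    have "1 * ln (real d) \<le> net_const * ln (real d)"
      using net_const_ge d by (intro mult_right_mono) auto
    moreover have "net_const * real k = 5 * real k + 2 * real k * ?a" unfolding net_const_def by (simp only: algebra_simps)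
    ultimately show ?thesis by linarith
  qed
  finally show ?thesis by (simp only: distrib_left)
qed

text \<open>
  With a single block, \<open>k\<close> may be much larger than \<open>d\<close>; then \<open>N k\<close> is not \<open>O(d)\<close>, but the nets have
  dimension at most \<open>d\<close>, so \<open>L = O(d)\<close> and the product is \<open>O(k d)\<close>.
\<close>
lemma num_blocks_log_net_size_le:
  assumes k: "1 \<le> k" and d: "1 \<le> d"
  shows "real (num_blocks d k) * real k * log_net_size (num_blocks d k) k d
     \<le> 2 * net_const * (real d * (real k + ln (real d)))"
  using num_blocks_bound[of d k]
proof
  let ?L = "log_net_size (num_blocks d k) k d"
  assume N: "num_blocks d k = 1"
  have a: "0 \<le> ln net_base" by (intro ln_ge_zero) simp
  have "ln 3 \<le> (2::real)" using ln_le_minus_one[of 3] by simp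
  moreover have "2 * real (min k d) * ln net_base \<le> 2 * real d * ln net_base" using a by (intro mult_right_mono) auto
  moreover have "?L = ln 3 + 2 * real (min k d) * ln net_base"
    by (simp only: log_net_size_def N of_nat_1 mult_1_right)
  ultimately have "?L \<le> 2 + 2 * real d * ln net_base" by linarith
  also have "\<dots> \<le> net_const * real d"
  proof -
    have "net_const * real d = 5 * real d + 2 * real d * ln net_base" unfolding net_const_def by (simp only: algebra_simps)
    then show ?thesis using d by linarith
  qed
  finally have "real k * ?L \<le> real k * (net_const * real d)" by (intro mult_left_mono) auto
  also have "\<dots> = net_const * (real d * real k)" by simp
  also have "\<dots> \<le> 2 * net_const * (real d * (real k + ln (real d)))"
    using net_const_ge d by (intro mult_mono) auto
  finally show "real (num_blocks d k) * real k * ?L \<le> 2 * net_const * (real d * (real k + ln (real d)))" by (simp add: N)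
next
  let ?L = "log_net_size (num_blocks d k) k d"
  assume "num_blocks d k * k \<le> 2 * d"
  then have "real (num_blocks d k * k) \<le> real (2 * d)" by (rule of_nat_mono)
  then have "real (num_blocks d k) * real k * ?L \<le> (2 * real d) * (net_const * (real k + ln (real d)))"
    using log_net_size_le[OF k d] log_net_size_ge_1[OF num_blocks_pos, of d k k d]
      mult_mono[of "real (num_blocks d k) * real k" "2 * real d" ?L "net_const * (real k + ln (real d))"]
    by simp
  then show "real (num_blocks d k) * real k * ?L \<le> 2 * net_const * (real d * (real k + ln (real d)))" by (simp only: mult_ac)
qed

lemma risk_rate:
  assumes const: "0 < \<alpha>" "0 < K" "0 < M" "20 \<le> C"
  defines "A1 \<equiv> 144 * (3328 * K ^ 4 * (4 * net_const) * net_const)"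
    and "A2 \<equiv> 144 * (36 * C ^ 4 * K ^ 4 * 85 * (2 * net_const))"
    and "A3 \<equiv> 4 * (9 * ((32 * K ^ 4 + 1) * \<alpha> powr \<alpha>)\<^sup>2 + (7 * M / (1 - 2 powr (- \<alpha>)))\<^sup>2)"
  assumes d: "1 \<le> d" and n: "0 < n" and \<rho>: "0 < \<rho>" and log_d: "ln (real d) \<le> 3 * real n"
    and k: "1 \<le> k" "real k \<le> real n"
    and P: "P \<in> data_laws d K" and cov: "cov_mat P \<in> cov_class d \<alpha> M0 M"
  shows "dp_tri_risk n d k \<rho> (C * K * sqrt (real k)) P
     \<le> ennreal ((A1 + A2 + A3) * ((real k + ln (real d)) / real n
              + real d * real k * (real k + ln (real d)) / (\<rho> * (real n)\<^sup>2) + real k powr (- 2 * \<alpha>)))"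
proof -
  interpret subgaussian_law d K P using P const by unfold_locales
  let ?N = "num_blocks d k"
  let ?L = "log_net_size ?N k d"
  let ?R = "C * K * sqrt (real k)"
  define T1 where "T1 = (real k + ln (real d)) / real n"
  define T2 where "T2 = real d * real k * (real k + ln (real d)) / (\<rho> * (real n)\<^sup>2)"
  define T3 where "T3 = real k powr (- 2 * \<alpha>)"
  have lnd: "0 \<le> ln (real d)" using d by simp
  have T: "0 \<le> T1" "0 \<le> T2" "0 \<le> T3" using lnd \<rho> by (auto simp: T1_def T2_def T3_def)
  have nc: "0 < net_const" using net_const_ge by linarith
  have A: "0 \<le> A1" "0 \<le> A2" "0 \<le> A3" using nc const by (auto simp: A1_def A2_def A3_def)
  have L: "?L \<le> net_const * (real k + ln (real d))" by (rule log_net_size_le[OF k(1) d])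
  have LB: "?L \<le> (4 * net_const) * real n"
  proof -
    have "net_const * (real k + ln (real d)) \<le> net_const * (4 * real n)"
      using nc k(2) log_d by (intro mult_left_mono) auto
    then show ?thesis using L by simp
  qed
  have 1: "144 * (3328 * K ^ 4 * (4 * net_const) * ?L / real n) \<le> A1 * T1"
  proof -
    have "144 * (3328 * K ^ 4 * (4 * net_const)) / real n * ?L
        \<le> 144 * (3328 * K ^ 4 * (4 * net_const)) / real n * (net_const * (real k + ln (real d)))"
      using nc const by (intro mult_left_mono L) auto
    then show ?thesis by (simp add: A1_def T1_def mult_ac)
  qed
  have 2: "144 * (18 * ?R ^ 4 / (\<rho> / (2 * real ?N) * (real n)\<^sup>2)) * (85 * ?L) \<le> A2 * T2"
  proof -
    have "sqrt (real k) ^ 4 = (sqrt (real k) ^ 2) ^ 2" by (simp only: power_mult[symmetric]) simp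
    then have R4: "?R ^ 4 = C ^ 4 * K ^ 4 * (real k)\<^sup>2" by (simp add: power_mult_distrib)
    have "144 * (18 * ?R ^ 4 / (\<rho> / (2 * real ?N) * (real n)\<^sup>2)) * (85 * ?L)
        = 144 * (36 * C ^ 4 * K ^ 4 * 85) * real k / (\<rho> * (real n)\<^sup>2) * (real ?N * real k * ?L)"
      unfolding R4 using \<rho> n num_blocks_pos[of d k] by (simp add: field_simps power2_eq_square)
    also have "\<dots> \<le> 144 * (36 * C ^ 4 * K ^ 4 * 85) * real k / (\<rho> * (real n)\<^sup>2)
        * (2 * net_const * (real d * (real k + ln (real d))))"
      using const \<rho> by (intro mult_left_mono num_blocks_log_net_size_le[OF k(1) d]) auto
    also have "\<dots> = A2 * T2" by (simp add: A2_def T2_def mult_ac)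
    finally show ?thesis .
  qed
  have 3: "4 * (9 * ((32 * K ^ 4 + 1) * exp (- real k))\<^sup>2 + (7 * M / (1 - 2 powr (- \<alpha>)) * real k powr (- \<alpha>))\<^sup>2) \<le> A3 * T3"
  proof -
    have kk: "(real k powr (- \<alpha>))\<^sup>2 = T3" by (simp add: T3_def power2_eq_square powr_add[symmetric])
    have "((32 * K ^ 4 + 1) * exp (- real k))\<^sup>2 \<le> ((32 * K ^ 4 + 1) * (\<alpha> powr \<alpha> * real k powr (- \<alpha>)))\<^sup>2"
      using const k by (intro power_mono mult_left_mono exp_minus_le_powr) auto
    also have "\<dots> = ((32 * K ^ 4 + 1) * \<alpha> powr \<alpha>)\<^sup>2 * T3" by (simp only: power_mult_distrib kk mult_ac)
    finally have "4 * (9 * ((32 * K ^ 4 + 1) * exp (- real k))\<^sup>2 + (7 * M / (1 - 2 powr (- \<alpha>)) * real k powr (- \<alpha>))\<^sup>2)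
       \<le> 4 * (9 * (((32 * K ^ 4 + 1) * \<alpha> powr \<alpha>)\<^sup>2 * T3) + (7 * M / (1 - 2 powr (- \<alpha>)))\<^sup>2 * T3)"
      by (simp only: power_mult_distrib[of _ "real k powr (- \<alpha>)"] kk) simp
    also have "\<dots> = A3 * T3" by (simp only: A3_def algebra_simps)
    finally show ?thesis .
  qed
  have "dp_tri_risk n d k \<rho> ?R P \<le> ennreal (144 * (3328 * K ^ 4 * (4 * net_const) * ?L / real n)
     + 144 * (18 * ?R ^ 4 / (\<rho> / (2 * real ?N) * (real n)\<^sup>2)) * (85 * ?L)
     + 4 * (9 * ((32 * K ^ 4 + 1) * exp (- real k))\<^sup>2 + (7 * M / (1 - 2 powr (- \<alpha>)) * real k powr (- \<alpha>))\<^sup>2))"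
    using const net_const_ge by (intro risk_le[OF cov _ _ k(1) d n \<rho> _ _ LB]) auto
  also have "\<dots> \<le> ennreal (A1 * T1 + A2 * T2 + A3 * T3)" by (intro ennreal_leI add_mono 1 2 3)
  also have "\<dots> \<le> ennreal ((A1 + A2 + A3) * (T1 + T2 + T3))"
  proof (intro ennreal_leI)
    have "0 \<le> A1 * (T2 + T3) + A2 * (T1 + T3) + A3 * (T1 + T2)" using A T by (intro add_nonneg_nonneg mult_nonneg_nonneg)
    then show "A1 * T1 + A2 * T2 + A3 * T3 \<le> (A1 + A2 + A3) * (T1 + T2 + T3)" by (simp add: algebra_simps)
  qed
  finally show ?thesis by (simp only: T1_def T2_def T3_def)
qed

text \<open>
  Since \<open>d / (\<rho> n\<^sup>2)\<close> tends to 0 and \<open>\<rho>\<close> is bounded, \<open>d \<le> n\<^sup>3\<close> eventually.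
\<close>
lemma eventually_regime:
  fixes n d :: "nat \<Rightarrow> nat" and \<rho> :: "nat \<Rightarrow> real"
  assumes "0 < a" and n: "filterlim n at_top sequentially"
    and d: "\<forall>\<^sub>F m in sequentially. real (d m) \<ge> a * ln (real (n m))"
    and \<rho>: "\<forall>\<^sub>F m in sequentially. 0 < \<rho> m \<and> \<rho> m \<le> \<rho>max"
    and lim: "(\<lambda>m. real (d m) / (\<rho> m * (real (n m))\<^sup>2)) \<longlonglongrightarrow> 0"
  shows "\<forall>\<^sub>F m in sequentially. 1 \<le> d m \<and> 0 < n m \<and> 0 < \<rho> m \<and> ln (real (d m)) \<le> 3 * real (n m)"
proof -
  have "\<forall>\<^sub>F m in sequentially. real (d m) / (\<rho> m * (real (n m))\<^sup>2) < 1"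
    using lim by (rule order_tendstoD) simp
  moreover have "\<forall>\<^sub>F m in sequentially. max 2 (nat \<lceil>\<rho>max\<rceil>) \<le> n m"
    using n unfolding filterlim_at_top by blast
  ultimately show ?thesis using d \<rho>
  proof eventually_elim
    case (elim m)
    then have n2: "2 \<le> n m" and n\<rho>: "\<rho>max \<le> real (n m)" by linarith+
    have "0 < a * ln (real (n m))" using \<open>0 < a\<close> n2 by simp
    then have d1: "1 \<le> d m" using elim by linarith
    have "real (d m) < \<rho> m * (real (n m))\<^sup>2" using elim n2 by (simp add: divide_less_eq)
    also have "\<dots> \<le> real (n m) * (real (n m))\<^sup>2" using elim n\<rho> by (intro mult_right_mono) auto
    also have "\<dots> = real (n m) ^ 3" by (simp add: power2_eq_square power3_eq_cube)
    finally have "ln (real (d m)) \<le> ln (real (n m) ^ 3)" using d1 by (intro ln_mono) auto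
    also have "\<dots> = 3 * ln (real (n m))" using n2 by (simp add: ln_realpow)
    also have "\<dots> \<le> 3 * real (n m)" using ln_le_minus_one[of "real (n m)"] n2 by simp
    finally show ?case using d1 n2 elim by simp
  qed
qed

theorem theorem3p3:
  shows "\<exists>C0>0. \<exists>c>0. \<forall>C\<ge>C0. \<forall>\<alpha> K M0 M a \<rho>max :: real.
    0 < \<alpha> \<and> 0 < K \<and> 0 < M0 \<and> 0 < M \<and> 0 < a \<and> 0 < \<rho>max \<longrightarrow>
    (\<exists>C'>0. \<forall>(n :: nat \<Rightarrow> nat) (d :: nat \<Rightarrow> nat) (\<rho> :: nat \<Rightarrow> real).
      filterlim n at_top sequentially \<and>
      (\<forall>\<^sub>F m in sequentially. real (d m) \<ge> a * ln (real (n m))) \<and>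
      (\<forall>\<^sub>F m in sequentially. 0 < \<rho> m \<and> \<rho> m \<le> \<rho>max) \<and>
      (\<lambda>m. real (d m) / (\<rho> m * (real (n m))\<^sup>2)) \<longlonglongrightarrow> 0 \<longrightarrow>
      (\<forall>\<^sub>F m in sequentially. \<forall>k P.
        1 \<le> k \<and> real k \<le> c * real (n m) \<and>
        P \<in> data_laws (d m) K \<and> cov_mat P \<in> cov_class (d m) \<alpha> M0 M \<longrightarrow>
        dp_tri_risk (n m) (d m) k (\<rho> m) (C * K * sqrt (real k)) P
          \<le> ennreal (C' * ((real k + ln (real (d m))) / real (n m)
              + real (d m) * real k * (real k + ln (real (d m))) / (\<rho> m * (real (n m))\<^sup>2)
              + real k powr (- 2 * \<alpha>)))))"
proof (rule exI[of _ "20::real"], rule conjI, simp, rule exI[of _ "1::real"], rule conjI, simp, intro allI impI, (elim conjE)?)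
  \<comment> \<open>The witness 20 is the threshold of \<open>norm_tail\<close>; \<open>k \<le> n\<close> suffices because the constants in
    \<open>sampling_error\<close> adapt to any linear bound on \<open>k\<close>.\<close>
  fix C \<alpha> K M0 M a \<rho>max :: real
  assume C: "20 \<le> C" and \<alpha>: "0 < \<alpha>" and K: "0 < K" and M: "0 < M" and a: "0 < a"
  define C' where "C' = 144 * (3328 * K ^ 4 * (4 * net_const) * net_const)
    + 144 * (36 * C ^ 4 * K ^ 4 * 85 * (2 * net_const))
    + 4 * (9 * ((32 * K ^ 4 + 1) * \<alpha> powr \<alpha>)\<^sup>2 + (7 * M / (1 - 2 powr (- \<alpha>)))\<^sup>2)"
  have "0 < C'"
  proof -
    have "0 < net_const" using net_const_ge by linarith
    then show ?thesis unfolding C'_def using K C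
      by (intro add_pos_nonneg add_nonneg_nonneg mult_pos_pos mult_nonneg_nonneg) auto
  qed
  show "\<exists>C'>0. \<forall>(n :: nat \<Rightarrow> nat) (d :: nat \<Rightarrow> nat) (\<rho> :: nat \<Rightarrow> real).
      filterlim n at_top sequentially \<and>
      (\<forall>\<^sub>F m in sequentially. real (d m) \<ge> a * ln (real (n m))) \<and>
      (\<forall>\<^sub>F m in sequentially. 0 < \<rho> m \<and> \<rho> m \<le> \<rho>max) \<and>
      (\<lambda>m. real (d m) / (\<rho> m * (real (n m))\<^sup>2)) \<longlonglongrightarrow> 0 \<longrightarrow>
      (\<forall>\<^sub>F m in sequentially. \<forall>k P.
        1 \<le> k \<and> real k \<le> 1 * real (n m) \<and>
        P \<in> data_laws (d m) K \<and> cov_mat P \<in> cov_class (d m) \<alpha> M0 M \<longrightarrow>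
        dp_tri_risk (n m) (d m) k (\<rho> m) (C * K * sqrt (real k)) P
          \<le> ennreal (C' * ((real k + ln (real (d m))) / real (n m)
              + real (d m) * real k * (real k + ln (real (d m))) / (\<rho> m * (real (n m))\<^sup>2)
              + real k powr (- 2 * \<alpha>))))"
  proof (rule exI[of _ C'], rule conjI[OF \<open>0 < C'\<close>], intro allI impI, elim conjE)
    fix n d :: "nat \<Rightarrow> nat" and \<rho> :: "nat \<Rightarrow> real"
    assume "filterlim n at_top sequentially" "\<forall>\<^sub>F m in sequentially. real (d m) \<ge> a * ln (real (n m))"
      "\<forall>\<^sub>F m in sequentially. 0 < \<rho> m \<and> \<rho> m \<le> \<rho>max" "(\<lambda>m. real (d m) / (\<rho> m * (real (n m))\<^sup>2)) \<longlonglongrightarrow> 0"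
    from eventually_regime[OF a this]
    show "\<forall>\<^sub>F m in sequentially. \<forall>k P.
        1 \<le> k \<and> real k \<le> 1 * real (n m) \<and>
        P \<in> data_laws (d m) K \<and> cov_mat P \<in> cov_class (d m) \<alpha> M0 M \<longrightarrow>
        dp_tri_risk (n m) (d m) k (\<rho> m) (C * K * sqrt (real k)) P
          \<le> ennreal (C' * ((real k + ln (real (d m))) / real (n m)
              + real (d m) * real k * (real k + ln (real (d m))) / (\<rho> m * (real (n m))\<^sup>2)
              + real k powr (- 2 * \<alpha>)))"
    proof eventually_elim
      case (elim m)
      show ?case
      proof (intro allI impI, elim conjE)
        fix k P
        assume "1 \<le> k" "real k \<le> 1 * real (n m)" "P \<in> data_laws (d m) K" "cov_mat P \<in> cov_class (d m) \<alpha> M0 M"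
        then show "dp_tri_risk (n m) (d m) k (\<rho> m) (C * K * sqrt (real k)) P
          \<le> ennreal (C' * ((real k + ln (real (d m))) / real (n m)
              + real (d m) * real k * (real k + ln (real (d m))) / (\<rho> m * (real (n m))\<^sup>2)
              + real k powr (- 2 * \<alpha>)))"
          unfolding C'_def using elim by (intro risk_rate[OF \<alpha> K M C]) auto
      qed
    qed
  qed
qed

end
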